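(* Let $P>0$. Let $p:(-1,1)\to\mathbb{R}$ be a given piecewise Lipschitz-continuous function, extended to $\mathbb{R}$ by $2$-periodicity. For $n\geq 1$, let $f_n:(-1,1)\to\mathbb{R}$ be the $2/n$-periodic piecewise Lipschitz-continuous function defined on $(-1,1)$ by $f_n(x):=p(nx)$, and let $t_n\in\bigcup_{q>1}L^q(-1,1)$ be the unique nonpositive solution of total mass $-P$ (that is, $\int_{-1}^1t_n\,\mathrm{d}x=-P$) of the equation $$-\frac{1}{\pi}\,\mathrm{pv}\frac{1}{x} * t_n + f_n\,t_n = 0\qquad \text{in }\mathscr{D}'((-1,1)).$$ Let $f_{\rm eff}$ be the constant $$f_{\rm eff} := \tan \bigl\langle \arctan f_1 \bigr\rangle,$$ where $\langle h\rangle := \frac12\int_{-1}^1 h\,\mathrm{d}x$, and let $t_{\rm eff}$ be the unique solution of the problem associated with the constant $f_{\rm eff}$: $$t_{\rm eff}(x) := -\frac{P}{\pi\sqrt{1+f_{\rm eff}^2}\,(1+x)^{1/2+\alpha_{\rm eff}}(1-x)^{1/2-\alpha_{\rm eff}}},\qquad \alpha_{\rm eff} :=\tfrac{1}{\pi}\arctan f_{\rm eff}.$$ Then the sequences $(t_n)$ and $(f_nt_n)$ converge weakly in $L^q(-1,1)$, respectively towards $t_{\rm eff}$ and $f_{\rm eff}t_{\rm eff}$, for all $q\in \bigl(1,(1/2+\beta)^{-1}\bigr)$, where $$\beta := \frac{1}{\pi}\arctan \bigl\|f_1\bigr\|_{L^\infty(-1,1)} < \frac{1}{2}.$$ In particular,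 $-\int_{-1}^{1}f_nt_n\,\mathrm{d}x$ converges towards $f_{\rm eff}P$ as $n\to\infty$.
   Context: $\mathrm{pv}\frac1x$ denotes the distributional derivative of $\log|x|$ on $\mathbb{R}$, $*$ is convolution on $\mathbb{R}$, and $t_n$ is extended by zero to $\mathbb{R}$ in the convolution. Piecewise Lipschitz-continuous on $(-1,1)$ means Lipschitz-continuous on each interval of some finite subdivision of $(-1,1)$. For every piecewise Lipschitz-continuous $f:(-1,1)\to\mathbb{R}$ and $P>0$ there is exactly one nonpositive $t\in\bigcup_{q>1}L^q(-1,1)$ with $\int_{-1}^1 t\,\mathrm{d}x=-P$ and $-\frac1\pi\mathrm{pv}\frac1x*t+ft=0$ in $\mathscr{D}'((-1,1))$; this is what makes $t_n$ well defined. *)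

theory Defs
  imports "HOL-Analysis.Analysis" "HOL-Probability.Essential_Supremum"
begin

abbreviation itv :: "real set" where
  "itv \<equiv> {-1<..<1}"

abbreviation leb_itv :: "real measure" where
  "leb_itv \<equiv> lebesgue_on itv"

text \<open>Elements of \<open>Lq q\<close> are functions, not equivalence classes; accordingly, uniqueness is
  always understood almost everywhere.  Values outside (-1,1) play no role.\<close>

definition Lq :: "real \<Rightarrow> (real \<Rightarrow> real) set" where
  "Lq q = {u. u \<in> borel_measurable leb_itv \<and> integrable leb_itv (\<lambda>x. \<bar>u x\<bar> powr q)}"

definition Linf_norm :: "(real \<Rightarrow> real) \<Rightarrow> real" where
  "Linf_norm g = real_of_ereal (esssup leb_itv (\<lambda>x. ereal \<bar>g x\<bar>))"

text \<open>Weak convergence in \<open>L\<^sup>q\<close> for \<open>1 < q < \<infinity>\<close>, tested against the dual space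
  \<open>L\<^sup>q\<^sup>'\<close> with \<open>q' = q / (q - 1)\<close>.  Sequences are indexed by \<open>n \<ge> 1\<close>.\<close>

definition weakly_converges :: "real \<Rightarrow> (nat \<Rightarrow> real \<Rightarrow> real) \<Rightarrow> (real \<Rightarrow> real) \<Rightarrow> bool" where
  "weakly_converges q u v \<longleftrightarrow>
     (\<forall>n\<ge>1. u n \<in> Lq q) \<and> v \<in> Lq q \<and>
     (\<forall>g\<in>Lq (q / (q - 1)).
        (\<lambda>n. LINT x|leb_itv. u n x * g x) \<longlonglongrightarrow> (LINT x|leb_itv. v x * g x))"

definition piecewise_lipschitz :: "(real \<Rightarrow> real) \<Rightarrow> bool" where
  "piecewise_lipschitz g \<longleftrightarrow>
     (\<exists>(m::nat) (a::nat \<Rightarrow> real). a 0 = -1 \<and> a m = 1 \<and>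
        (\<forall>i<m. a i < a (Suc i) \<and> (\<exists>L. L-lipschitz_on {a i<..<a (Suc i)} g)))"

text \<open>A distribution is represented by its action on real test functions.\<close>

type_synonym distribution = "(real \<Rightarrow> real) \<Rightarrow> real"

definition test_functions :: "real set \<Rightarrow> (real \<Rightarrow> real) set" where
  "test_functions U = {\<phi>. (\<forall>k x. (deriv ^^ k) \<phi> field_differentiable (at x)) \<and>
     compact (closure {x. \<phi> x \<noteq> 0}) \<and> closure {x. \<phi> x \<noteq> 0} \<subseteq> U}"

definition distr_of :: "(real \<Rightarrow> real) \<Rightarrow> distribution" where
  "distr_of g = (\<lambda>\<phi>. LINT x|lebesgue. g x * \<phi> x)"

definition distr_deriv :: "distribution \<Rightarrow> distribution" where
  "distr_deriv T = (\<lambda>\<phi>. - T (deriv \<phi>))"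

definition pv_inverse :: distribution where
  "pv_inverse = distr_deriv (distr_of (\<lambda>x. ln \<bar>x\<bar>))"

text \<open>Convolution of a distribution on the real line with a compactly supported integrable
  function \<open>u\<close>: \<open>\<langle>T * u, \<phi>\<rangle> = \<langle>T\<^sub>x, \<langle>u\<^sub>y, \<phi>(x + y)\<rangle>\<rangle>\<close>.\<close>

definition distr_conv :: "distribution \<Rightarrow> (real \<Rightarrow> real) \<Rightarrow> distribution" where
  "distr_conv T u = (\<lambda>\<phi>. T (\<lambda>x. LINT y|lebesgue. u y * \<phi> (x + y)))"

definition zero_ext :: "(real \<Rightarrow> real) \<Rightarrow> real \<Rightarrow> real" where
  "zero_ext g x = (if x \<in> itv then g x else 0)"

text \<open>\<open>is_solution P f t\<close>: \<open>t\<close> is a nonpositive solution, of total mass \<open>-P\<close> and in the union of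
  the spaces \<open>Lq q\<close> over \<open>q > 1\<close>, of the problem with coefficient \<open>f\<close>.\<close>

definition is_solution :: "real \<Rightarrow> (real \<Rightarrow> real) \<Rightarrow> (real \<Rightarrow> real) \<Rightarrow> bool" where
  "is_solution P f t \<longleftrightarrow>
     t \<in> (\<Union>q\<in>{1<..}. Lq q) \<and>
     (AE x in leb_itv. t x \<le> 0) \<and>
     (LINT x|leb_itv. t x) = - P \<and>
     (\<forall>\<phi>\<in>test_functions itv.
        - (1 / pi) * distr_conv pv_inverse (zero_ext t) \<phi>
        + distr_of (zero_ext (\<lambda>x. f x * t x)) \<phi> = 0)"

definition rescale :: "(real \<Rightarrow> real) \<Rightarrow> nat \<Rightarrow> real \<Rightarrow> real" where
  "rescale p n x = p (real n * x)"

definition mean :: "(real \<Rightarrow> real) \<Rightarrow> real" where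
  "mean h = 1 / 2 * (LINT x|leb_itv. h x)"

definition f_eff :: "(real \<Rightarrow> real) \<Rightarrow> real" where
  "f_eff p = tan (mean (\<lambda>x. arctan (rescale p 1 x)))"

definition alpha :: "real \<Rightarrow> real" where
  "alpha c = 1 / pi * arctan c"

definition const_solution :: "real \<Rightarrow> real \<Rightarrow> real \<Rightarrow> real" where
  "const_solution P c x =
     - (P / (pi * sqrt (1 + c\<^sup>2) * (1 + x) powr (1/2 + alpha c) * (1 - x) powr (1/2 - alpha c)))"

definition t_eff :: "real \<Rightarrow> (real \<Rightarrow> real) \<Rightarrow> real \<Rightarrow> real" where
  "t_eff P p = const_solution P (f_eff p)"

definition beta :: "(real \<Rightarrow> real) \<Rightarrow> real" where
  "beta p = 1 / pi * arctan (Linf_norm (rescale p 1))"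

end

theory Submission
  imports Defs "HOL-Complex_Analysis.Complex_Analysis" "HOL-Real_Asymp.Real_Asymp"
begin

text \<open>
  After the substitution \<open>x = cos \<theta>\<close> the equation is a statement about Fourier coefficients.  On the half
  circle put \<open>U \<theta> = - t (cos \<theta>) sin \<theta>\<close>, which is nonnegative with integral \<open>P\<close>, and
  \<open>b \<theta> = f (cos \<theta>)\<close>.  The kernel \<open>ln \<bar>cos \<theta> - cos \<eta>\<bar>\<close> has the cosine coefficients
  \<open>- (\<pi> / k) cos (k \<eta>)\<close>, so the equation tested against \<open>sin (k \<theta>)\<close> becomes
  \<open>\<integral> U (cos (k \<theta>) + b sin (k \<theta>)) = 0\<close> for all \<open>k \<ge> 1\<close> (\<open>solution_boundary_data\<close>, with
  the converse \<open>boundary_data_solution\<close>).  This says that \<open>U (1 - \<i> b)\<close>, continued to the lower half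
  circle by conjugation, has no Fourier coefficients of negative index: it is the boundary value of a
  function \<open>G\<close> that is holomorphic in the unit disc, has real Taylor coefficients and satisfies
  \<open>G 0 = P / \<pi>\<close>.  If \<open>\<bar>b\<bar> \<le> M\<close>, then \<open>U \<ge> 0\<close> and the Poisson formula keep \<open>G\<close> in the sector
  \<open>\<bar>Im G\<bar> \<le> M Re G\<close> of the right half plane.  Hence \<open>h = Ln G - ln (P / \<pi>)\<close> is holomorphic with
  \<open>\<bar>Im h\<bar> \<le> arctan M\<close>, and everything follows from a study of \<open>h\<close>.

  First, the boundary values of \<open>Im h\<close> are \<open>- arctan b\<close>, so the Taylor coefficients of \<open>h\<close> are linear
  functionals of \<open>arctan b\<close> (\<open>log_series_coeff\<close>).  Because \<open>G = (P / \<pi>) exp h\<close>, the Taylor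
  coefficients of \<open>G\<close>, which are the cosine moments of \<open>U\<close>, are polynomials in those of \<open>h\<close>
  (\<open>exp_series_recursion\<close>).  So the moments of \<open>t\<close> are determined by \<open>f\<close> and depend continuously on
  \<open>arctan f\<close> for weak convergence (\<open>moments_tendsto\<close>).  This gives uniqueness, and it explains the
  effective coefficient: the functions \<open>arctan (p (n x))\<close> converge weakly to their mean
  (\<open>periodic_mean_tendsto\<close>), which is the arctangent of \<open>f_eff p\<close>.

  Secondly, the mean value property of \<open>exp (s h)\<close>, whose argument stays away from \<open>\<pi> / 2\<close> as long as
  \<open>s arctan M < \<pi> / 2\<close>, bounds \<open>\<integral> U\<^sup>s\<close> by a constant that depends only on \<open>P\<close>, \<open>M\<close> and \<open>s\<close>
  (\<open>power_bound\<close>).  Returning to the variable \<open>x\<close> costs a power of the sine, and what remains is a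
  bound of the solutions in \<open>L\<^sup>q\<close> for all \<open>1 < q < 1 / (1/2 + \<beta>)\<close> (\<open>Lq_uniform_bound\<close>).

  Thirdly, for a constant coefficient \<open>c = tan (\<pi> \<alpha>)\<close> the function \<open>G\<close> is
  \<open>(P / \<pi>) ((1 - w) / (1 + w))\<close> to the power \<open>2 \<alpha>\<close>, and its boundary values give the explicit
  solution (\<open>constant_boundary_data\<close>).

  Convergence of all polynomial moments together with the uniform bound gives the weak convergence
  of \<open>t n\<close>.  The same works for the products with the coefficients, because the equation expresses the
  sine moments of \<open>b U\<close> through the cosine moments of \<open>U\<close>.
\<close>

section \<open>Fourier series on the half circle\<close>

text \<open>The interval \<open>(0, \<pi>)\<close> stands for the upper half of the unit circle.  All functions on the circle
  that occur below have an even real part and an odd imaginary part, so that half of it suffices.\<close>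
abbreviation angles :: "real measure" where
  "angles \<equiv> lebesgue_on {0<..<pi}"

interpretation angles: finite_measure angles
  by (rule finite_measure_lebesgue_on) simp

interpretation angles2: pair_sigma_finite angles angles ..

lemma measure_angles [simp]: "measure angles {0<..<pi} = pi"
  by (simp add: measure_restrict_space)

lemma integrable_angles_continuous:
  fixes g :: "real \<Rightarrow> 'a::euclidean_space"
  assumes "continuous_on {0..pi} g"
  shows "integrable angles g"
proof -
  have "g absolutely_integrable_on {0<..<pi}"
    by (metis absolutely_integrable_continuous_real assms absolutely_integrable_on_Icc_iff_Ioo)
  then show ?thesis
    by (simp add: integrable_restrict_space set_integrable_def)
qed

lemma measurable_angles_continuous:
  fixes g :: "real \<Rightarrow> real"
  assumes "continuous_on {0..pi} g"
  shows "g \<in> borel_measurable angles"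
  using integrable_angles_continuous[OF assms] by simp

lemma trig_measurable [measurable]:
  "sin \<in> borel_measurable angles" "cos \<in> borel_measurable angles"
  by (intro measurable_angles_continuous continuous_intros)+

lemma continuous_bounded_Icc:
  fixes f :: "real \<Rightarrow> real"
  assumes "continuous_on {a..b} f"
  shows "\<exists>B>0. \<forall>x\<in>{a..b}. \<bar>f x\<bar> \<le> B"
proof -
  have "bounded (f ` {a..b})" by (intro compact_imp_bounded compact_continuous_image assms) auto
  then show ?thesis by (force simp: bounded_pos)
qed

lemma integrable_mult_bounded:
  fixes v f :: "'a \<Rightarrow> real"
  assumes v: "integrable M v" and f: "f \<in> borel_measurable M" "AE x in M. \<bar>f x\<bar> \<le> C"
  shows "integrable M (\<lambda>x. v x * f x)"
proof (rule Bochner_Integration.integrable_bound[OF integrable_mult_left[OF v, of C]])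
  show "(\<lambda>x. v x * f x) \<in> borel_measurable M"
    using v f(1) by measurable
  show "AE x in M. norm (v x * f x) \<le> norm (v x * C)"
    using f(2) by eventually_elim (simp add: abs_mult mult_left_mono)
qed

lemma integrable_mult_continuous:
  fixes v e :: "real \<Rightarrow> real"
  assumes "integrable angles v" "continuous_on {0..pi} e"
  shows "integrable angles (\<lambda>x. v x * e x)"
proof -
  obtain B where "\<And>x. x \<in> {0..pi} \<Longrightarrow> \<bar>e x\<bar> \<le> B"
    using continuous_bounded_Icc[OF assms(2)] by blast
  then show ?thesis
    by (intro integrable_mult_bounded[where C = B] assms measurable_angles_continuous AE_I2) auto
qed

lemma integral_angles_continuous:
  fixes g :: "real \<Rightarrow> real"
  assumes "continuous_on {0..pi} g" and "(g has_integral I) {0..pi}"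
  shows "(LINT x|angles. g x) = I"
proof -
  have "(LINT x|angles. g x) = integral {0<..<pi} g"
    by (rule lebesgue_integral_eq_integral) (auto intro: integrable_angles_continuous assms)
  also have "\<dots> = I"
    using assms(2) by (metis has_integral_Icc_iff_Ioo integral_unique)
  finally show ?thesis .
qed

lemma integral_angles_cos_int:
  fixes k :: int
  shows "(LINT x|angles. cos (k * x)) = (if k = 0 then pi else 0)"
proof (cases "k = 0")
  case True
  show ?thesis unfolding True
    by (rule integral_angles_continuous) (use has_integral_const_real[of "1::real" 0 pi] in auto)
next
  case False
  have "((\<lambda>x. cos (real_of_int k * x)) has_integral (sin (real_of_int k * pi) / real_of_int k - sin (real_of_int k * 0) / real_of_int k)) {0..pi}"
    by (rule fundamental_theorem_of_calculus)
       (use False pi_ge_zero in \<open>auto intro!: derivative_eq_intros simp flip: has_real_derivative_iff_has_vector_derivative\<close>)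
  moreover have "sin (k * pi) = 0"
    using sin_integer_2pi sin_times_pi_eq_0 by auto
  ultimately have "((\<lambda>x. cos (k * x)) has_integral 0) {0..pi}" by simp
  then show ?thesis using False
    by (simp add: integral_angles_continuous continuous_intros)
qed

lemma integral_angles_cos_cos:
  "(LINT x|angles. cos (real m * x) * cos (real n * x)) =
     (if m = n then if m = 0 then pi else pi/2 else 0)"
proof -
  have eq: "cos (real m * x) * cos (real n * x) =
      (cos (real_of_int (int m - int n) * x) + cos (real_of_int (int m + int n) * x)) / 2" for x
    by (simp add: cos_times_cos algebra_simps)
  have I: "integrable angles (\<lambda>x. cos (real_of_int k * x))" for k :: int
    by (intro integrable_angles_continuous continuous_intros)
  show ?thesis
    unfolding eq by (simp add: I integral_angles_cos_int del: of_int_add of_int_diff)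
qed

lemma integral_angles_sin_sin:
  "(LINT x|angles. sin (real m * x) * sin (real n * x)) =
     (if m = n then if m = 0 then 0 else pi/2 else 0)"
proof -
  have eq: "sin (real m * x) * sin (real n * x) =
      (cos (real_of_int (int m - int n) * x) - cos (real_of_int (int m + int n) * x)) / 2" for x
    by (simp add: sin_times_sin algebra_simps)
  have I: "integrable angles (\<lambda>x. cos (real_of_int k * x))" for k :: int
    by (intro integrable_angles_continuous continuous_intros)
  show ?thesis
    unfolding eq by (simp add: I integral_angles_cos_int del: of_int_add of_int_diff)
qed

text \<open>Orthogonality, applied to absolutely convergent series; termwise integration is justified by the
  summability of the coefficients.\<close>
lemma
  fixes d :: "nat \<Rightarrow> real"
  assumes "summable (\<lambda>k. \<bar>d k\<bar>)"
  shows integral_cos_series: "(LINT x|angles. (\<Sum>k. d k * cos (real k * x)) * cos (real n * x)) =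
            (if n = 0 then pi else pi/2) * d n"
    and integral_sin_series: "n > 0 \<Longrightarrow> (LINT x|angles. (\<Sum>k. d k * sin (real k * x)) * sin (real n * x)) =
            pi/2 * d n"
proof -
  have gen: "(LINT x|angles. (\<Sum>k. d k * e (real k * x)) * e (real n * x)) =
      (\<Sum>k. d k * (LINT x|angles. e (real k * x) * e (real n * x)))"
    if e: "e = sin \<or> e = cos" for e :: "real \<Rightarrow> real"
  proof -
    have le: "\<bar>e x\<bar> \<le> 1" for x using e by auto
    have cont: "continuous_on A (\<lambda>x. e (c * x))" for c A
      using e by (auto intro!: continuous_intros)
    have bnd: "norm (d k * (e (real k * x) * e (real n * x))) \<le> \<bar>d k\<bar>" for k x
      using le[of "real k * x"] le[of "real n * x"]
      by (simp add: abs_mult mult_le_one mult_left_le)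
    have "(\<Sum>k. d k * e (real k * x)) * e (real n * x) =
          (\<Sum>k. d k * (e (real k * x) * e (real n * x)))" for x
    proof -
      have "summable (\<lambda>k. d k * e (real k * x))"
        by (rule summable_comparison_test'[OF assms, of 0]) (simp add: abs_mult le mult_left_le)
      then show ?thesis by (simp add: suminf_mult2 mult.assoc)
    qed
    then have "(LINT x|angles. (\<Sum>k. d k * e (real k * x)) * e (real n * x)) =
          (LINT x|angles. (\<Sum>k. d k * (e (real k * x) * e (real n * x))))" by simp
    also have "\<dots> = (\<Sum>k. LINT x|angles. d k * (e (real k * x) * e (real n * x)))"
    proof (rule integral_suminf)
      show "integrable angles (\<lambda>x. d k * (e (real k * x) * e (real n * x)))" for k
        by (intro integrable_angles_continuous continuous_intros cont)
      show "AE x in angles. summable (\<lambda>k. norm (d k * (e (real k * x) * e (real n * x))))"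
        by (rule AE_I2, rule summable_comparison_test'[OF assms, of 0]) (use bnd in simp)
      have "(LINT x|angles. norm (d k * (e (real k * x) * e (real n * x)))) \<le> (LINT x|angles. \<bar>d k\<bar>)" for k
        by (rule integral_mono)
           (use bnd in \<open>auto intro!: integrable_angles_continuous continuous_intros cont\<close>)
      then show "summable (\<lambda>k. LINT x|angles. norm (d k * (e (real k * x) * e (real n * x))))"
        by (intro summable_comparison_test'[OF summable_mult[OF assms, of pi], of 0]) simp
    qed
    finally show ?thesis by simp
  qed
  show "(LINT x|angles. (\<Sum>k. d k * cos (real k * x)) * cos (real n * x)) =
            (if n = 0 then pi else pi/2) * d n"
    unfolding gen[of cos, simplified] integral_angles_cos_cos
    using suminf_finite[of "{n}" "\<lambda>k. d k * (if k = n then if k = 0 then pi else pi / 2 else 0)"] by auto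
  show "(LINT x|angles. (\<Sum>k. d k * sin (real k * x)) * sin (real n * x)) = pi/2 * d n" if "n > 0"
    unfolding gen[of sin, simplified] integral_angles_sin_sin
    using suminf_finite[of "{n}" "\<lambda>k. d k * (if k = n then if k = 0 then 0 else pi / 2 else 0)"] that by auto
qed

text \<open>Radii of circles that exhaust the unit disc.\<close>
definition radius :: "nat \<Rightarrow> real" where
  "radius j = 1 - inverse (real (Suc j))"

lemma radius_bounds: "0 \<le> radius j" "radius j < 1"
  by (auto simp: radius_def field_simps)

lemma radius_tendsto: "radius \<longlonglongrightarrow> 1"
  using tendsto_diff[OF tendsto_const[of 1] LIMSEQ_inverse_real_of_nat] by (simp add: radius_def[abs_def])

section \<open>Power series with real coefficients\<close>

text \<open>Functions that take conjugate values at conjugate points.  Their values on a circle are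
  determined by the upper half: the real part is a cosine series, the imaginary part a sine series.\<close>
definition real_series :: "(nat \<Rightarrow> real) \<Rightarrow> (complex \<Rightarrow> complex) \<Rightarrow> bool" where
  "real_series c F \<longleftrightarrow> (\<forall>w. norm w < 1 \<longrightarrow> (\<lambda>k. of_real (c k) * w ^ k) sums F w)"

text \<open>Averaging the Taylor series of \<open>F\<close> with its conjugate replaces every coefficient by its real part.\<close>
lemma real_series_exists:
  assumes hol: "F holomorphic_on ball 0 1"
    and sym: "\<And>w. norm w < 1 \<Longrightarrow> F (cnj w) = cnj (F w)"
  shows "\<exists>c. real_series c F"
proof -
  define a where "a k = (deriv ^^ k) F 0 / fact k" for k
  have s: "(\<lambda>k. a k * w ^ k) sums F w" if "norm w < 1" for w
    using holomorphic_power_series[OF hol, of w] that by (simp add: a_def)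
  have "(\<lambda>k. of_real (Re (a k)) * w ^ k) sums F w" if w: "norm w < 1" for w
  proof -
    have "(\<lambda>k. cnj (a k * cnj w ^ k)) sums cnj (F (cnj w))"
      using s[of "cnj w"] w by (simp only: sums_cnj complex_mod_cnj)
    then have "(\<lambda>k. cnj (a k) * w ^ k) sums F w"
      using sym[OF w] by simp
    from sums_divide[OF sums_add[OF s[OF w] this], of 2]
    show ?thesis by (simp add: complex_add_cnj flip: distrib_right)
  qed
  then have "real_series (\<lambda>k. Re (a k)) F" by (simp add: real_series_def)
  then show ?thesis by (rule exI[of _ "\<lambda>k. Re (a k)"])
qed

lemma real_series_0: "real_series c F \<Longrightarrow> F 0 = of_real (c 0)"
  using sums_unique2[OF _ powser_sums_zero[of "\<lambda>k. of_real (c k)"], of "F 0"]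
  by (auto simp: real_series_def dest!: spec[of _ 0])

lemma real_series_summable:
  assumes "real_series c F" "0 \<le> r" "r < 1"
  shows "summable (\<lambda>k. \<bar>c k * r ^ k\<bar>)"
proof -
  define s where "s = (1 + r) / 2"
  have s: "0 \<le> s" "s < 1" "r < s" using assms by (auto simp: s_def)
  then have "norm (of_real s :: complex) < 1" by simp
  then have "summable (\<lambda>k. of_real (c k) * (of_real s :: complex) ^ k)"
    using assms(1) unfolding real_series_def by (blast intro: sums_summable)
  moreover have "norm (of_real r :: complex) < norm (of_real s :: complex)"
    using s assms by simp
  ultimately have "summable (\<lambda>k. norm (of_real (c k) * (of_real r :: complex) ^ k))"
    by (rule powser_insidea)
  then show ?thesis
    using assms(2) by (simp add: norm_mult norm_power abs_mult)
qed

lemma real_series_polar: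
  assumes "real_series c F" "0 \<le> r" "r < 1"
  shows "Re (F (rcis r x)) = (\<Sum>k. c k * r ^ k * cos (real k * x))"
    and "Im (F (rcis r x)) = (\<Sum>k. c k * r ^ k * sin (real k * x))"
proof -
  have "(\<lambda>k. of_real (c k) * rcis r x ^ k) sums F (rcis r x)"
    using assms unfolding real_series_def by auto
  from sums_Re[OF this] sums_Im[OF this]
  show "Re (F (rcis r x)) = (\<Sum>k. c k * r ^ k * cos (real k * x))"
    and "Im (F (rcis r x)) = (\<Sum>k. c k * r ^ k * sin (real k * x))"
    by (auto simp: DeMoivre2 sums_iff mult.assoc)
qed

lemma
  assumes F: "real_series c F" and r: "0 \<le> r" "r < 1"
  shows real_series_Im_coeff:
      "n > 0 \<Longrightarrow> (LINT x|angles. Im (F (rcis r x)) * sin (real n * x)) = pi/2 * (c n * r ^ n)"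
    and real_series_mean: "(LINT x|angles. Re (F (rcis r x))) = pi * Re (F 0)"
proof -
  note s = real_series_summable[OF F r] and p = real_series_polar[OF F r]
  show "n > 0 \<Longrightarrow> (LINT x|angles. Im (F (rcis r x)) * sin (real n * x)) = pi/2 * (c n * r ^ n)"
    unfolding p by (rule integral_sin_series[OF s])
  show "(LINT x|angles. Re (F (rcis r x))) = pi * Re (F 0)"
    using integral_cos_series[OF s, of 0] real_series_0[OF F] unfolding p by simp
qed

lemma real_series_has_fps_expansion:
  assumes "real_series c F"
  shows "F has_fps_expansion Abs_fps (\<lambda>k. of_real (c k))"
proof -
  have s: "(\<lambda>k. fps_nth (Abs_fps (\<lambda>k. of_real (c k))) k * w ^ k) sums F w" if "norm w < 1" for w
    using assms that by (simp add: real_series_def)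
  have "ereal 1 \<le> fps_conv_radius (Abs_fps (\<lambda>k. of_real (c k) :: complex))"
    unfolding fps_conv_radius_def
  proof (rule conv_radius_geI_ex)
    fix r :: real assume r: "0 < r" "ereal r < ereal 1"
    then show "\<exists>z::complex. norm z = r \<and> summable (\<lambda>n. fps_nth (Abs_fps (\<lambda>k. of_real (c k))) n * z ^ n)"
      using s[of "of_real r"] by (intro exI[of _ "of_real r"]) (simp add: sums_iff)
  qed
  moreover have "\<forall>\<^sub>F z in nhds 0. eval_fps (Abs_fps (\<lambda>k. of_real (c k))) z = F z"
    by (rule eventually_mono[OF eventually_nhds_in_open[of "ball 0 1"]])
       (use s in \<open>auto simp: eval_fps_def sums_iff\<close>)
  moreover have "(0::ereal) < ereal 1" by simp
  ultimately show ?thesis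
    unfolding has_fps_expansion_def using less_le_trans by blast
qed

text \<open>Compare coefficients in \<open>G' = h' G\<close>.\<close>
lemma exp_series_recursion:
  assumes G: "real_series g G" and h: "real_series c h"
    and eq: "\<And>w. norm w < 1 \<Longrightarrow> G w = A * exp (h w)"
    and hol: "h holomorphic_on ball 0 1"
  shows "real (Suc n) * g (Suc n) = (\<Sum>i\<le>n. real (Suc i) * c (Suc i) * g (n - i))"
proof -
  let ?g = "Abs_fps (\<lambda>k. of_real (g k) :: complex)" and ?c = "Abs_fps (\<lambda>k. of_real (c k) :: complex)"
  note eg = real_series_has_fps_expansion[OF G] and ec = real_series_has_fps_expansion[OF h]
  have "deriv h z * G z = deriv G z" if elim: "z \<in> ball 0 1" for z
  proof -
    have "(G has_field_derivative A * (exp (h z) * deriv h z)) (at z)"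
    proof (rule has_field_derivative_transform_within_open[of "\<lambda>w. A * exp (h w)" _ _ "ball 0 1"])
      show "((\<lambda>w. A * exp (h w)) has_field_derivative A * (exp (h z) * deriv h z)) (at z)"
        using elim hol by (auto intro!: derivative_eq_intros holomorphic_derivI[where S = "ball 0 1"])
    qed (use elim eq in auto)
    then show "deriv h z * G z = deriv G z"
      using elim eq by (simp add: DERIV_imp_deriv)
  qed
  then have "\<forall>\<^sub>F z in nhds 0. deriv h z * G z = deriv G z"
    by (intro eventually_mono[OF eventually_nhds_in_open[of "ball 0 1"]]) auto
  then have "deriv G has_fps_expansion fps_deriv ?c * ?g"
    using has_fps_expansion_mult[OF has_fps_expansion_deriv[OF ec] eg]
      has_fps_expansion_cong[of "\<lambda>z. deriv h z * G z" "deriv G", OF _ refl] by simp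
  then have "fps_deriv ?g = fps_deriv ?c * ?g"
    using fps_expansion_unique_complex has_fps_expansion_deriv[OF eg] by blast
  then have "fps_nth (fps_deriv ?g) n = fps_nth (fps_deriv ?c * ?g) n" by simp
  then have "of_real (real (Suc n) * g (Suc n)) =
     (of_real (\<Sum>i\<le>n. real (Suc i) * c (Suc i) * g (n - i)) :: complex)"
    by (simp add: fps_mult_nth atLeast0AtMost)
  then show ?thesis using of_real_eq_iff by blast
qed

text \<open>The recursion expresses each \<open>g n\<close> as a polynomial in \<open>g 0\<close> and the \<open>c\<close>, hence convergence is
  inherited coefficient by coefficient.\<close>
lemma exp_series_tendsto:
  fixes g c :: "nat \<Rightarrow> nat \<Rightarrow> real"
  assumes rec: "\<And>j n. real (Suc n) * g j (Suc n) = (\<Sum>i\<le>n. real (Suc i) * c j (Suc i) * g j (n - i))"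
    and rec': "\<And>n. real (Suc n) * g' (Suc n) = (\<Sum>i\<le>n. real (Suc i) * c' (Suc i) * g' (n - i))"
    and c: "\<And>n. n > 0 \<Longrightarrow> (\<lambda>j. c j n) \<longlonglongrightarrow> c' n"
    and g0: "(\<lambda>j. g j 0) \<longlonglongrightarrow> g' 0"
  shows "(\<lambda>j. g j n) \<longlonglongrightarrow> g' n"
proof (induction n rule: less_induct)
  case (less n)
  show ?case
  proof (cases n)
    case 0
    then show ?thesis using g0 by simp
  next
    case (Suc m)
    have "(\<lambda>j. (\<Sum>i\<le>m. real (Suc i) * c j (Suc i) * g j (m - i)) / real (Suc m)) \<longlonglongrightarrow>
          (\<Sum>i\<le>m. real (Suc i) * c' (Suc i) * g' (m - i)) / real (Suc m)"
      using less.IH Suc by (intro tendsto_intros c) auto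
    moreover have "g j n = (\<Sum>i\<le>m. real (Suc i) * c j (Suc i) * g j (m - i)) / real (Suc m)" for j
      using rec[of m j] Suc by (simp add: field_simps)
    moreover have "g' n = (\<Sum>i\<le>m. real (Suc i) * c' (Suc i) * g' (m - i)) / real (Suc m)"
      using rec'[of m] Suc by (simp add: field_simps)
    ultimately show ?thesis by simp
  qed
qed

section \<open>Density of polynomials\<close>

lemma powr_add_le:
  fixes a b s :: real
  assumes "0 \<le> a" "0 \<le> b" "0 < s"
  shows "(a + b) powr s \<le> 2 powr s * (a powr s + b powr s)"
proof -
  have "(a + b) powr s \<le> (2 * max a b) powr s"
    using assms by (intro powr_mono2) auto
  also have "\<dots> = 2 powr s * max a b powr s"
    using assms by (simp add: powr_mult)
  also have "\<dots> \<le> 2 powr s * (a powr s + b powr s)"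
    by (intro mult_left_mono) (auto simp: max_def)
  finally show ?thesis .
qed

lemma abs_diff_powr_triangle:
  fixes a b c s :: real
  assumes "0 < s"
  shows "\<bar>a - c\<bar> powr s \<le> 2 powr s * (\<bar>a - b\<bar> powr s + \<bar>b - c\<bar> powr s)"
proof -
  have "\<bar>a - c\<bar> powr s \<le> (\<bar>a - b\<bar> + \<bar>b - c\<bar>) powr s"
    using assms by (intro powr_mono2) auto
  also have "\<dots> \<le> 2 powr s * (\<bar>a - b\<bar> powr s + \<bar>b - c\<bar> powr s)"
    using assms by (intro powr_add_le) auto
  finally show ?thesis .
qed

lemma tendsto_imp_ex_less:
  fixes X :: "nat \<Rightarrow> real"
  assumes "X \<longlonglongrightarrow> 0" "0 < e"
  shows "\<exists>n. X n < e"
  using order_tendstoD(2)[OF assms] eventually_happens' sequentially_bot by blast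

text \<open>Truncate \<open>v\<close> first; a bounded measurable function is an almost everywhere limit of continuous
  functions, which may be truncated at the same height.\<close>
lemma bounded_continuous_approximation:
  fixes v :: "real \<Rightarrow> real"
  assumes S: "S \<in> lmeasurable" and v: "v \<in> borel_measurable (lebesgue_on S)"
    and vs: "integrable (lebesgue_on S) (\<lambda>x. \<bar>v x\<bar> powr s)" and s: "0 < s" and e: "0 < e"
  shows "\<exists>g. continuous_on UNIV g \<and> bounded (range g) \<and>
    integrable (lebesgue_on S) (\<lambda>x. \<bar>v x - g x\<bar> powr s) \<and>
    (LINT x|lebesgue_on S. \<bar>v x - g x\<bar> powr s) < e"
proof -
  interpret finite_measure "lebesgue_on S" by (rule finite_measure_lebesgue_on[OF S])
  define cl where "cl N y = max (- real N) (min (real N) y)" for N and y :: real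
  have cl_bd: "\<bar>cl N y\<bar> \<le> real N" for N y by (auto simp: cl_def)
  have cl_cont: "continuous_on UNIV (cl N)" for N
    unfolding cl_def by (intro continuous_intros)
  have cl_meas: "(\<lambda>x. cl N (f x)) \<in> borel_measurable (lebesgue_on S)"
    if "f \<in> borel_measurable (lebesgue_on S)" for N f
    using that unfolding cl_def by measurable
  have cl_lim: "(\<lambda>N. cl N y) \<longlonglongrightarrow> y" for y
  proof (rule tendsto_eventually)
    obtain m :: nat where m: "\<bar>y\<bar> \<le> m" using real_arch_simple by blast
    show "\<forall>\<^sub>F N in sequentially. cl N y = y"
      using eventually_ge_at_top[of m] by eventually_elim (use m in \<open>auto simp: cl_def\<close>)
  qed
  define C where "C = 2 powr s"
  have C: "C > 0" by (simp add: C_def)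
  have "(\<lambda>N. LINT x|lebesgue_on S. \<bar>v x - cl N (v x)\<bar> powr s) \<longlonglongrightarrow> (LINT x|lebesgue_on S. 0)"
  proof (rule integral_dominated_convergence[where w = "\<lambda>x. \<bar>v x\<bar> powr s"])
    show "AE x in lebesgue_on S. (\<lambda>N. \<bar>v x - cl N (v x)\<bar> powr s) \<longlonglongrightarrow> 0"
    proof (rule AE_I2)
      fix x
      have "(\<lambda>N. \<bar>v x - cl N (v x)\<bar> powr s) \<longlonglongrightarrow> \<bar>v x - v x\<bar> powr s"
        using s by (intro tendsto_powr' tendsto_intros cl_lim) auto
      then show "(\<lambda>N. \<bar>v x - cl N (v x)\<bar> powr s) \<longlonglongrightarrow> 0" by simp
    qed
    show "AE x in lebesgue_on S. norm (\<bar>v x - cl N (v x)\<bar> powr s) \<le> \<bar>v x\<bar> powr s" for N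
      using s by (intro AE_I2) (auto simp: cl_def intro!: powr_mono2)
  qed (use v vs cl_meas in measurable)
  then obtain N where N: "(LINT x|lebesgue_on S. \<bar>v x - cl N (v x)\<bar> powr s) < e / (2 * C)"
    using tendsto_imp_ex_less[of _ "e / (2 * C)"] e C by auto
  have "v measurable_on S"
    using v S by (simp add: measurable_on_iff_borel_measurable fmeasurableD)
  then obtain Z g where Z: "negligible Z" and g: "\<And>n. continuous_on UNIV (g n)"
    and lim: "\<And>x. x \<notin> Z \<Longrightarrow> (\<lambda>n. g n x) \<longlonglongrightarrow> (if x \<in> S then v x else 0)"
    unfolding measurable_on_def by blast
  have gm: "g n \<in> borel_measurable (lebesgue_on S)" for n
    using continuous_imp_measurable_on_sets_lebesgue[of S "g n"] g S
    by (meson continuous_on_subset fmeasurableD subset_UNIV)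
  have Zae: "AE x in lebesgue_on S. x \<notin> Z"
    using Z S by (auto simp: AE_restrict_space_iff fmeasurableD negligible_iff_null_sets dest: AE_not_in intro: AE_mp)
  have "(\<lambda>n. LINT x|lebesgue_on S. \<bar>cl N (v x) - cl N (g n x)\<bar> powr s) \<longlonglongrightarrow> (LINT x|lebesgue_on S. 0)"
  proof (rule integral_dominated_convergence[where w = "\<lambda>x. (2 * real N) powr s"])
    show "AE x in lebesgue_on S. (\<lambda>n. \<bar>cl N (v x) - cl N (g n x)\<bar> powr s) \<longlonglongrightarrow> 0"
      using Zae AE_space
    proof eventually_elim
      case (elim x)
      have "(\<lambda>n. cl N (g n x)) \<longlonglongrightarrow> cl N (v x)"
        using lim[of x] elim unfolding cl_def by (auto intro!: tendsto_intros)
      then have "(\<lambda>n. \<bar>cl N (v x) - cl N (g n x)\<bar> powr s) \<longlonglongrightarrow> \<bar>cl N (v x) - cl N (v x)\<bar> powr s"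
        using s by (intro tendsto_powr' tendsto_intros) auto
      then show ?case by simp
    qed
    show "AE x in lebesgue_on S. norm (\<bar>cl N (v x) - cl N (g n x)\<bar> powr s) \<le> (2 * real N) powr s" for n
      using s by (intro AE_I2) (auto simp: cl_def intro!: powr_mono2)
    show "(\<lambda>x. \<bar>cl N (v x) - cl N (g n x)\<bar> powr s) \<in> borel_measurable (lebesgue_on S)" for n
      using cl_meas[OF v] cl_meas[OF gm] by measurable
  qed auto
  then obtain n where n: "(LINT x|lebesgue_on S. \<bar>cl N (v x) - cl N (g n x)\<bar> powr s) < e / (2 * C)"
    using tendsto_imp_ex_less[of _ "e / (2 * C)"] e C by auto
  define h where "h = (\<lambda>x. cl N (g n x))"
  have hm: "h \<in> borel_measurable (lebesgue_on S)"
    unfolding h_def by (rule cl_meas[OF gm])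
  have i1: "integrable (lebesgue_on S) (\<lambda>x. \<bar>v x - cl N (v x)\<bar> powr s)"
  proof (rule Bochner_Integration.integrable_bound[OF vs])
    show "(\<lambda>x. \<bar>v x - cl N (v x)\<bar> powr s) \<in> borel_measurable (lebesgue_on S)"
      using v cl_meas[OF v] by measurable
  qed (use s in \<open>auto intro!: powr_mono2 simp: cl_def\<close>)
  have i2: "integrable (lebesgue_on S) (\<lambda>x. \<bar>cl N (v x) - h x\<bar> powr s)"
  proof (rule integrable_const_bound[where B = "(2 * real N) powr s"])
    show "(\<lambda>x. \<bar>cl N (v x) - h x\<bar> powr s) \<in> borel_measurable (lebesgue_on S)"
      using hm cl_meas[OF v] by measurable
  qed (use s in \<open>auto intro!: powr_mono2 simp: cl_def h_def\<close>)
  have le: "\<bar>v x - h x\<bar> powr s \<le> C * (\<bar>v x - cl N (v x)\<bar> powr s + \<bar>cl N (v x) - h x\<bar> powr s)" for x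
    unfolding C_def by (rule abs_diff_powr_triangle[OF s])
  have i3: "integrable (lebesgue_on S) (\<lambda>x. \<bar>v x - h x\<bar> powr s)"
    by (rule Bochner_Integration.integrable_bound[OF integrable_mult_right[OF Bochner_Integration.integrable_add[OF i1 i2], of C]])
       (use le v hm C in \<open>auto intro!: powr_real_measurable borel_measurable_abs borel_measurable_diff simp: abs_of_nonneg\<close>)
  have "(LINT x|lebesgue_on S. \<bar>v x - h x\<bar> powr s) \<le>
      (LINT x|lebesgue_on S. C * (\<bar>v x - cl N (v x)\<bar> powr s + \<bar>cl N (v x) - h x\<bar> powr s))"
    by (intro integral_mono i3 integrable_mult_right Bochner_Integration.integrable_add i1 i2 le)
  also have "\<dots> = C * ((LINT x|lebesgue_on S. \<bar>v x - cl N (v x)\<bar> powr s) + (LINT x|lebesgue_on S. \<bar>cl N (v x) - h x\<bar> powr s))"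
    using i1 i2 by simp
  also have "\<dots> < C * (e / (2 * C) + e / (2 * C))"
    using N n C unfolding h_def by (intro mult_strict_left_mono add_strict_mono)
  also have "\<dots> = e" using C by simp
  finally have "(LINT x|lebesgue_on S. \<bar>v x - h x\<bar> powr s) < e" .
  moreover have "continuous_on UNIV h"
    unfolding h_def using continuous_on_compose2[OF cl_cont g] by auto
  moreover have "bounded (range h)"
    unfolding h_def bounded_iff using cl_bd by auto
  ultimately show ?thesis using i3 by blast
qed

lemma polynomial_uniform_approximation:
  fixes f :: "real \<Rightarrow> real"
  assumes "compact K" "continuous_on K f" "0 < e"
  shows "\<exists>q. \<forall>x\<in>K. \<bar>f x - poly q x\<bar> < e"
proof -
  obtain g where g: "real_polynomial_function g" "\<And>x. x \<in> K \<Longrightarrow> \<bar>f x - g x\<bar> < e"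
    using Stone_Weierstrass_real_polynomial_function[OF assms(1,2,3)] by auto
  then obtain a n where "g = (\<lambda>x. \<Sum>i\<le>n. a i * x ^ i)"
    by (auto simp: real_polynomial_function_iff_sum)
  then have "g x = poly (\<Sum>i\<le>n. monom (a i) i) x" for x
    by (simp add: poly_sum poly_monom)
  with g(2) show ?thesis by auto
qed

text \<open>The weight \<open>w\<close> may vanish at the end points.  Therefore a continuous approximation \<open>g\<close> of \<open>v\<close> is
  first replaced by \<open>w g / (w + d)\<close> with a small \<open>d > 0\<close>; the factor \<open>g / (w + d)\<close> is continuous up to
  the boundary, and a continuous function of the injective variable \<open>\<psi>\<close> can be approximated
  uniformly by polynomials.  The weights \<open>1\<close> and \<open>sin\<close> (or \<open>sqrt (1 - x\<^sup>2)\<close>) serve even and odd functions.\<close>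
lemma weighted_polynomial_density:
  fixes v w \<psi> :: "real \<Rightarrow> real"
  assumes v: "v \<in> borel_measurable (lebesgue_on {a<..<b})"
    and vs: "integrable (lebesgue_on {a<..<b}) (\<lambda>x. \<bar>v x\<bar> powr s)" and s: "0 < s" and e: "0 < e"
    and w: "continuous_on {a..b} w" "\<And>x. a < x \<Longrightarrow> x < b \<Longrightarrow> 0 < w x"
    and \<psi>: "continuous_on {a..b} \<psi>" "inj_on \<psi> {a..b}" and ab: "a < b"
  shows "\<exists>q. integrable (lebesgue_on {a<..<b}) (\<lambda>x. \<bar>v x - w x * poly q (\<psi> x)\<bar> powr s) \<and>
    (LINT x|lebesgue_on {a<..<b}. \<bar>v x - w x * poly q (\<psi> x)\<bar> powr s) < e"
proof -
  let ?S = "{a<..<b}"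
  let ?M = "lebesgue_on ?S"
  interpret finite_measure ?M by (rule finite_measure_lebesgue_on) simp
  define C where "C = 2 powr s"
  have C: "C > 0" by (simp add: C_def)
  obtain g where g: "continuous_on UNIV g" "bounded (range g)"
      "integrable ?M (\<lambda>x. \<bar>v x - g x\<bar> powr s)" "(LINT x|?M. \<bar>v x - g x\<bar> powr s) < e / (2 * C)"
    using bounded_continuous_approximation[OF _ v vs s, of "e / (2 * C)"] e C by auto
  obtain B where B: "\<And>x. \<bar>g x\<bar> \<le> B" using g(2) by (auto simp: bounded_iff)
  have cm: "f \<in> borel_measurable ?M" if "continuous_on {a..b} f" for f :: "real \<Rightarrow> real"
    by (rule continuous_imp_measurable_on_sets_lebesgue) (auto intro: continuous_on_subset[OF that])
  have wge: "0 \<le> w x" if "x \<in> {a..b}" for x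
  proof -
    have "closure ?S = {a..b}" using ab by simp
    then show ?thesis
      using continuous_ge_on_closure[of ?S w x 0] w that by (auto simp: less_imp_le)
  qed
  define c where "c d x = g x / (w x + d)" for d x
  have c_cont: "continuous_on {a..b} (c d)" if "d > 0" for d
    unfolding c_def using wge that
    by (intro continuous_intros continuous_on_subset[OF g(1)] w) (auto simp: add_nonneg_eq_0_iff dest!: wge)
  obtain W where W: "\<And>x. x \<in> {a..b} \<Longrightarrow> \<bar>w x\<bar> \<le> W" and W0: "0 < W"
    using continuous_bounded_Icc[OF w(1)] by blast
  \<comment> \<open>Two applications of the quasi-triangle inequality produce the square of its constant.\<close>
  define C2 where "C2 = C * C"
  have C2: "C2 > 0" using C by (simp add: C2_def)
  have "(\<lambda>n. LINT x|?M. \<bar>g x - w x * c (inverse (real (Suc n))) x\<bar> powr s) \<longlonglongrightarrow> (LINT x|?M. 0)"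
  proof (rule integral_dominated_convergence[where w = "\<lambda>x. B powr s"])
    show "AE x in ?M. (\<lambda>n. \<bar>g x - w x * c (inverse (real (Suc n))) x\<bar> powr s) \<longlonglongrightarrow> 0"
    proof (rule AE_I2)
      fix x assume "x \<in> space ?M"
      then have x: "w x > 0" using w(2) by simp
      have "(\<lambda>n. c (inverse (real (Suc n))) x) \<longlonglongrightarrow> g x / (w x + 0)"
        unfolding c_def using x by (intro tendsto_intros LIMSEQ_inverse_real_of_nat) auto
      then have "(\<lambda>n. \<bar>g x - w x * c (inverse (real (Suc n))) x\<bar> powr s) \<longlonglongrightarrow> \<bar>g x - w x * (g x / (w x + 0))\<bar> powr s"
        using s by (intro tendsto_powr' tendsto_intros) auto
      then show "(\<lambda>n. \<bar>g x - w x * c (inverse (real (Suc n))) x\<bar> powr s) \<longlonglongrightarrow> 0" using x by simp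
    qed
    show "AE x in ?M. norm (\<bar>g x - w x * c (inverse (real (Suc n))) x\<bar> powr s) \<le> B powr s" for n
    proof (rule AE_I2)
      fix x assume "x \<in> space ?M"
      then have x: "w x > 0" using w(2) by simp
      define d where "d = inverse (real (Suc n))"
      have d: "d > 0" by (simp add: d_def)
      have "g x - w x * c d x = g x * (d / (w x + d))"
        using x d by (simp add: c_def field_simps)
      also have "\<bar>\<dots>\<bar> \<le> \<bar>g x\<bar> * 1"
        unfolding abs_mult by (rule mult_left_mono) (use x d in auto)
      finally have "\<bar>g x - w x * c d x\<bar> \<le> B" using B[of x] by simp
      then show "norm (\<bar>g x - w x * c (inverse (real (Suc n))) x\<bar> powr s) \<le> B powr s"
        using s by (simp add: d_def powr_mono2)
    qed
    show "(\<lambda>x. \<bar>g x - w x * c (inverse (real (Suc n))) x\<bar> powr s) \<in> borel_measurable ?M" for n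
      using cm[OF w(1)] cm[OF c_cont[of "inverse (real (Suc n))"]] cm[OF continuous_on_subset[OF g(1)]]
      by (auto intro!: powr_real_measurable borel_measurable_abs borel_measurable_diff borel_measurable_times)
  qed auto
  then obtain n where n: "(LINT x|?M. \<bar>g x - w x * c (inverse (real (Suc n))) x\<bar> powr s) < e / (4 * C2)"
    using tendsto_imp_ex_less[of _ "e / (4 * C2)"] e C2 by auto
  define f where "f = c (inverse (real (Suc n)))"
  have f: "continuous_on {a..b} f" unfolding f_def by (rule c_cont) simp
  define L where "L = b - a"
  have L: "L > 0" using ab by (simp add: L_def)
  define \<tau> where "\<tau> = (e / (8 * C2 * L)) powr (1 / s) / W"
  have \<tau>: "\<tau> > 0" unfolding \<tau>_def using e C2 L W0 by simp
  have "continuous_on (\<psi> ` {a..b}) (\<lambda>y. f (the_inv_into {a..b} \<psi> y))"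
    by (rule continuous_on_compose2[OF f continuous_on_inv[OF \<psi>(1)]])
       (auto simp: the_inv_into_f_f[OF \<psi>(2)])
  then obtain q where "\<And>y. y \<in> \<psi> ` {a..b} \<Longrightarrow> \<bar>f (the_inv_into {a..b} \<psi> y) - poly q y\<bar> < \<tau>"
    using polynomial_uniform_approximation[OF compact_continuous_image[OF \<psi>(1) compact_Icc] _ \<tau>] by blast
  then have q: "\<And>x. x \<in> {a..b} \<Longrightarrow> \<bar>f x - poly q (\<psi> x)\<bar> < \<tau>"
    using the_inv_into_f_f[OF \<psi>(2)] by fastforce
  have bd3: "\<bar>w x * f x - w x * poly q (\<psi> x)\<bar> powr s \<le> e / (8 * C2 * L)" if "x \<in> ?S" for x
  proof -
    have "\<bar>w x * f x - w x * poly q (\<psi> x)\<bar> = \<bar>w x\<bar> * \<bar>f x - poly q (\<psi> x)\<bar>"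
      by (simp add: abs_mult flip: right_diff_distrib)
    also have "\<dots> \<le> W * \<tau>" using W[of x] q[of x] that by (intro mult_mono) auto
    finally have "\<bar>w x * f x - w x * poly q (\<psi> x)\<bar> powr s \<le> (W * \<tau>) powr s"
      using s by (intro powr_mono2) auto
    also have "\<dots> = e / (8 * C2 * L)" using W0 s e C2 L by (simp add: \<tau>_def powr_powr)
    finally show ?thesis .
  qed
  have pc: "continuous_on {a..b} (\<lambda>x. w x * poly q (\<psi> x))"
    by (intro continuous_intros w \<psi>)
  have bdi: "integrable ?M (\<lambda>x. \<bar>f1 x - f2 x\<bar> powr s)"
    if c12: "continuous_on {a..b} f1" "continuous_on {a..b} f2" for f1 f2 :: "real \<Rightarrow> real"
  proof -
    obtain D where "\<And>x. x \<in> {a..b} \<Longrightarrow> \<bar>f1 x - f2 x\<bar> \<le> D"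
      using continuous_bounded_Icc[OF continuous_on_diff[OF c12]] by blast
    then show ?thesis
      using s cm[OF c12(1)] cm[OF c12(2)]
      by (intro integrable_const_bound[where B = "D powr s"])
         (auto intro!: powr_real_measurable borel_measurable_abs borel_measurable_diff powr_mono2)
  qed
  have i1: "integrable ?M (\<lambda>x. \<bar>g x - w x * f x\<bar> powr s)"
    by (intro bdi continuous_intros w f continuous_on_subset[OF g(1)]) auto
  have i2: "integrable ?M (\<lambda>x. \<bar>w x * f x - w x * poly q (\<psi> x)\<bar> powr s)"
    by (intro bdi continuous_intros w f \<psi>)
  let ?R = "\<lambda>x. C * \<bar>v x - g x\<bar> powr s + C2 * \<bar>g x - w x * f x\<bar> powr s + C2 * \<bar>w x * f x - w x * poly q (\<psi> x)\<bar> powr s"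
  have le: "\<bar>v x - w x * poly q (\<psi> x)\<bar> powr s \<le> ?R x" for x
  proof -
    have "\<bar>v x - w x * poly q (\<psi> x)\<bar> powr s \<le> C * (\<bar>v x - g x\<bar> powr s + \<bar>g x - w x * poly q (\<psi> x)\<bar> powr s)"
      unfolding C_def by (rule abs_diff_powr_triangle[OF s])
    also have "\<dots> \<le> C * (\<bar>v x - g x\<bar> powr s + C * (\<bar>g x - w x * f x\<bar> powr s + \<bar>w x * f x - w x * poly q (\<psi> x)\<bar> powr s))"
      using C abs_diff_powr_triangle[OF s, of "g x" "w x * poly q (\<psi> x)" "w x * f x"]
      by (intro mult_left_mono add_left_mono) (auto simp: C_def)
    finally show ?thesis by (simp add: C2_def algebra_simps)
  qed
  have iR: "integrable ?M ?R"
    by (intro Bochner_Integration.integrable_add integrable_mult_right g(3) i1 i2)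
  have i3: "integrable ?M (\<lambda>x. \<bar>v x - w x * poly q (\<psi> x)\<bar> powr s)"
  proof (rule Bochner_Integration.integrable_bound[OF iR])
    show "(\<lambda>x. \<bar>v x - w x * poly q (\<psi> x)\<bar> powr s) \<in> borel_measurable ?M"
      using v cm[OF pc] by (intro powr_real_measurable borel_measurable_abs borel_measurable_diff) auto
    show "AE x in ?M. norm (\<bar>v x - w x * poly q (\<psi> x)\<bar> powr s) \<le> norm (?R x)"
      using le C C2 by (intro AE_I2) (auto simp: abs_of_nonneg)
  qed
  have "(LINT x|?M. \<bar>w x * f x - w x * poly q (\<psi> x)\<bar> powr s) \<le> (LINT x|?M. e / (8 * C2 * L))"
    by (intro integral_mono_AE i2) (use bd3 in auto)
  also have "\<dots> = L * (e / (8 * C2 * L))"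
    using ab by (simp add: L_def measure_restrict_space)
  also have "\<dots> = e / (8 * C2)" using L by simp
  finally have l3: "(LINT x|?M. \<bar>w x * f x - w x * poly q (\<psi> x)\<bar> powr s) \<le> e / (8 * C2)" .
  have "(LINT x|?M. \<bar>v x - w x * poly q (\<psi> x)\<bar> powr s) \<le> (LINT x|?M. ?R x)"
    by (intro integral_mono i3 iR le)
  also have "\<dots> = C * (LINT x|?M. \<bar>v x - g x\<bar> powr s) + C2 * (LINT x|?M. \<bar>g x - w x * f x\<bar> powr s)
      + C2 * (LINT x|?M. \<bar>w x * f x - w x * poly q (\<psi> x)\<bar> powr s)"
    by (simp add: g(3) i1 i2)
  also have "\<dots> < C * (e / (2 * C)) + C2 * (e / (4 * C2)) + C2 * (e / (4 * C2))"
    using g(4) n l3 C C2 e unfolding f_def[symmetric]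
    by (intro add_strict_mono mult_strict_left_mono) (auto elim!: le_less_trans simp: field_simps)
  also have "\<dots> = e" using C C2 by simp
  finally show ?thesis using i3 by blast
qed

section \<open>Trigonometric polynomials on the half circle\<close>

text \<open>Even trigonometric polynomials are the polynomials in \<open>cos x\<close>.  To make the induction work, the
  claim is proved for all products with \<open>cos (k x)\<close>, since \<open>2 cos x cos (k x)\<close> is a sum of cosines.\<close>
lemma cos_poly_induct:
  assumes add: "\<And>f g. Q f \<Longrightarrow> Q g \<Longrightarrow> Q (\<lambda>x. f x + g x)"
    and scale: "\<And>f c. Q f \<Longrightarrow> Q (\<lambda>x. c * f x :: real)"
    and base: "\<And>k. Q (\<lambda>x. cos (real k * x))"
  shows "Q (\<lambda>x. poly q (cos x))"
proof -
  have "Q (\<lambda>x. cos (real k * x) * poly q (cos x))" for k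
  proof (induction q arbitrary: k)
    case 0
    show ?case using scale[OF base, of 0] by simp
  next
    case (pCons a q)
    have "Q (\<lambda>x. a * cos (real k * x) + (1/2 * (cos (real (k + 1) * x) * poly q (cos x)) +
        1/2 * (cos (real (if k = 0 then 1 else k - 1) * x) * poly q (cos x))))"
      by (intro add scale base pCons.IH)
    moreover have "a * cos (real k * x) + (1/2 * (cos (real (k + 1) * x) * poly q (cos x)) +
        1/2 * (cos (real (if k = 0 then 1 else k - 1) * x) * poly q (cos x))) =
        cos (real k * x) * poly (pCons a q) (cos x)" for x
    proof (cases k)
      case (Suc n)
      have "real (k + 1) * x = real k * x + x" "real n * x = real k * x - x"
        using Suc by (auto simp: algebra_simps)
      then have "cos (real (k + 1) * x) + cos (real n * x) = 2 * (cos (real k * x) * cos x)"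
        by (simp only: cos_add cos_diff)
      then have "(cos (real (k + 1) * x) + cos (real n * x)) * poly q (cos x) = 2 * (cos (real k * x) * cos x) * poly q (cos x)"
        by simp
      then show ?thesis using Suc by (simp add: distrib_right distrib_left)
    qed (simp add: algebra_simps)
    ultimately show ?case by simp
  qed
  from this[of 0] show ?thesis by simp
qed

text \<open>The odd counterpart.  The pair of consecutive indices in the induction is what the recursion
  \<open>2 cos x sin (k x) = sin ((k + 1) x) + sin ((k - 1) x)\<close> asks for.\<close>
lemma sin_poly_induct:
  assumes add: "\<And>f g. Q f \<Longrightarrow> Q g \<Longrightarrow> Q (\<lambda>x. f x + g x)"
    and scale: "\<And>f c. Q f \<Longrightarrow> Q (\<lambda>x. c * f x :: real)"
    and base: "\<And>k. k > 0 \<Longrightarrow> Q (\<lambda>x. sin (real k * x))"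
  shows "Q (\<lambda>x. sin x * poly q (cos x))"
proof -
  have base': "Q (\<lambda>x. sin (real k * x))" for k
  proof (cases "k = 0")
    case True
    then show ?thesis using scale[OF base[of 1], of 0] by simp
  qed (use base in simp)
  have "Q (\<lambda>x. sin (real (Suc k) * x) * poly q (cos x)) \<and> Q (\<lambda>x. sin (real k * x) * poly q (cos x))" for k
  proof (induction q arbitrary: k)
    case 0
    show ?case using scale[OF base', of 0] by simp
  next
    case (pCons a q)
    have "Q (\<lambda>x. sin (real k * x) * poly (pCons a q) (cos x))" for k
    proof (cases k)
      case 0
      then show ?thesis using scale[OF base', of 0] by simp
    next
      case (Suc n)
      have "Q (\<lambda>x. a * sin (real k * x) + (1/2 * (sin (real (Suc k) * x) * poly q (cos x)) +
          1/2 * (sin (real n * x) * poly q (cos x))))"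
        by (intro add scale base' pCons.IH[THEN conjunct1] pCons.IH[THEN conjunct2])
      moreover have "a * sin (real k * x) + (1/2 * (sin (real (Suc k) * x) * poly q (cos x)) +
          1/2 * (sin (real n * x) * poly q (cos x))) = sin (real k * x) * poly (pCons a q) (cos x)" for x
      proof -
        have "real (Suc k) * x = real k * x + x" "real n * x = real k * x - x"
          using Suc by (auto simp: algebra_simps)
        then have "sin (real (Suc k) * x) + sin (real n * x) = 2 * (sin (real k * x) * cos x)"
          by (simp only: sin_add sin_diff)
        then have "(sin (real (Suc k) * x) + sin (real n * x)) * poly q (cos x) = 2 * (sin (real k * x) * cos x) * poly q (cos x)"
          by simp
        then show ?thesis by (simp add: distrib_right distrib_left)
      qed
      ultimately show ?thesis by simp
    qed
    then show ?case by blast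
  qed
  from this[of 0] show ?thesis by simp
qed

lemma sin_multiple_poly: "\<exists>q. \<forall>x. sin (real k * x) = sin x * poly q (cos x)"
proof -
  have "(\<exists>q. \<forall>x. sin (real k * x) = sin x * poly q (cos x)) \<and>
        (\<exists>q. \<forall>x. sin (real (Suc k) * x) = sin x * poly q (cos x))"
  proof (induction k)
    case 0
    have "\<forall>x. sin (real 0 * x) = sin x * poly 0 (cos x)" "\<forall>x. sin (real (Suc 0) * x) = sin x * poly 1 (cos x)"
      by auto
    then show ?case by blast
  next
    case (Suc k)
    then obtain q0 q1 where q: "\<And>x. sin (real k * x) = sin x * poly q0 (cos x)"
        "\<And>x. sin (real (Suc k) * x) = sin x * poly q1 (cos x)" by blast
    have "sin (real (Suc (Suc k)) * x) = sin x * poly ([:0, 2:] * q1 - q0) (cos x)" for x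
    proof -
      have "sin (real (Suc (Suc k)) * x) = 2 * cos x * sin (real (Suc k) * x) - sin (real k * x)"
      proof -
        have "real (Suc (Suc k)) * x = real (Suc k) * x + x" "real k * x = real (Suc k) * x - x"
          by (auto simp: algebra_simps)
        then have "sin (real (Suc (Suc k)) * x) + sin (real k * x) = 2 * (sin (real (Suc k) * x) * cos x)"
          by (simp only: sin_add sin_diff)
        then show ?thesis by (simp add: mult_ac)
      qed
      also have "\<dots> = sin x * poly ([:0, 2:] * q1 - q0) (cos x)"
        unfolding q by (simp add: algebra_simps)
      finally show ?thesis .
    qed
    with q show ?case by blast
  qed
  then show ?thesis by blast
qed

section \<open>The Poisson kernel\<close>

definition poisson :: "real \<Rightarrow> real \<Rightarrow> real" where
  "poisson r x = (1 - r\<^sup>2) / (1 - 2 * r * cos x + r\<^sup>2)"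

text \<open>The Taylor coefficients of \<open>(1 + w) / (1 - w)\<close>, whose real part is the Poisson kernel.\<close>
definition poisson_coeff :: "nat \<Rightarrow> real" where "poisson_coeff k = (if k = 0 then 1 else 2)"

lemma poisson_denominator:
  assumes "0 \<le> r"
  shows "1 - 2 * r * cos x + r\<^sup>2 = (norm (1 - rcis r x))\<^sup>2"
proof -
  have "(norm (1 - z))\<^sup>2 = 1 - 2 * Re z + (norm z)\<^sup>2" for z
    unfolding cmod_power2 by (simp add: power2_eq_square algebra_simps)
  from this[of "rcis r x"] show ?thesis by simp
qed

lemma poisson_denominator_bounds:
  fixes r x :: real
  assumes "0 \<le> r" "r < 1"
  shows "(1 - r)\<^sup>2 \<le> 1 - 2 * r * cos x + r\<^sup>2" "1 - 2 * r * cos x + r\<^sup>2 \<le> (1 + r)\<^sup>2"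
proof -
  have "r * cos x \<le> r * 1"
    by (rule mult_left_mono) (use assms in auto)
  moreover have "r * (-1) \<le> r * cos x"
    by (rule mult_left_mono) (use assms in auto)
  ultimately show "(1 - r)\<^sup>2 \<le> 1 - 2 * r * cos x + r\<^sup>2" "1 - 2 * r * cos x + r\<^sup>2 \<le> (1 + r)\<^sup>2"
    by (auto simp: power2_eq_square algebra_simps)
qed

lemma poisson_lower:
  assumes "0 \<le> r" "r < 1"
  shows "(1 - r) / (1 + r) \<le> poisson r x"
proof -
  have p: "0 < (1 - r)\<^sup>2" using assms by simp
  have "(1 - r) / (1 + r) = (1 - r\<^sup>2) / (1 + r)\<^sup>2"
    using assms by (simp add: power2_eq_square divide_simps) (simp add: algebra_simps)
  also have "\<dots> \<le> poisson r x"
    unfolding poisson_def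
  proof (rule divide_left_mono)
    have "0 < 1 - 2 * r * cos x + r\<^sup>2"
      using poisson_denominator_bounds[OF assms, of x] p by linarith
    then show "0 < (1 + r)\<^sup>2 * (1 - 2 * r * cos x + r\<^sup>2)" using assms by simp
  qed (use poisson_denominator_bounds[OF assms, of x] assms in \<open>auto simp: power_le_one\<close>)
  finally show ?thesis .
qed

lemma poisson_pos: "0 \<le> r \<Longrightarrow> r < 1 \<Longrightarrow> 0 < poisson r x"
  using poisson_lower[of r x] by (meson add_pos_nonneg diff_gt_0_iff_gt divide_pos_pos less_le_trans zero_less_one)

lemma poisson_continuous:
  assumes "0 \<le> r" "r < 1"
  shows "continuous_on A (poisson r)"
proof -
  have "0 < (1 - r)\<^sup>2" using assms by simp
  then have "1 - 2 * r * cos x + r\<^sup>2 \<noteq> 0" for x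
    using poisson_denominator_bounds(1)[OF assms, of x] by linarith
  then show ?thesis unfolding poisson_def by (intro continuous_intros) auto
qed

lemma poisson_upper:
  assumes "0 \<le> r" "r < 1"
  shows "poisson r x \<le> (1 - r\<^sup>2) / (1 - r)\<^sup>2"
  unfolding poisson_def using poisson_denominator_bounds[OF assms, of x] assms
  by (intro divide_left_mono mult_pos_pos)
     (auto simp: power_le_one intro: less_le_trans[of _ "(1 - r)\<^sup>2"])

lemma poisson_series: "real_series poisson_coeff (\<lambda>w. (1 + w) / (1 - w))"
  unfolding real_series_def
proof (intro allI impI)
  fix w :: complex assume w: "norm w < 1"
  then have "w \<noteq> 1" by auto
  have "(\<lambda>k. 2 * w ^ k - (if k = 0 then 1 else 0)) sums (2 * (1 / (1 - w)) - 1)"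
  proof (intro sums_diff sums_mult geometric_sums w)
    show "(\<lambda>k::nat. if k = 0 then 1 else 0) sums (1::complex)"
      using sums_single[of 0 "\<lambda>_. 1::complex"] by simp
  qed
  moreover have "2 * (1 / (1 - w)) - 1 = (1 + w) / (1 - w)"
    using \<open>w \<noteq> 1\<close> by (simp add: divide_simps)
  moreover have "(\<lambda>k. 2 * w ^ k - (if k = 0 then 1 else 0)) = (\<lambda>k. of_real (poisson_coeff k) * w ^ k)"
    by (auto simp: poisson_coeff_def fun_eq_iff)
  ultimately show "(\<lambda>k. of_real (poisson_coeff k) * w ^ k) sums ((1 + w) / (1 - w))" by simp
qed

lemma poisson_eq_suminf:
  assumes "0 \<le> r" "r < 1"
  shows "poisson r x = (\<Sum>k. poisson_coeff k * r ^ k * cos (real k * x))"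
proof -
  have "Re ((1 + z) / (1 - z)) = (1 - (norm z)\<^sup>2) / (norm (1 - z))\<^sup>2" for z
  proof -
    have "Re ((1 + z) / (1 - z)) = Re ((1 + z) * cnj (1 - z)) / (norm (1 - z))\<^sup>2"
      by (subst complex_div_cnj) simp
    also have "Re ((1 + z) * cnj (1 - z)) = 1 - (norm z)\<^sup>2"
      unfolding cmod_power2 by (simp add: power2_eq_square algebra_simps)
    finally show ?thesis .
  qed
  from this[of "rcis r x"] have "Re ((1 + rcis r x) / (1 - rcis r x)) = poisson r x"
    using assms by (simp add: poisson_def poisson_denominator)
  then show ?thesis using real_series_polar(1)[OF poisson_series assms, of x] by simp
qed

section \<open>Poisson means of even and odd densities\<close>

text \<open>The Poisson integral of a density on the circle, folded to the half circle: \<open>cos_kernel\<close> for densities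
  that are even under conjugation, \<open>sin_kernel\<close> for odd ones.\<close>
definition cos_kernel :: "real \<Rightarrow> real \<Rightarrow> real \<Rightarrow> real" where
  "cos_kernel r x y = (poisson r (x - y) + poisson r (x + y)) / (2 * pi)"

definition sin_kernel :: "real \<Rightarrow> real \<Rightarrow> real \<Rightarrow> real" where
  "sin_kernel r x y = (poisson r (x - y) - poisson r (x + y)) / (2 * pi)"

definition kernel_mean :: "(real \<Rightarrow> real \<Rightarrow> real) \<Rightarrow> (real \<Rightarrow> real) \<Rightarrow> real \<Rightarrow> real" where
  "kernel_mean K v x = (LINT y|angles. v y * K x y)"

lemma summable_poisson_coeff:
  assumes "0 \<le> r" "r < 1"
  shows "summable (\<lambda>k. poisson_coeff k * r ^ k)"
  using real_series_summable[OF poisson_series assms] by (rule summable_rabs_cancel)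

lemma summable_poisson_coeff_trig:
  assumes "0 \<le> r" "r < 1" "\<And>k. \<bar>e k\<bar> \<le> 1"
  shows "summable (\<lambda>k. poisson_coeff k * r ^ k * e k)"
proof (rule summable_comparison_test'[OF summable_poisson_coeff[OF assms(1,2)], of 0])
  fix n
  have "\<bar>poisson_coeff n * r ^ n\<bar> * \<bar>e n\<bar> \<le> \<bar>poisson_coeff n * r ^ n\<bar> * 1" by (intro mult_left_mono assms) auto
  then show "norm (poisson_coeff n * r ^ n * e n) \<le> poisson_coeff n * r ^ n"
    using assms(1) by (simp add: abs_mult poisson_coeff_def)
qed

lemma
  assumes r: "0 \<le> r" "r < 1"
  shows cos_kernel_series: "cos_kernel r x y = (\<Sum>k. poisson_coeff k * r ^ k * (cos (real k * x) * cos (real k * y)) / pi)"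
    and sin_kernel_series: "sin_kernel r x y = (\<Sum>k. poisson_coeff k * r ^ k * (sin (real k * x) * sin (real k * y)) / pi)"
proof -
  have s: "summable (\<lambda>k. poisson_coeff k * r ^ k * cos (real k * z))" for z
    by (rule summable_poisson_coeff_trig[OF r]) simp
  have "cos_kernel r x y = (\<Sum>k. (poisson_coeff k * r ^ k * cos (real k * (x - y)) + poisson_coeff k * r ^ k * cos (real k * (x + y))) / (2 * pi))"
    unfolding cos_kernel_def poisson_eq_suminf[OF r]
    by (simp add: suminf_add[OF s s] suminf_divide[OF summable_add[OF s s]])
  also have "\<dots> = (\<Sum>k. poisson_coeff k * r ^ k * (cos (real k * x) * cos (real k * y)) / pi)"
    by (simp add: cos_add cos_diff algebra_simps divide_simps)
  finally show "cos_kernel r x y = (\<Sum>k. poisson_coeff k * r ^ k * (cos (real k * x) * cos (real k * y)) / pi)" .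
  have "sin_kernel r x y = (\<Sum>k. (poisson_coeff k * r ^ k * cos (real k * (x - y)) - poisson_coeff k * r ^ k * cos (real k * (x + y))) / (2 * pi))"
    unfolding sin_kernel_def poisson_eq_suminf[OF r]
    by (simp add: suminf_diff[OF s s] suminf_divide[OF summable_diff[OF s s]])
  also have "\<dots> = (\<Sum>k. poisson_coeff k * r ^ k * (sin (real k * x) * sin (real k * y)) / pi)"
    by (simp add: cos_add cos_diff algebra_simps divide_simps)
  finally show "sin_kernel r x y = (\<Sum>k. poisson_coeff k * r ^ k * (sin (real k * x) * sin (real k * y)) / pi)" .
qed

lemma kernel_mean_series:
  assumes r: "0 \<le> r" "r < 1" and v: "integrable angles v"
    and e: "e = sin \<or> e = cos"
    and K: "\<And>x y. K x y = (\<Sum>k. poisson_coeff k * r ^ k * (e (real k * x) * e (real k * y)) / pi)"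
  shows "kernel_mean K v x = (\<Sum>k. poisson_coeff k * r ^ k * (LINT y|angles. v y * e (real k * y)) / pi * e (real k * x))"
proof -
  have le: "\<bar>e x\<bar> \<le> 1" for x using e by auto
  have le2: "\<bar>e x * e y\<bar> \<le> 1" for x y using le[of x] le[of y] by (simp add: abs_mult mult_le_one)
  have cont: "continuous_on A (\<lambda>x. e (c * x))" for c A
    using e by (auto intro!: continuous_intros)
  have em: "(\<lambda>y. e (c * y)) \<in> borel_measurable angles" for c
    by (rule measurable_angles_continuous[OF cont])
  have bnd: "norm (poisson_coeff k * r ^ k * (e (real k * x) * e (real k * y)) / pi) \<le> poisson_coeff k * r ^ k" for k x y
  proof -
    have "norm (poisson_coeff k * r ^ k * (e (real k * x) * e (real k * y)) / pi) = (poisson_coeff k * r ^ k) * (\<bar>e (real k * x) * e (real k * y)\<bar> / pi)"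
      using r by (simp add: abs_mult poisson_coeff_def)
    also have "\<dots> \<le> (poisson_coeff k * r ^ k) * 1"
      using le2[of "real k * x" "real k * y"] r pi_gt3 by (intro mult_left_mono) (auto simp: poisson_coeff_def)
    finally show ?thesis by simp
  qed
  have sK: "summable (\<lambda>k. poisson_coeff k * r ^ k * (e (real k * x) * e (real k * y)) / pi)" for x y
    by (rule summable_comparison_test'[OF summable_poisson_coeff[OF r], of 0]) (rule bnd)
  let ?f = "\<lambda>k y. v y * (poisson_coeff k * r ^ k * (e (real k * x) * e (real k * y)) / pi)"
  have nf: "norm (?f k y) \<le> \<bar>v y\<bar> * (poisson_coeff k * r ^ k)" for k y
    using mult_left_mono[OF bnd[of k x y], of "\<bar>v y\<bar>"] by (simp add: abs_mult)
  have eq: "(LINT y|angles. ?f k y) = poisson_coeff k * r ^ k * (LINT y|angles. v y * e (real k * y)) / pi * e (real k * x)" for k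
  proof -
    have "?f k y = (v y * e (real k * y)) * (poisson_coeff k * r ^ k / pi * e (real k * x))" for y
      by (simp add: mult_ac)
    then have "(LINT y|angles. ?f k y) = (LINT y|angles. (v y * e (real k * y)) * (poisson_coeff k * r ^ k / pi * e (real k * x)))"
      by (simp only:)
    also have "\<dots> = (LINT y|angles. v y * e (real k * y)) * (poisson_coeff k * r ^ k / pi * e (real k * x))"
      by (rule integral_mult_left_zero)
    finally show ?thesis by (simp add: mult_ac)
  qed
  have "kernel_mean K v x = (LINT y|angles. (\<Sum>k. ?f k y))"
    unfolding kernel_mean_def K by (simp only: suminf_mult[OF sK])
  also have "\<dots> = (\<Sum>k. LINT y|angles. ?f k y)"
  proof (rule integral_suminf)
    show int: "integrable angles (?f k)" for k
      by (rule integrable_mult_continuous[OF v]) (intro continuous_intros cont, simp)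
    show "AE y in angles. summable (\<lambda>k. norm (?f k y))"
      by (rule AE_I2, rule summable_comparison_test'[OF summable_mult[OF summable_poisson_coeff[OF r]], of 0]) (use nf in simp)
    have "(LINT y|angles. norm (?f k y)) \<le> (LINT y|angles. \<bar>v y\<bar> * (poisson_coeff k * r ^ k))" for k
      by (intro integral_mono integrable_norm int integrable_mult_left integrable_abs v nf)
    then show "summable (\<lambda>k. LINT y|angles. norm (?f k y))"
      by (intro summable_comparison_test'[OF summable_mult[OF summable_poisson_coeff[OF r], of "LINT y|angles. \<bar>v y\<bar>"], of 0])
         simp
  qed
  also have "\<dots> = (\<Sum>k. poisson_coeff k * r ^ k * (LINT y|angles. v y * e (real k * y)) / pi * e (real k * x))"
    by (simp only: eq)
  finally show ?thesis .
qed

lemmas cos_mean_series = kernel_mean_series[where e = cos and K = "cos_kernel _", OF _ _ _ disjI2[OF refl] cos_kernel_series]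
lemmas sin_mean_series = kernel_mean_series[where e = sin and K = "sin_kernel _", OF _ _ _ disjI1[OF refl] sin_kernel_series]

text \<open>Positivity of the Poisson kernel is all that is behind this bound, which later confines \<open>G\<close> to a sector.\<close>
lemma kernel_bound: "0 \<le> r \<Longrightarrow> r < 1 \<Longrightarrow> \<bar>sin_kernel r x y\<bar> \<le> cos_kernel r x y"
  using poisson_pos[of r "x - y"] poisson_pos[of r "x + y"]
  by (auto simp: cos_kernel_def sin_kernel_def abs_divide intro!: divide_right_mono)

lemma cos_kernel_lower:
  assumes "0 \<le> r" "r < 1"
  shows "(1 - r) / (1 + r) / pi \<le> cos_kernel r x y"
proof -
  have "((1 - r) / (1 + r) + (1 - r) / (1 + r)) / (2 * pi) \<le> cos_kernel r x y"
    unfolding cos_kernel_def by (intro divide_right_mono add_mono poisson_lower assms) auto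
  moreover have "(c + c) / (2 * pi) = c / pi" for c by simp
  ultimately show ?thesis by (simp only:)
qed

lemma cos_kernel_pos: "0 \<le> r \<Longrightarrow> r < 1 \<Longrightarrow> 0 < cos_kernel r x y"
  by (simp add: cos_kernel_def add_pos_pos poisson_pos)

lemma cos_kernel_upper:
  assumes "0 \<le> r" "r < 1"
  shows "cos_kernel r x y \<le> (1 - r\<^sup>2) / (1 - r)\<^sup>2 / pi"
proof -
  have "cos_kernel r x y \<le> ((1 - r\<^sup>2) / (1 - r)\<^sup>2 + (1 - r\<^sup>2) / (1 - r)\<^sup>2) / (2 * pi)"
    unfolding cos_kernel_def by (intro divide_right_mono add_mono poisson_upper assms) auto
  moreover have "(c + c) / (2 * pi) = c / pi" for c by simp
  ultimately show ?thesis by (simp only:)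
qed

lemma cos_mean_cos:
  assumes "0 \<le> r" "r < 1"
  shows "kernel_mean (cos_kernel r) (\<lambda>y. cos (real n * y)) x = r ^ n * cos (real n * x)"
proof -
  have "integrable angles (\<lambda>y. cos (real n * y))"
    by (intro integrable_angles_continuous continuous_intros)
  from cos_mean_series[OF assms this assms, of x] show ?thesis
    unfolding integral_angles_cos_cos
    by (subst (asm) suminf_finite[of "{n}"]) (auto simp: poisson_coeff_def)
qed

lemma sin_mean_sin:
  assumes "0 \<le> r" "r < 1"
  shows "kernel_mean (sin_kernel r) (\<lambda>y. sin (real n * y)) x = r ^ n * sin (real n * x)"
proof -
  have "integrable angles (\<lambda>y. sin (real n * y))"
    by (intro integrable_angles_continuous continuous_intros)
  from sin_mean_series[OF assms this assms, of x] show ?thesis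
    unfolding integral_angles_sin_sin
    by (subst (asm) suminf_finite[of "{n}"]) (auto simp: poisson_coeff_def)
qed

lemma id_borel_angles [measurable]: "(\<lambda>x. x) \<in> borel_measurable angles"
  by (rule measurable_angles_continuous) (intro continuous_intros)

lemma kernel_measurable:
  assumes "0 \<le> r" "r < 1"
  shows "(\<lambda>(x, y). cos_kernel r x y) \<in> borel_measurable (angles \<Otimes>\<^sub>M angles)"
    and "(\<lambda>(x, y). sin_kernel r x y) \<in> borel_measurable (angles \<Otimes>\<^sub>M angles)"
proof -
  have [measurable]: "poisson r \<in> borel_measurable borel"
    by (rule borel_measurable_continuous_onI[OF poisson_continuous[OF assms]])
  have [measurable]: "fst \<in> borel_measurable (angles \<Otimes>\<^sub>M angles)" "snd \<in> borel_measurable (angles \<Otimes>\<^sub>M angles)"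
    using measurable_compose[OF measurable_fst id_borel_angles, of angles]
          measurable_compose[OF measurable_snd id_borel_angles, of angles] by simp_all
  show "(\<lambda>(x, y). cos_kernel r x y) \<in> borel_measurable (angles \<Otimes>\<^sub>M angles)"
    unfolding cos_kernel_def case_prod_beta by measurable
  show "(\<lambda>(x, y). sin_kernel r x y) \<in> borel_measurable (angles \<Otimes>\<^sub>M angles)"
    unfolding sin_kernel_def case_prod_beta by measurable
qed

lemma cos_kernel_commute: "cos_kernel r x y = cos_kernel r y x"
proof -
  have "poisson r (x - y) = poisson r (y - x)"
    unfolding poisson_def by (metis cos_minus minus_diff_eq)
  then show ?thesis by (simp add: cos_kernel_def add.commute)
qed

lemma cos_kernel_section:
  assumes "0 \<le> r" "r < 1"
  shows "integrable angles (\<lambda>x. cos_kernel r x y)" "(LINT x|angles. cos_kernel r x y) = 1"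
proof -
  have cont: "continuous_on {0..pi} (\<lambda>x. poisson r (f x))" if "continuous_on {0..pi} f" for f
    by (rule continuous_on_compose2[OF poisson_continuous[OF assms] that, of UNIV]) simp
  have "continuous_on {0..pi} (\<lambda>x. cos_kernel r x y)"
    unfolding cos_kernel_def by (intro continuous_intros cont) auto
  then show "integrable angles (\<lambda>x. cos_kernel r x y)"
    by (rule integrable_angles_continuous)
  show "(LINT x|angles. cos_kernel r x y) = 1"
    using cos_mean_cos[OF assms, of 0 y] by (simp add: kernel_mean_def cos_kernel_commute[of r y])
qed

lemma kernel_continuous:
  assumes "0 \<le> r" "r < 1"
  shows "continuous_on A (cos_kernel r x)" "continuous_on A (sin_kernel r x)"
proof -
  have cont: "continuous_on A (\<lambda>x. poisson r (f x))" if "continuous_on A f" for f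
    by (rule continuous_on_compose2[OF poisson_continuous[OF assms] that, of UNIV]) simp
  show "continuous_on A (cos_kernel r x)"
    unfolding cos_kernel_def[abs_def] by (intro continuous_intros cont) auto
  show "continuous_on A (sin_kernel r x)"
    unfolding sin_kernel_def[abs_def] by (intro continuous_intros cont) auto
qed

text \<open>Both kernels act as contractions of \<open>L\<^sup>1\<close>, because they are dominated by \<open>cos_kernel\<close>, whose total
  mass is one in each variable.\<close>
lemma
  assumes r: "0 \<le> r" "r < 1" and v: "integrable angles v"
    and K: "K = cos_kernel r \<or> K = sin_kernel r"
  shows kernel_mean_integrable: "integrable angles (kernel_mean K v)"
    and kernel_mean_norm_le: "(LINT x|angles. \<bar>kernel_mean K v x\<bar>) \<le> (LINT x|angles. \<bar>v x\<bar>)"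
    and kernel_mean_section: "integrable angles (\<lambda>y. v y * K x y)"
proof -
  note vm [measurable] = borel_measurable_integrable[OF v]
  have vm2 [measurable]: "(\<lambda>z. v (snd z)) \<in> borel_measurable (angles \<Otimes>\<^sub>M angles)"
    by (rule measurable_compose[OF measurable_snd vm])
  define B where "B = (1 - r\<^sup>2) / (1 - r)\<^sup>2 / pi"
  have cB: "cos_kernel r x y \<le> B" for x y unfolding B_def by (rule cos_kernel_upper[OF r])
  have Kle: "\<bar>L x y\<bar> \<le> cos_kernel r x y" if "L = cos_kernel r \<or> L = sin_kernel r" for L x y
    using that kernel_bound[OF r] cos_kernel_pos[OF r, of x y] by auto
  have sec: "integrable angles (\<lambda>y. v y * L x y)" if L: "L = cos_kernel r \<or> L = sin_kernel r" for L x
    by (rule integrable_mult_continuous[OF v]) (use L kernel_continuous[OF r] in auto)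
  have prod: "integrable (angles \<Otimes>\<^sub>M angles) (\<lambda>(x, y). v y * L x y)"
    if L: "L = cos_kernel r \<or> L = sin_kernel r" for L
  proof (rule angles2.Fubini_integrable)
    have [measurable]: "(\<lambda>(x, y). L x y) \<in> borel_measurable (angles \<Otimes>\<^sub>M angles)"
      using L kernel_measurable[OF r] by auto
    show m: "(\<lambda>(x, y). v y * L x y) \<in> borel_measurable (angles \<Otimes>\<^sub>M angles)"
      using vm2 \<open>(\<lambda>(x, y). L x y) \<in> _\<close> unfolding case_prod_beta by measurable
    show "AE x in angles. integrable angles (\<lambda>y. case (x, y) of (x, y) \<Rightarrow> v y * L x y)"
      using sec[OF L] by simp
    show "integrable angles (\<lambda>x. LINT y|angles. norm (case (x, y) of (x, y) \<Rightarrow> v y * L x y))"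
    proof (rule angles.integrable_const_bound[where B = "LINT y|angles. \<bar>v y\<bar> * B"])
      have "(LINT y|angles. \<bar>v y * L x y\<bar>) \<le> (LINT y|angles. \<bar>v y\<bar> * B)" for x
      proof (intro integral_mono integrable_abs sec L integrable_mult_left v)
        show "\<bar>v y * L x y\<bar> \<le> \<bar>v y\<bar> * B" for y
          using Kle[OF L, of x y] cB[of x y] by (simp add: abs_mult mult_left_mono)
      qed
      moreover have "0 \<le> (LINT y|angles. \<bar>v y * L x y\<bar>)" for x by simp
      ultimately show "AE x in angles. norm (LINT y|angles. norm (case (x, y) of (x, y) \<Rightarrow> v y * L x y)) \<le> (LINT y|angles. \<bar>v y\<bar> * B)"
        by simp
      show "(\<lambda>x. LINT y|angles. norm (case (x, y) of (x, y) \<Rightarrow> v y * L x y)) \<in> borel_measurable angles"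
        using m by measurable
    qed
  qed
  show int: "integrable angles (kernel_mean K v)"
    using angles2.integrable_fst'[OF prod[OF K]] by (simp add: kernel_mean_def[abs_def])
  show "integrable angles (\<lambda>y. v y * K x y)" by (rule sec[OF K])
  have prod2: "integrable (angles \<Otimes>\<^sub>M angles) (\<lambda>(x, y). \<bar>v y\<bar> * cos_kernel r x y)"
    using integrable_norm[OF prod[OF disjI1[OF refl]]] cos_kernel_pos[OF r]
    by (simp add: case_prod_unfold abs_mult less_imp_le abs_of_pos)
  have sec2: "integrable angles (\<lambda>y. \<bar>v y\<bar> * cos_kernel r x y)" for x
    using integrable_norm[OF sec[OF disjI1[OF refl], of x]] cos_kernel_pos[OF r]
    by (simp add: abs_mult abs_of_pos)
  have "(LINT x|angles. \<bar>kernel_mean K v x\<bar>) \<le> (LINT x|angles. LINT y|angles. \<bar>v y\<bar> * cos_kernel r x y)"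
  proof (rule integral_mono)
    show "integrable angles (\<lambda>x. \<bar>kernel_mean K v x\<bar>)" using int by (rule integrable_abs)
    show "integrable angles (\<lambda>x. LINT y|angles. \<bar>v y\<bar> * cos_kernel r x y)"
      using angles2.integrable_fst'[OF prod2] by simp
    fix x
    have "\<bar>kernel_mean K v x\<bar> \<le> (LINT y|angles. \<bar>v y * K x y\<bar>)"
      unfolding kernel_mean_def by (rule integral_abs_bound)
    also have "\<dots> \<le> (LINT y|angles. \<bar>v y\<bar> * cos_kernel r x y)"
      by (intro integral_mono integrable_abs sec K sec2) (simp add: abs_mult mult_left_mono Kle[OF K])
    finally show "\<bar>kernel_mean K v x\<bar> \<le> (LINT y|angles. \<bar>v y\<bar> * cos_kernel r x y)" .
  qed
  also have "\<dots> = (LINT y|angles. LINT x|angles. \<bar>v y\<bar> * cos_kernel r x y)"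
    using angles2.Fubini_integral[OF prod2] by simp
  also have "\<dots> = (LINT y|angles. \<bar>v y\<bar>)"
    by (simp add: cos_kernel_section[OF r])
  finally show "(LINT x|angles. \<bar>kernel_mean K v x\<bar>) \<le> (LINT x|angles. \<bar>v x\<bar>)" .
qed

lemma kernel_mean_add:
  assumes "0 \<le> r" "r < 1" "integrable angles u" "integrable angles v" "K = cos_kernel r \<or> K = sin_kernel r"
  shows "kernel_mean K (\<lambda>x. u x + v x) x = kernel_mean K u x + kernel_mean K v x"
  unfolding kernel_mean_def distrib_right
  by (intro Bochner_Integration.integral_add kernel_mean_section[where r = r] assms)

lemma kernel_mean_scale: "kernel_mean K (\<lambda>x. c * u x) x = c * kernel_mean K u x"
  unfolding kernel_mean_def by (simp add: mult.assoc)

text \<open>The functions whose Poisson means approximate them in \<open>L\<^sup>1\<close>.  They form a closed subspace, as the means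
  are contractions, and it contains the trigonometric polynomials, on which the means act diagonally.\<close>
definition means_converge :: "(nat \<Rightarrow> real \<Rightarrow> real \<Rightarrow> real) \<Rightarrow> (real \<Rightarrow> real) \<Rightarrow> bool" where
  "means_converge K v \<longleftrightarrow> integrable angles v \<and> (\<lambda>j. LINT x|angles. \<bar>kernel_mean (K j) v x - v x\<bar>) \<longlonglongrightarrow> 0"

context
  fixes r :: "nat \<Rightarrow> real" and K :: "nat \<Rightarrow> real \<Rightarrow> real \<Rightarrow> real"
  assumes r: "\<And>j. 0 \<le> r j" "\<And>j. r j < 1" and lim: "r \<longlonglongrightarrow> 1"
    and K: "\<And>j. K j = cos_kernel (r j) \<or> K j = sin_kernel (r j)"
begin

lemma means_converge_add:
  assumes "means_converge K u" "means_converge K v"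
  shows "means_converge K (\<lambda>x. u x + v x)"
proof -
  have u: "integrable angles u" "(\<lambda>j. LINT x|angles. \<bar>kernel_mean (K j) u x - u x\<bar>) \<longlonglongrightarrow> 0"
    and v: "integrable angles v" "(\<lambda>j. LINT x|angles. \<bar>kernel_mean (K j) v x - v x\<bar>) \<longlonglongrightarrow> 0"
    using assms by (auto simp: means_converge_def)
  have i: "integrable angles (\<lambda>x. \<bar>kernel_mean (K j) w x - w x\<bar>)" if "integrable angles w" for w j
    using kernel_mean_integrable[OF r that K] that by (intro integrable_abs Bochner_Integration.integrable_diff)
  have "(\<lambda>j. LINT x|angles. \<bar>kernel_mean (K j) (\<lambda>x. u x + v x) x - (u x + v x)\<bar>) \<longlonglongrightarrow> 0"
  proof (rule Lim_null_comparison)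
    show "(\<lambda>j. (LINT x|angles. \<bar>kernel_mean (K j) u x - u x\<bar>) + (LINT x|angles. \<bar>kernel_mean (K j) v x - v x\<bar>)) \<longlonglongrightarrow> 0"
      using tendsto_add[OF u(2) v(2)] by simp
    have "(LINT x|angles. \<bar>kernel_mean (K j) (\<lambda>x. u x + v x) x - (u x + v x)\<bar>) \<le>
       (LINT x|angles. \<bar>kernel_mean (K j) u x - u x\<bar> + \<bar>kernel_mean (K j) v x - v x\<bar>)" for j
      by (intro integral_mono i Bochner_Integration.integrable_add u v)
         (auto simp: kernel_mean_add[OF r u(1) v(1) K])
    then show "\<forall>\<^sub>F j in sequentially. norm (LINT x|angles. \<bar>kernel_mean (K j) (\<lambda>x. u x + v x) x - (u x + v x)\<bar>) \<le>
       (LINT x|angles. \<bar>kernel_mean (K j) u x - u x\<bar>) + (LINT x|angles. \<bar>kernel_mean (K j) v x - v x\<bar>)"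
      by (intro always_eventually) (simp add: i u v)
  qed
  then show ?thesis using u v by (simp add: means_converge_def)
qed

lemma means_converge_scale:
  assumes "means_converge K u"
  shows "means_converge K (\<lambda>x. c * u x)"
proof -
  have u: "integrable angles u" "(\<lambda>j. LINT x|angles. \<bar>kernel_mean (K j) u x - u x\<bar>) \<longlonglongrightarrow> 0"
    using assms by (auto simp: means_converge_def)
  have "\<bar>kernel_mean (K j) (\<lambda>x. c * u x) x - c * u x\<bar> = \<bar>c\<bar> * \<bar>kernel_mean (K j) u x - u x\<bar>" for j x
    by (simp add: kernel_mean_scale flip: right_diff_distrib abs_mult)
  then show ?thesis using u tendsto_mult_right_zero[OF u(2), of "\<bar>c\<bar>"] by (simp add: means_converge_def)
qed

lemma means_converge_eigen:
  assumes u: "continuous_on {0..pi} u" and eig: "\<And>j x. kernel_mean (K j) u x = r j ^ n * u x"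
  shows "means_converge K u"
proof -
  have "(\<lambda>j. \<bar>r j ^ n - 1\<bar> * (LINT x|angles. \<bar>u x\<bar>)) \<longlonglongrightarrow> \<bar>1 ^ n - 1\<bar> * (LINT x|angles. \<bar>u x\<bar>)"
    by (intro tendsto_intros lim)
  moreover have "\<bar>kernel_mean (K j) u x - u x\<bar> = \<bar>r j ^ n - 1\<bar> * \<bar>u x\<bar>" for j x
    by (simp add: eig left_diff_distrib flip: abs_mult)
  ultimately show ?thesis using integrable_angles_continuous[OF u] by (simp add: means_converge_def)
qed

lemma means_converge_closed:
  assumes v: "integrable angles v"
    and dense: "\<And>e. 0 < e \<Longrightarrow> \<exists>u. means_converge K u \<and> (LINT x|angles. \<bar>v x - u x\<bar>) < e"
  shows "means_converge K v"
proof -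
  have "(\<lambda>j. LINT x|angles. \<bar>kernel_mean (K j) v x - v x\<bar>) \<longlonglongrightarrow> 0"
  proof (rule LIMSEQ_I)
    fix e :: real assume "0 < e"
    then obtain u where u: "means_converge K u" and e: "(LINT x|angles. \<bar>v x - u x\<bar>) < e / 3"
      using dense[of "e / 3"] by auto
    have ui: "integrable angles u" and "(\<lambda>j. LINT x|angles. \<bar>kernel_mean (K j) u x - u x\<bar>) \<longlonglongrightarrow> 0"
      using u by (auto simp: means_converge_def)
    from LIMSEQ_D[OF this(2), of "e / 3"] \<open>0 < e\<close>
    obtain N where N: "\<And>j. j \<ge> N \<Longrightarrow> (LINT x|angles. \<bar>kernel_mean (K j) u x - u x\<bar>) < e / 3" by auto
    have di: "integrable angles (\<lambda>x. v x - u x)" using v ui by simp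
    show "\<exists>N. \<forall>j\<ge>N. norm ((LINT x|angles. \<bar>kernel_mean (K j) v x - v x\<bar>) - 0) < e"
    proof (intro exI allI impI)
      fix j assume "j \<ge> N"
      note mi = kernel_mean_integrable[OF r _ K]
      have dec: "kernel_mean (K j) v x = kernel_mean (K j) u x + kernel_mean (K j) (\<lambda>x. v x - u x) x" for x
        using kernel_mean_add[OF r ui di K, of j x] by simp
      have "(LINT x|angles. \<bar>kernel_mean (K j) v x - v x\<bar>) \<le>
         (LINT x|angles. \<bar>kernel_mean (K j) u x - u x\<bar> + (\<bar>kernel_mean (K j) (\<lambda>x. v x - u x) x\<bar> + \<bar>v x - u x\<bar>))"
        by (intro integral_mono integrable_abs Bochner_Integration.integrable_add
              Bochner_Integration.integrable_diff mi v ui di) (simp add: dec)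
      also have "\<dots> = (LINT x|angles. \<bar>kernel_mean (K j) u x - u x\<bar>) + ((LINT x|angles. \<bar>kernel_mean (K j) (\<lambda>x. v x - u x) x\<bar>) + (LINT x|angles. \<bar>v x - u x\<bar>))"
        using mi[OF ui, of j] mi[OF di, of j] ui di by simp
      also have "\<dots> < e"
        using N[OF \<open>j \<ge> N\<close>] kernel_mean_norm_le[OF r di K, of j] e by linarith
      finally show "norm ((LINT x|angles. \<bar>kernel_mean (K j) v x - v x\<bar>) - 0) < e" by simp
    qed
  qed
  with v show ?thesis by (simp add: means_converge_def)
qed

end

lemma integrable_weighted_density:
  assumes "integrable angles v" "0 < e" "continuous_on {0..pi} w" "\<And>x. 0 < x \<Longrightarrow> x < pi \<Longrightarrow> 0 < w x"
  shows "\<exists>q. (LINT x|angles. \<bar>v x - w x * poly q (cos x)\<bar>) < e"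
proof -
  have inj: "inj_on cos {0..pi}"
    by (metis cos_inj_pi atLeastAtMost_iff inj_onI)
  show ?thesis
    using weighted_polynomial_density[of v 0 pi 1 e w cos] assms inj
    by (auto simp: borel_measurable_integrable continuous_intros)
qed

lemma
  assumes r: "\<And>j. 0 \<le> r j" "\<And>j. r j < (1::real)" and lim: "r \<longlonglongrightarrow> 1" and v: "integrable angles v"
  shows cos_mean_tendsto: "(\<lambda>j. LINT x|angles. \<bar>kernel_mean (cos_kernel (r j)) v x - v x\<bar>) \<longlonglongrightarrow> 0"
    and sin_mean_tendsto: "(\<lambda>j. LINT x|angles. \<bar>kernel_mean (sin_kernel (r j)) v x - v x\<bar>) \<longlonglongrightarrow> 0"
proof -
  have "means_converge (\<lambda>j. cos_kernel (r j)) (\<lambda>x. poly q (cos x))" for q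
    proof (rule cos_poly_induct)
    show "means_converge (\<lambda>j. cos_kernel (r j)) (\<lambda>x. cos (real k * x))" for k
      by (rule means_converge_eigen[OF r lim, where n = k]) (auto intro!: continuous_intros cos_mean_cos r)
  qed (auto intro!: means_converge_add[OF r lim] means_converge_scale[OF r lim])
  moreover have "\<exists>q. (LINT x|angles. \<bar>v x - poly q (cos x)\<bar>) < e" if "0 < e" for e
    using integrable_weighted_density[OF v that, of "\<lambda>_. 1"] by simp
  ultimately have "means_converge (\<lambda>j. cos_kernel (r j)) v"
    by (intro means_converge_closed[OF r lim disjI1[OF refl] v]) blast
  then show "(\<lambda>j. LINT x|angles. \<bar>kernel_mean (cos_kernel (r j)) v x - v x\<bar>) \<longlonglongrightarrow> 0"
    by (simp add: means_converge_def)
  have "means_converge (\<lambda>j. sin_kernel (r j)) (\<lambda>x. sin x * poly q (cos x))" for q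
    proof (rule sin_poly_induct)
    show "means_converge (\<lambda>j. sin_kernel (r j)) (\<lambda>x. sin (real k * x))" for k
      by (rule means_converge_eigen[OF r lim, where n = k]) (auto intro!: continuous_intros sin_mean_sin r)
  qed (auto intro!: means_converge_add[OF r lim] means_converge_scale[OF r lim])
  moreover have "\<exists>q. (LINT x|angles. \<bar>v x - sin x * poly q (cos x)\<bar>) < e" if "0 < e" for e
    using integrable_weighted_density[OF v that, of sin] by (simp add: continuous_intros sin_gt_zero)
  ultimately have "means_converge (\<lambda>j. sin_kernel (r j)) v"
    by (intro means_converge_closed[OF r lim disjI2[OF refl] v]) blast
  then show "(\<lambda>j. LINT x|angles. \<bar>kernel_mean (sin_kernel (r j)) v x - v x\<bar>) \<longlonglongrightarrow> 0"
    by (simp add: means_converge_def)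
qed

section \<open>Boundary values of the generating function\<close>

lemma real_series_holomorphic:
  assumes "real_series c F"
  shows "F holomorphic_on ball 0 1"
  by (rule power_series_holomorphic[where a = "\<lambda>k. of_real (c k)"]) (use assms in \<open>auto simp: real_series_def\<close>)

lemma real_series_cnj:
  assumes "real_series c F" "norm w < 1"
  shows "F (cnj w) = cnj (F w)"
proof -
  have "(\<lambda>k. cnj (of_real (c k) * w ^ k)) sums cnj (F w)"
    using assms by (simp only: sums_cnj real_series_def)
  moreover have "(\<lambda>k. of_real (c k) * cnj w ^ k) sums F (cnj w)"
    using assms by (simp add: real_series_def)
  ultimately show ?thesis by (auto intro: sums_unique2)
qed

lemma continuous_on_circle:
  assumes "F holomorphic_on ball 0 1" "0 \<le> r" "r < 1"
  shows "continuous_on A (\<lambda>x. F (rcis r x))"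
proof (rule continuous_on_compose2[OF holomorphic_on_imp_continuous_on[OF assms(1)]])
  show "continuous_on A (\<lambda>x. rcis r x)"
    unfolding rcis_def cis_conv_exp by (intro continuous_intros)
qed (use assms in auto)

text \<open>On the upper half circle alone, thanks to the symmetry of \<open>F\<close>.\<close>
lemma disc_mean_value:
  assumes "F holomorphic_on ball 0 1" "\<And>w. norm w < 1 \<Longrightarrow> F (cnj w) = cnj (F w)" "0 \<le> r" "r < 1"
  shows "(LINT x|angles. Re (F (rcis r x))) = pi * Re (F 0)"
  using real_series_exists[OF assms(1,2)] real_series_mean assms(3,4) by blast

text \<open>The equation on the half circle.  The conditions \<open>moments\<close> say that \<open>U (1 - \<i> b)\<close> is the boundary value of
  a holomorphic function.\<close>
locale boundary_data =
  fixes P M :: real and b U :: "real \<Rightarrow> real"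
  assumes P: "0 < P" and M: "0 \<le> M"
    and U_int: "integrable angles U" and U_nonneg: "AE x in angles. 0 \<le> U x"
    and U_mass: "(LINT x|angles. U x) = P"
    and b_meas [measurable]: "b \<in> borel_measurable angles" and b_le: "AE x in angles. \<bar>b x\<bar> \<le> M"
    and moments: "\<And>k. 0 < k \<Longrightarrow> (LINT x|angles. U x * (cos (real k * x) + b x * sin (real k * x))) = 0"
begin

lemma U_meas [measurable]: "U \<in> borel_measurable angles"
  using U_int by simp

text \<open>The imaginary part of the boundary value \<open>U (1 - \<i> b)\<close>.\<close>
definition V :: "real \<Rightarrow> real" where "V x = - (b x * U x)"

lemma V_le: "AE x in angles. \<bar>V x\<bar> \<le> M * U x"
  using b_le U_nonneg by eventually_elim (simp add: V_def abs_mult mult_right_mono)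

lemma V_int: "integrable angles V"
  using integrable_mult_bounded[OF U_int b_meas b_le] by (simp add: V_def[abs_def] mult.commute)

text \<open>The moment conditions, read as equality of the coefficients of the real and the imaginary part.\<close>
lemma V_sin:
  assumes "0 < k"
  shows "(LINT x|angles. V x * sin (real k * x)) = (LINT x|angles. U x * cos (real k * x))"
proof -
  have "(LINT x|angles. U x * (cos (real k * x) + b x * sin (real k * x))) =
        (LINT x|angles. U x * cos (real k * x) - V x * sin (real k * x))"
    by (simp add: V_def algebra_simps)
  also have "\<dots> = (LINT x|angles. U x * cos (real k * x)) - (LINT x|angles. V x * sin (real k * x))"
    by (intro Bochner_Integration.integral_diff integrable_mult_continuous U_int V_int continuous_intros)
  finally show ?thesis using moments[OF assms] by simp
qed

definition g :: "nat \<Rightarrow> real" where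
  "g k = poisson_coeff k / pi * (LINT x|angles. U x * cos (real k * x))"

definition G :: "complex \<Rightarrow> complex" where
  "G w = (\<Sum>k. of_real (g k) * w ^ k)"

lemma g_0: "g 0 = P / pi"
  by (simp add: g_def poisson_coeff_def U_mass)

lemma g_bound: "\<bar>g k\<bar> \<le> 2 * P / pi"
proof -
  have "\<bar>LINT x|angles. U x * cos (real k * x)\<bar> \<le> (LINT x|angles. \<bar>U x * cos (real k * x)\<bar>)"
    by (rule integral_abs_bound)
  also have "\<dots> \<le> (LINT x|angles. U x)"
  proof (rule integral_mono_AE)
    show "AE x in angles. \<bar>U x * cos (real k * x)\<bar> \<le> U x"
      using U_nonneg by eventually_elim (simp add: abs_mult mult_left_le)
  qed (intro integrable_abs integrable_mult_continuous U_int continuous_intros)+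
  finally have "\<bar>LINT x|angles. U x * cos (real k * x)\<bar> \<le> P" by (simp add: U_mass)
  then have "poisson_coeff k / pi * \<bar>LINT x|angles. U x * cos (real k * x)\<bar> \<le> 2 / pi * P"
    by (intro mult_mono divide_right_mono) (auto simp: poisson_coeff_def)
  then show ?thesis by (simp add: g_def abs_mult poisson_coeff_def)
qed

lemma G_series: "real_series g G"
  unfolding real_series_def
proof (intro allI impI)
  fix w :: complex assume w: "norm w < 1"
  have "summable (\<lambda>k. 2 * P / pi * norm w ^ k)"
    using w by (intro summable_mult summable_geometric) simp
  then have "summable (\<lambda>k. of_real (g k) * w ^ k)"
  proof (rule summable_comparison_test'[where N = 0])
    show "norm (of_real (g k) * w ^ k) \<le> 2 * P / pi * norm w ^ k" for k
      using mult_right_mono[OF g_bound[of k], of "norm w ^ k"] by (simp add: norm_mult norm_power)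
  qed
  then show "(\<lambda>k. of_real (g k) * w ^ k) sums G w"
    unfolding G_def by (rule summable_sums)
qed

lemmas G_holomorphic = real_series_holomorphic[OF G_series]

lemma G_Re:
  assumes "0 \<le> r" "r < 1"
  shows "Re (G (rcis r x)) = kernel_mean (cos_kernel r) U x"
  unfolding real_series_polar[OF G_series assms] cos_mean_series[OF assms U_int assms]
  by (simp add: g_def mult_ac)

text \<open>Here the equation enters: the sine series with the coefficients of \<open>U\<close> is the Poisson integral of \<open>V\<close>.\<close>
lemma G_Im:
  assumes "0 \<le> r" "r < 1"
  shows "Im (G (rcis r x)) = kernel_mean (sin_kernel r) V x"
proof -
  have "g k * r ^ k * sin (real k * x) = poisson_coeff k * r ^ k * (LINT y|angles. V y * sin (real k * y)) / pi * sin (real k * x)" for k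
  proof (cases "k = 0")
    case False
    then show ?thesis unfolding g_def by (subst V_sin) (auto simp: mult_ac)
  qed simp
  then show ?thesis
    unfolding real_series_polar[OF G_series assms] sin_mean_series[OF assms V_int assms] by simp
qed

text \<open>The condition \<open>\<bar>Im z\<bar> \<le> M Re z\<close> holds for the boundary values and is inherited by their Poisson means;
  the lower bound of the kernel makes the real part strictly positive.\<close>
lemma
  assumes w: "norm w < 1"
  shows G_Re_pos: "0 < Re (G w)" and G_Im_le: "\<bar>Im (G w)\<bar> \<le> M * Re (G w)"
proof -
  define r where "r = norm w"
  have r: "0 \<le> r" "r < 1" using w by (auto simp: r_def)
  have weq: "w = rcis r (Arg w)" by (simp add: r_def rcis_cmod_Arg)
  define x where "x = Arg w"
  have ci: "integrable angles (\<lambda>y. U y * cos_kernel r x y)"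
    by (rule kernel_mean_section[OF r U_int]) simp
  have si: "integrable angles (\<lambda>y. V y * sin_kernel r x y)"
    by (rule kernel_mean_section[OF r V_int]) simp
  have "(LINT y|angles. U y * ((1 - r) / (1 + r) / pi)) \<le> kernel_mean (cos_kernel r) U x"
    unfolding kernel_mean_def
  proof (rule integral_mono_AE)
    show "AE y in angles. U y * ((1 - r) / (1 + r) / pi) \<le> U y * cos_kernel r x y"
      using U_nonneg by eventually_elim (intro mult_left_mono cos_kernel_lower r)
  qed (use ci U_int in auto)
  moreover have "0 < P * ((1 - r) / (1 + r) / pi)"
    using P r by simp
  ultimately show "0 < Re (G w)"
    by (subst weq) (simp add: G_Re r U_mass flip: x_def)
  have "\<bar>kernel_mean (sin_kernel r) V x\<bar> \<le> (LINT y|angles. \<bar>V y * sin_kernel r x y\<bar>)"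
    unfolding kernel_mean_def by (rule integral_abs_bound)
  also have "\<dots> \<le> (LINT y|angles. M * (U y * cos_kernel r x y))"
  proof (rule integral_mono_AE)
    show "AE y in angles. \<bar>V y * sin_kernel r x y\<bar> \<le> M * (U y * cos_kernel r x y)"
      using V_le U_nonneg
    proof eventually_elim
      case (elim y)
      then have "\<bar>V y\<bar> * \<bar>sin_kernel r x y\<bar> \<le> (M * U y) * cos_kernel r x y"
        using M by (intro mult_mono kernel_bound r) auto
      then show ?case by (simp add: abs_mult mult.assoc)
    qed
  qed (use ci si in auto)
  also have "\<dots> = M * kernel_mean (cos_kernel r) U x"
    by (simp add: kernel_mean_def)
  finally show "\<bar>Im (G w)\<bar> \<le> M * Re (G w)"
    by (subst (1 2) weq) (simp add: G_Re G_Im r flip: x_def)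
qed

lemma G_nonneg_Reals: "norm w < 1 \<Longrightarrow> G w \<notin> \<real>\<^sub>\<le>\<^sub>0"
  using G_Re_pos[of w] by (auto simp: complex_nonpos_Reals_iff)

text \<open>Normalised so that \<open>h 0 = 0\<close>.\<close>
definition h :: "complex \<Rightarrow> complex" where
  "h w = Ln (G w) - of_real (ln (P / pi))"

lemma h_holomorphic: "h holomorphic_on ball 0 1"
  unfolding h_def using G_nonneg_Reals by (intro holomorphic_intros G_holomorphic) auto

lemma h_cnj: "norm w < 1 \<Longrightarrow> h (cnj w) = cnj (h w)"
  unfolding h_def using real_series_cnj[OF G_series, of w] G_nonneg_Reals[of w] by (simp add: cnj_Ln)

lemma h_0: "h 0 = 0"
proof -
  have "G 0 = of_real (P / pi)" using real_series_0[OF G_series] g_0 by simp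
  then show ?thesis unfolding h_def using P by (simp del: of_real_divide add: Ln_of_real)
qed

lemma G_eq_exp:
  assumes "norm w < 1"
  shows "G w = of_real (P / pi) * exp (h w)"
proof -
  have "G w \<noteq> 0" using G_Re_pos[OF assms] by auto
  moreover have "exp (of_real (ln (P / pi)) :: complex) = of_real (P / pi)"
    using P by (simp add: exp_of_real del: of_real_divide)
  ultimately show ?thesis using P by (simp add: h_def exp_diff del: of_real_divide)
qed

lemma h_Im:
  assumes "norm w < 1"
  shows "Im (h w) = arctan (Im (G w) / Re (G w))"
proof -
  have "G w \<noteq> 0" using G_Re_pos[OF assms] by auto
  then show ?thesis
    using arg_conv_arctan[OF G_Re_pos[OF assms]] by (simp add: h_def Arg_eq_Im_Ln)
qed

lemma h_Im_le:
  assumes "norm w < 1"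
  shows "\<bar>Im (h w)\<bar> \<le> arctan M"
proof -
  have "\<bar>Im (G w) / Re (G w)\<bar> \<le> M"
    using G_Re_pos[OF assms] G_Im_le[OF assms] by (simp add: abs_divide pos_divide_le_eq)
  then have "- M \<le> Im (G w) / Re (G w)" "Im (G w) / Re (G w) \<le> M"
    by (simp_all only: abs_le_iff minus_le_iff)
  then have "arctan (- M) \<le> Im (h w)" "Im (h w) \<le> arctan M"
    unfolding h_Im[OF assms] by (simp_all only: arctan_le_iff)
  then show ?thesis by (simp add: arctan_minus)
qed

lemma h_Re:
  assumes "norm w < 1"
  shows "Re (h w) = ln (norm (G w)) - ln (P / pi)"
proof -
  have "G w \<noteq> 0" using G_Re_pos[OF assms] by auto
  then show ?thesis by (simp add: h_def)
qed

text \<open>The mean of \<open>h\<^sup>2\<close> vanishes with \<open>h 0\<close>, so the real part of \<open>h\<close> has the same \<open>L\<^sup>2\<close> norm on every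
  circle as its bounded imaginary part.\<close>
lemma h_square_mean:
  assumes r: "0 \<le> r" "r < 1"
  shows "(LINT x|angles. (Re (h (rcis r x)))\<^sup>2) \<le> pi * (pi / 2)\<^sup>2"
proof -
  have "(LINT x|angles. Re ((h (rcis r x))\<^sup>2)) = pi * Re ((h 0)\<^sup>2)"
    by (rule disc_mean_value) (use r h_cnj in \<open>auto intro!: holomorphic_intros h_holomorphic\<close>)
  then have "(LINT x|angles. (Re (h (rcis r x)))\<^sup>2 - (Im (h (rcis r x)))\<^sup>2) = 0"
    by (simp add: h_0 Re_power2)
  moreover have i: "integrable angles (\<lambda>x. (Re (h (rcis r x)))\<^sup>2)" "integrable angles (\<lambda>x. (Im (h (rcis r x)))\<^sup>2)"
    by (intro integrable_angles_continuous continuous_intros continuous_on_circle h_holomorphic r)+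
  ultimately have "(LINT x|angles. (Re (h (rcis r x)))\<^sup>2) = (LINT x|angles. (Im (h (rcis r x)))\<^sup>2)"
    by simp
  also have "\<dots> \<le> (LINT x|angles. (pi / 2)\<^sup>2)"
  proof (intro integral_mono i)
    fix x
    have "\<bar>Im (h (rcis r x))\<bar> \<le> \<bar>pi / 2\<bar>"
      using h_Im_le[of "rcis r x"] arctan_ubound[of M] r by simp
    then show "(Im (h (rcis r x)))\<^sup>2 \<le> (pi / 2)\<^sup>2" by (simp only: abs_le_square_iff)
  qed auto
  finally show ?thesis by simp
qed

text \<open>Convergence in \<open>L\<^sup>1\<close> of the Poisson means, along a sequence of radii that makes it pointwise.\<close>
lemma boundary_limit:
  "\<exists>\<rho> :: nat \<Rightarrow> real. (\<forall>j. 0 \<le> \<rho> j) \<and> (\<forall>j. \<rho> j < 1) \<and> \<rho> \<longlonglongrightarrow> 1 \<and>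
    (AE x in angles. (\<lambda>j. G (rcis (\<rho> j) x)) \<longlonglongrightarrow> Complex (U x) (V x))"
proof -
  define \<sigma> where "\<sigma> = radius"
  note \<sigma> = radius_bounds[folded \<sigma>_def] and lim = radius_tendsto[folded \<sigma>_def]
  let ?D = "\<lambda>j x. \<bar>kernel_mean (cos_kernel (\<sigma> j)) U x - U x\<bar> + \<bar>kernel_mean (sin_kernel (\<sigma> j)) V x - V x\<bar>"
  have "integrable angles (\<lambda>x. \<bar>kernel_mean K v x - v x\<bar>)"
    if "integrable angles v" "K = cos_kernel (\<sigma> j) \<or> K = sin_kernel (\<sigma> j)" for K v j
    using kernel_mean_integrable[OF \<sigma> that] that(1) by (intro integrable_abs Bochner_Integration.integrable_diff)
  then have i: "integrable angles (\<lambda>x. \<bar>kernel_mean (cos_kernel (\<sigma> j)) U x - U x\<bar>)"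
      "integrable angles (\<lambda>x. \<bar>kernel_mean (sin_kernel (\<sigma> j)) V x - V x\<bar>)" for j
    using U_int V_int by blast+
  have "(\<lambda>j. LINT x|angles. norm (?D j x)) \<longlonglongrightarrow> 0"
    using tendsto_add[OF cos_mean_tendsto[OF \<sigma> lim U_int] sin_mean_tendsto[OF \<sigma> lim V_int]]
    by (simp add: i)
  then obtain s where s: "strict_mono s" "AE x in angles. (\<lambda>j. ?D (s j) x) \<longlonglongrightarrow> 0"
    using tendsto_L1_AE_subseq[of angles ?D] i by auto
  have "AE x in angles. (\<lambda>j. G (rcis (\<sigma> (s j)) x)) \<longlonglongrightarrow> Complex (U x) (V x)"
    using s(2)
  proof eventually_elim
    case (elim x)
    have "(\<lambda>j. kernel_mean (cos_kernel (\<sigma> (s j))) U x - U x) \<longlonglongrightarrow> 0"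
      by (rule Lim_null_comparison[OF always_eventually elim]) simp
    moreover have "(\<lambda>j. kernel_mean (sin_kernel (\<sigma> (s j))) V x - V x) \<longlonglongrightarrow> 0"
      by (rule Lim_null_comparison[OF always_eventually elim]) simp
    ultimately have "(\<lambda>j. Re (G (rcis (\<sigma> (s j)) x))) \<longlonglongrightarrow> U x" "(\<lambda>j. Im (G (rcis (\<sigma> (s j)) x))) \<longlonglongrightarrow> V x"
      by (simp_all add: G_Re G_Im \<sigma> LIM_zero_iff)
    then show ?case by (simp add: tendsto_complex_iff)
  qed
  moreover have "(\<lambda>j. \<sigma> (s j)) \<longlonglongrightarrow> 1"
    using LIMSEQ_subseq_LIMSEQ[OF lim s(1)] by (simp add: o_def)
  ultimately show ?thesis using \<sigma> by (intro exI[of _ "\<lambda>j. \<sigma> (s j)"]) simp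
qed

text \<open>A zero of \<open>U\<close> is a zero of \<open>U (1 - \<i> b)\<close>, and there \<open>Re h = ln \<bar>G\<bar> - ln (P / \<pi>)\<close> tends to \<open>-\<infinity>\<close>.  By the
  lemma of Fatou the uniform \<open>L\<^sup>2\<close> bound of \<open>Re h\<close> allows this on a null set only.\<close>
lemma U_pos: "AE x in angles. 0 < U x"
proof -
  from boundary_limit obtain \<rho> :: "nat \<Rightarrow> real" where \<rho>01: "\<forall>j. 0 \<le> \<rho> j" "\<forall>j. \<rho> j < 1" and \<rho>1: "\<rho> \<longlonglongrightarrow> 1"
    and lim: "AE x in angles. (\<lambda>j. G (rcis (\<rho> j) x)) \<longlonglongrightarrow> Complex (U x) (V x)"
    by (elim exE conjE)
  note \<rho> = spec[OF \<rho>01(1)] spec[OF \<rho>01(2)]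
  let ?f = "\<lambda>j x. (Re (h (rcis (\<rho> j) x)))\<^sup>2"
  have i: "integrable angles (?f j)" for j
    by (intro integrable_angles_continuous continuous_intros continuous_on_circle h_holomorphic \<rho>)
  have "(\<integral>\<^sup>+x. liminf (\<lambda>j. ennreal (?f j x)) \<partial>angles) \<le> liminf (\<lambda>j. \<integral>\<^sup>+x. ennreal (?f j x) \<partial>angles)"
    using i by (intro nn_integral_liminf) auto
  also have "\<dots> \<le> liminf (\<lambda>j. ennreal (pi * (pi / 2)\<^sup>2))"
  proof (intro Liminf_mono always_eventually allI)
    fix j
    have "(\<integral>\<^sup>+x. ennreal (?f j x) \<partial>angles) = ennreal (LINT x|angles. ?f j x)"
      by (intro nn_integral_eq_integral i) auto
    then show "(\<integral>\<^sup>+x. ennreal (?f j x) \<partial>angles) \<le> ennreal (pi * (pi / 2)\<^sup>2)"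
      using h_square_mean[OF \<rho>, of j] by (simp add: ennreal_leI)
  qed
  also have "\<dots> < \<infinity>" by (simp add: Liminf_const)
  finally have "AE x in angles. liminf (\<lambda>j. ennreal (?f j x)) \<noteq> \<infinity>"
    using i by (intro nn_integral_PInf_AE) auto
  then show ?thesis
    using lim U_nonneg
  proof eventually_elim
    case (elim x)
    have "U x \<noteq> 0"
    proof
      assume "U x = 0"
      then have "Complex (U x) (V x) = 0" by (simp add: V_def complex_eq_iff)
      with elim have "(\<lambda>j. G (rcis (\<rho> j) x)) \<longlonglongrightarrow> 0" by simp
      then have "(\<lambda>j. norm (G (rcis (\<rho> j) x))) \<longlonglongrightarrow> 0" by (rule tendsto_norm_zero)
      moreover have pos: "0 < norm (G (rcis (\<rho> j) x))" for j
        using G_Re_pos[of "rcis (\<rho> j) x"] \<rho>[of j] by auto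
      ultimately have "filterlim (\<lambda>j. norm (G (rcis (\<rho> j) x))) (at_right 0) sequentially"
        by (auto simp: filterlim_at intro!: always_eventually)
      from filterlim_compose[OF ln_at_0 this]
      have "filterlim (\<lambda>j. ln (norm (G (rcis (\<rho> j) x)))) at_bot sequentially" .
      then have "filterlim (\<lambda>j. - ln (norm (G (rcis (\<rho> j) x)))) at_top sequentially"
        by (simp add: filterlim_uminus_at_bot)
      from filterlim_tendsto_add_at_top[OF tendsto_const[of "ln (P / pi)"] this]
      have "filterlim (\<lambda>j. - Re (h (rcis (\<rho> j) x))) at_top sequentially"
        by (simp add: h_Re \<rho>)
      from filterlim_at_top_mult_at_top[OF this this]
      have "filterlim (\<lambda>j. Re (h (rcis (\<rho> j) x)) * Re (h (rcis (\<rho> j) x))) at_top sequentially"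
        by simp
      then have "(\<lambda>j. ennreal (?f j x)) \<longlonglongrightarrow> \<infinity>"
        by (simp add: power2_eq_square ennreal_tendsto_top_eq_at_top)
      then have "liminf (\<lambda>j. ennreal (?f j x)) = \<infinity>"
        by (rule lim_imp_Liminf[OF sequentially_bot])
      with elim show False by simp
    qed
    with elim show ?case by simp
  qed
qed

text \<open>Since \<open>U > 0\<close> almost everywhere, \<open>Im h = arctan (Im G / Re G)\<close> converges boundedly to
  \<open>arctan (V / U) = - arctan b\<close>.\<close>
lemma log_series_coeff:
  obtains c where "real_series c h"
    "\<And>n. 0 < n \<Longrightarrow> c n = - (2 / pi) * (LINT x|angles. arctan (b x) * sin (real n * x))"
proof -
  from real_series_exists[OF h_holomorphic h_cnj] obtain c where c: "real_series c h" ..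
  have "c n = - (2 / pi) * (LINT x|angles. arctan (b x) * sin (real n * x))" if n: "0 < n" for n
  proof -
    from boundary_limit obtain \<rho> :: "nat \<Rightarrow> real" where \<rho>01: "\<forall>j. 0 \<le> \<rho> j" "\<forall>j. \<rho> j < 1" and \<rho>1: "\<rho> \<longlonglongrightarrow> 1"
    and lim: "AE x in angles. (\<lambda>j. G (rcis (\<rho> j) x)) \<longlonglongrightarrow> Complex (U x) (V x)"
    by (elim exE conjE)
  note \<rho> = spec[OF \<rho>01(1)] spec[OF \<rho>01(2)]
    have i: "integrable angles (\<lambda>x. Im (h (rcis (\<rho> j) x)) * sin (real n * x))" for j
      by (intro integrable_angles_continuous continuous_intros continuous_on_circle h_holomorphic \<rho>)
    have "(\<lambda>j. LINT x|angles. Im (h (rcis (\<rho> j) x)) * sin (real n * x)) \<longlonglongrightarrow>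
        (LINT x|angles. - arctan (b x) * sin (real n * x))"
    proof (rule integral_dominated_convergence[where w = "\<lambda>_. pi / 2"])
      show "(\<lambda>x. - arctan (b x) * sin (real n * x)) \<in> borel_measurable angles"
        by (intro borel_measurable_times borel_measurable_uminus measurable_compose[OF b_meas]
             borel_measurable_continuous_onI measurable_angles_continuous continuous_intros)
      show "(\<lambda>x. Im (h (rcis (\<rho> j) x)) * sin (real n * x)) \<in> borel_measurable angles" for j
        using i by blast
      show "AE x in angles. (\<lambda>j. Im (h (rcis (\<rho> j) x)) * sin (real n * x)) \<longlonglongrightarrow> - arctan (b x) * sin (real n * x)"
        using lim U_pos
      proof eventually_elim
        case (elim x)
        then have "(\<lambda>j. Re (G (rcis (\<rho> j) x))) \<longlonglongrightarrow> U x" "(\<lambda>j. Im (G (rcis (\<rho> j) x))) \<longlonglongrightarrow> V x"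
          by (auto simp: tendsto_complex_iff)
        with elim have "(\<lambda>j. arctan (Im (G (rcis (\<rho> j) x)) / Re (G (rcis (\<rho> j) x)))) \<longlonglongrightarrow> arctan (V x / U x)"
          by (intro tendsto_intros) auto
        moreover have "arctan (V x / U x) = - arctan (b x)"
          using elim by (simp add: V_def arctan_minus)
        ultimately show ?case
          by (intro tendsto_intros) (simp add: h_Im \<rho>)
      qed
      show "AE x in angles. norm (Im (h (rcis (\<rho> j) x)) * sin (real n * x)) \<le> pi / 2" for j
      proof (rule AE_I2)
        fix x
        have "\<bar>Im (h (rcis (\<rho> j) x))\<bar> \<le> pi / 2"
          using h_Im_le[of "rcis (\<rho> j) x"] arctan_ubound[of M] \<rho>[of j] by simp
        then have "\<bar>Im (h (rcis (\<rho> j) x))\<bar> * \<bar>sin (real n * x)\<bar> \<le> pi / 2 * 1"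
          by (intro mult_mono) auto
        then show "norm (Im (h (rcis (\<rho> j) x)) * sin (real n * x)) \<le> pi / 2" by (simp add: abs_mult)
      qed
    qed auto
    moreover have "(\<lambda>j. LINT x|angles. Im (h (rcis (\<rho> j) x)) * sin (real n * x)) \<longlonglongrightarrow> pi / 2 * (c n * 1 ^ n)"
      unfolding real_series_Im_coeff[OF c \<rho> n] by (intro tendsto_intros \<rho>1)
    ultimately have "pi / 2 * (c n * 1 ^ n) = (LINT x|angles. - arctan (b x) * sin (real n * x))"
      by (rule LIMSEQ_unique[OF _ _, rotated])
    then show ?thesis by (simp add: field_simps)
  qed
  then show ?thesis using that c by blast
qed

text \<open>The mean value of \<open>exp (s h)\<close> over each circle is \<open>1\<close>.  Its argument is at most \<open>s arctan M < \<pi> / 2\<close> in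
  absolute value, so its real part controls \<open>\<bar>exp (s h)\<bar> = (\<pi> \<bar>G\<bar> / P)\<^sup>s\<close>, and the lemma of Fatou
  passes to the boundary.\<close>
lemma power_bound:
  assumes s: "0 < s" and sM: "s * arctan M < pi / 2"
  shows "(\<integral>\<^sup>+x. ennreal (U x powr s) \<partial>angles) \<le> ennreal ((P / pi) powr s * (pi / cos (s * arctan M)))"
proof -
  define \<kappa> where "\<kappa> = cos (s * arctan M)"
  have sM0: "0 \<le> s * arctan M" using s M by simp
  have \<kappa>: "0 < \<kappa>" unfolding \<kappa>_def using sM sM0 by (intro cos_gt_zero_pi) auto
  from boundary_limit obtain \<rho> :: "nat \<Rightarrow> real" where \<rho>01: "\<forall>j. 0 \<le> \<rho> j" "\<forall>j. \<rho> j < 1" and \<rho>1: "\<rho> \<longlonglongrightarrow> 1"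
    and lim: "AE x in angles. (\<lambda>j. G (rcis (\<rho> j) x)) \<longlonglongrightarrow> Complex (U x) (V x)"
    by (elim exE conjE)
  note \<rho> = spec[OF \<rho>01(1)] spec[OF \<rho>01(2)]
  let ?f = "\<lambda>j x. Re (G (rcis (\<rho> j) x)) powr s"
  have pos: "0 < Re (G (rcis (\<rho> j) x))" for j x
    by (rule G_Re_pos) (use \<rho>[of j] in simp)
  have i: "integrable angles (?f j)" for j
  proof (intro integrable_angles_continuous continuous_on_powr continuous_intros continuous_on_circle G_holomorphic \<rho>)
    show "\<forall>x\<in>{0..pi}. Re (G (rcis (\<rho> j) x)) \<noteq> 0" using pos[of j] by (metis less_irrefl)
  qed
  have bd: "(LINT x|angles. ?f j x) \<le> (P / pi) powr s * (pi / \<kappa>)" for j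
  proof -
    let ?E = "\<lambda>w. exp (of_real s * h w)"
    have hol: "?E holomorphic_on ball 0 1" by (intro holomorphic_intros h_holomorphic)
    have "(LINT x|angles. Re (?E (rcis (\<rho> j) x))) = pi * Re (?E 0)"
      by (rule disc_mean_value[OF hol]) (use \<rho> h_cnj in \<open>auto simp: exp_cnj\<close>)
    then have mean: "(LINT x|angles. Re (?E (rcis (\<rho> j) x))) = pi" by (simp add: h_0)
    have "(LINT x|angles. ?f j x) \<le> (LINT x|angles. ((P / pi) powr s / \<kappa>) * Re (?E (rcis (\<rho> j) x)))"
    proof (intro integral_mono i integrable_mult_right)
      show "integrable angles (\<lambda>x. Re (?E (rcis (\<rho> j) x)))"
        by (intro integrable_angles_continuous continuous_intros continuous_on_circle[of h] h_holomorphic \<rho>)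
      fix x
      let ?w = "rcis (\<rho> j) x"
      have w: "norm ?w < 1" using \<rho>[of j] by simp
      have "\<bar>s * Im (h ?w)\<bar> \<le> s * arctan M"
        using h_Im_le[OF w] s by (simp add: abs_mult)
      then have "\<kappa> \<le> cos \<bar>s * Im (h ?w)\<bar>"
        unfolding \<kappa>_def using sM pi_gt_zero by (intro cos_monotone_0_pi_le) auto
      then have c: "\<kappa> \<le> cos (s * Im (h ?w))" by simp
      have "exp (s * Re (h ?w)) = (norm (G ?w)) powr s / (P / pi) powr s"
        using P pos[of j x] G_Re_pos[OF w]
        by (subst h_Re[OF w]) (auto simp: powr_def exp_diff right_diff_distrib)
      then have "norm (G ?w) powr s = (P / pi) powr s * exp (s * Re (h ?w))"
        using P by simp
      moreover have "?f j x \<le> norm (G ?w) powr s"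
        using s pos[of j x] complex_Re_le_cmod[of "G ?w"] by (intro powr_mono2) auto
      moreover have "exp (s * Re (h ?w)) \<le> Re (?E ?w) / \<kappa>"
        using c \<kappa> by (simp add: Re_exp pos_le_divide_eq)
      moreover have "0 \<le> (P / pi) powr s" by simp
      ultimately have "?f j x \<le> (P / pi) powr s * (Re (?E ?w) / \<kappa>)"
        by (metis mult_left_mono order_trans)
      then show "?f j x \<le> ((P / pi) powr s / \<kappa>) * Re (?E ?w)" by simp
    qed
    also have "\<dots> = ((P / pi) powr s / \<kappa>) * pi" using mean by simp
    finally show ?thesis by simp
  qed
  have "(\<integral>\<^sup>+x. ennreal (U x powr s) \<partial>angles) = (\<integral>\<^sup>+x. liminf (\<lambda>j. ennreal (?f j x)) \<partial>angles)"
  proof (rule nn_integral_cong_AE)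
    show "AE x in angles. ennreal (U x powr s) = liminf (\<lambda>j. ennreal (?f j x))"
      using lim U_pos
    proof eventually_elim
      case (elim x)
      then have "(\<lambda>j. Re (G (rcis (\<rho> j) x))) \<longlonglongrightarrow> U x" by (auto simp: tendsto_complex_iff)
      then have "(\<lambda>j. ennreal (?f j x)) \<longlonglongrightarrow> ennreal (U x powr s)"
        using elim by (intro tendsto_ennrealI tendsto_powr tendsto_const) auto
      then show ?case by (metis lim_imp_Liminf sequentially_bot)
    qed
  qed
  also have "\<dots> \<le> liminf (\<lambda>j. \<integral>\<^sup>+x. ennreal (?f j x) \<partial>angles)"
    using i by (intro nn_integral_liminf) auto
  also have "\<dots> \<le> liminf (\<lambda>j. ennreal ((P / pi) powr s * (pi / \<kappa>)))"
  proof (intro Liminf_mono always_eventually allI)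
    fix j
    have "(\<integral>\<^sup>+x. ennreal (?f j x) \<partial>angles) = ennreal (LINT x|angles. ?f j x)"
      by (intro nn_integral_eq_integral i) auto
    then show "(\<integral>\<^sup>+x. ennreal (?f j x) \<partial>angles) \<le> ennreal ((P / pi) powr s * (pi / \<kappa>))"
      using bd[of j] by (simp add: ennreal_leI)
  qed
  also have "\<dots> = ennreal ((P / pi) powr s * (pi / \<kappa>))" by (simp add: Liminf_const)
  finally show ?thesis unfolding \<kappa>_def .
qed

lemma series_recursion:
  obtains c where "\<And>n. real (Suc n) * g (Suc n) = (\<Sum>i\<le>n. real (Suc i) * c (Suc i) * g (n - i))"
    "\<And>n. 0 < n \<Longrightarrow> c n = - (2 / pi) * (LINT x|angles. arctan (b x) * sin (real n * x))"
proof -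
  obtain c where c: "real_series c h"
    "\<And>n. 0 < n \<Longrightarrow> c n = - (2 / pi) * (LINT x|angles. arctan (b x) * sin (real n * x))"
    using log_series_coeff by blast
  show ?thesis
    using that[of c] exp_series_recursion[OF G_series c(1) G_eq_exp h_holomorphic] c(2) by blast
qed

end

section \<open>Powers of the sine\<close>

lemma sin_ge_third:
  fixes x :: real
  assumes "0 \<le> x" "x \<le> 2"
  shows "x / 3 \<le> sin x"
proof -
  have "\<bar>sin x - (\<Sum>m<3. sin_coeff m * x ^ m)\<bar> \<le> inverse (fact 3) * \<bar>x\<bar> ^ 3"
    by (rule Maclaurin_sin_bound)
  then have "\<bar>sin x - x\<bar> \<le> x ^ 3 / 6"
    using assms by (simp add: eval_nat_numeral sin_coeff_def)
  moreover have "x ^ 3 \<le> 4 * x"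
  proof -
    have "x * x \<le> 2 * 2" using assms by (intro mult_mono) auto
    then have "(x * x) * x \<le> 4 * x" using assms by (intro mult_right_mono) auto
    then show ?thesis by (simp add: power3_eq_cube)
  qed
  ultimately show ?thesis by linarith
qed

lemma sin_lower_bound:
  assumes "0 < x" "x < pi"
  shows "x / 3 \<le> sin x \<or> (pi - x) / 3 \<le> sin x"
proof (cases "x \<le> 2")
  case True
  then show ?thesis using sin_ge_third[of x] assms by simp
next
  case False
  then have "(pi - x) / 3 \<le> sin (pi - x)"
    using assms pi_less_4 by (intro sin_ge_third) auto
  then show ?thesis by simp
qed

lemma integrable_lebesgue_on_iff:
  "S \<in> sets lebesgue \<Longrightarrow> integrable (lebesgue_on S) f \<longleftrightarrow> f absolutely_integrable_on S"
  by (simp add: integrable_restrict_space set_integrable_def)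

lemma powr_integrable_angles:
  assumes "s < 1"
  shows "integrable angles (\<lambda>x. x powr - s)" "integrable angles (\<lambda>x. (pi - x) powr - s)"
proof -
  have "(\<lambda>x. x powr - s) integrable_on {0..pi}"
    using has_integral_powr_from_0[of "- s" pi] assms by (auto simp: integrable_on_def)
  then have "(\<lambda>x. x powr - s) absolutely_integrable_on {0..pi}"
    by (rule nonnegative_absolutely_integrable_1) simp
  then have a: "(\<lambda>x. x powr - s) absolutely_integrable_on {0<..<pi}"
    by (simp add: absolutely_integrable_on_Icc_iff_Ioo)
  then show "integrable angles (\<lambda>x. x powr - s)"
    by (simp add: integrable_lebesgue_on_iff)
  have im: "(\<lambda>x. pi - x) ` {0<..<pi} = {0<..<pi}"
    by (auto simp: image_iff intro!: bexI[of _ "pi - _"])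
  have "(\<lambda>x. \<bar>- 1\<bar> * (pi - x) powr - s) absolutely_integrable_on {0<..<pi} \<and>
      integral {0<..<pi} (\<lambda>x. \<bar>- 1\<bar> * (pi - x) powr - s) = integral {0<..<pi} (\<lambda>x. x powr - s)"
    by (subst has_absolute_integral_change_of_variables_1'[where f = "\<lambda>x. x powr - s"])
       (use a im in \<open>auto intro!: derivative_eq_intros simp: inj_on_def\<close>)
  then show "integrable angles (\<lambda>x. (pi - x) powr - s)"
    by (simp add: integrable_lebesgue_on_iff)
qed

lemma sin_powr_integrable:
  assumes "0 \<le> s" "s < 1"
  shows "integrable angles (\<lambda>x. sin x powr - s)"
proof (rule Bochner_Integration.integrable_bound)
  show "integrable angles (\<lambda>x. 3 powr s * (x powr - s + (pi - x) powr - s))"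
    by (intro integrable_mult_right Bochner_Integration.integrable_add powr_integrable_angles assms)
  show "(\<lambda>x. sin x powr - s) \<in> borel_measurable angles" by measurable
  show "AE x in angles. norm (sin x powr - s) \<le> norm (3 powr s * (x powr - s + (pi - x) powr - s))"
  proof (rule AE_I2)
    fix x assume "x \<in> space angles"
    then have x: "0 < x" "x < pi" by auto
    have three: "(y / 3) powr - s = 3 powr s * y powr - s" if "0 < y" for y :: real
      using that by (simp add: powr_divide powr_minus divide_simps)
    from sin_lower_bound[OF x] show "norm (sin x powr - s) \<le> norm (3 powr s * (x powr - s + (pi - x) powr - s))"
    proof
      assume "x / 3 \<le> sin x"
      then have "sin x powr - s \<le> (x / 3) powr - s"
        using x assms by (intro powr_mono2') auto
      then show ?thesis using three[of x] x by (simp add: distrib_left add_increasing2)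
    next
      assume "(pi - x) / 3 \<le> sin x"
      then have "sin x powr - s \<le> ((pi - x) / 3) powr - s"
        using x assms by (intro powr_mono2') auto
      then show ?thesis using three[of "pi - x"] x by (simp add: distrib_left add_increasing)
    qed
  qed
qed

section \<open>Uniform weighted power bounds\<close>

text \<open>Either \<open>u\<close> is at most \<open>y\<close> to the power \<open>- (q - 1) / (s - q)\<close>, and the second term dominates, or it is
  larger, and the first one does.\<close>
lemma powr_interpolation:
  fixes u y q s :: real
  assumes q: "1 < q" "q < s" and u: "0 \<le> u" and y: "0 < y"
  shows "u powr q * y powr (1 - q) \<le> u powr s + y powr - ((q - 1) * s / (s - q))"
proof -
  define \<kappa> where "\<kappa> = (q - 1) / (s - q)"
  have \<kappa>: "0 < \<kappa>" "\<kappa> * (s - q) = q - 1" using q by (auto simp: \<kappa>_def)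
  have e: "(q - 1) * s / (s - q) = \<kappa> * q + q - 1"
    using q by (simp add: \<kappa>_def divide_simps) (simp add: algebra_simps)
  show ?thesis
  proof (cases "u \<le> y powr - \<kappa>")
    case True
    then have "u powr q \<le> (y powr - \<kappa>) powr q" using q u by (intro powr_mono2) auto
    then have "u powr q * y powr (1 - q) \<le> (y powr - \<kappa>) powr q * y powr (1 - q)"
      by (intro mult_right_mono) auto
    also have "\<dots> = y powr - ((q - 1) * s / (s - q))"
      unfolding e by (simp add: powr_powr flip: powr_add) (simp add: algebra_simps)
    finally show ?thesis by (simp add: add_increasing)
  next
    case False
    moreover have "0 < y powr - \<kappa>" using y by simp
    ultimately have u0: "0 < u" by linarith
    have "(y powr - \<kappa>) powr (s - q) \<le> u powr (s - q)"
      using False q by (intro powr_mono2) auto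
    then have "y powr (1 - q) \<le> u powr (s - q)"
      using \<kappa>(2) by (simp add: powr_powr)
    then have "u powr q * y powr (1 - q) \<le> u powr q * u powr (s - q)"
      by (intro mult_left_mono) auto
    also have "\<dots> = u powr s" by (simp flip: powr_add)
    finally show ?thesis by (simp add: add_increasing2)
  qed
qed

text \<open>The exponent \<open>s\<close> has to satisfy \<open>s \<beta> < 1/2\<close>, where \<open>\<beta> = arctan M / \<pi>\<close>, for the bound on \<open>\<integral> U\<^sup>s\<close>, and
  \<open>q / (2 - q) < s\<close>, which makes the remaining power of the sine integrable.  Such an \<open>s\<close> exists
  exactly if \<open>q (1/2 + \<beta>) < 1\<close>.\<close>
lemma uniform_weighted_power_bound:
  assumes P: "0 < P" and M: "0 \<le> M" and q: "1 < q" "q < inverse (1/2 + arctan M / pi)"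
  shows "\<exists>C. \<forall>b U. boundary_data P M b U \<longrightarrow>
    (\<integral>\<^sup>+x. ennreal (U x powr q * sin x powr (1 - q)) \<partial>angles) \<le> ennreal C"
proof -
  define \<beta> where "\<beta> = arctan M / pi"
  have \<beta>: "0 \<le> \<beta>" "\<beta> < 1/2"
    using M arctan_ubound[of M] by (auto simp: \<beta>_def divide_simps)
  have q1: "q * (1/2 + \<beta>) < 1"
    using q(2) \<beta> by (simp add: \<beta>_def[symmetric] inverse_eq_divide pos_less_divide_eq)
  have q2: "q < 2"
  proof -
    have "0 \<le> q * \<beta>" using q \<beta> by simp
    with q1 show ?thesis by (simp add: distrib_left)
  qed
  obtain s where s: "q / (2 - q) < s" "s * \<beta> < 1/2"
  proof (cases "\<beta> = 0")
    case True
    then show ?thesis using that[of "q / (2 - q) + 1"] by simp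
  next
    case False
    then have b: "0 < \<beta>" using \<beta> by simp
    have "q * (2 * \<beta>) < 2 - q" using q1 by (simp add: algebra_simps)
    then have "q / (2 - q) < 1 / (2 * \<beta>)" using q2 b by (simp add: divide_simps mult_ac)
    then obtain s where "q / (2 - q) < s" "s < 1 / (2 * \<beta>)" using dense by blast
    then show ?thesis using that[of s] b by (simp add: field_simps)
  qed
  have qs: "q < s"
  proof -
    have "q * (2 - q) < q * 1" using q q2 by (intro mult_strict_left_mono) auto
    then have "q < q / (2 - q)" using q2 by (simp add: pos_less_divide_eq)
    with s show ?thesis by simp
  qed
  define \<sigma> where "\<sigma> = (q - 1) * s / (s - q)"
  have "q < s * (2 - q)" using s(1) q2 by (simp add: pos_divide_less_eq)
  then have \<sigma>: "0 \<le> \<sigma>" "\<sigma> < 1" using q qs by (auto simp: \<sigma>_def divide_simps algebra_simps)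
  have sM: "s * arctan M < pi / 2" using s(2) by (simp add: \<beta>_def field_simps)
  define A where "A = (P / pi) powr s * (pi / cos (s * arctan M))"
  define B where "B = (LINT x|angles. sin x powr - \<sigma>)"
  have c: "0 < cos (s * arctan M)"
    using sM q qs M by (intro cos_gt_zero_pi) (auto intro: less_le_trans[of _ 0] mult_nonneg_nonneg)
  show ?thesis
  proof (intro exI allI impI)
    fix b U assume "boundary_data P M b U"
    then interpret boundary_data P M b U .
    have "(\<integral>\<^sup>+x. ennreal (U x powr q * sin x powr (1 - q)) \<partial>angles) \<le>
        (\<integral>\<^sup>+x. ennreal (U x powr s) + ennreal (sin x powr - \<sigma>) \<partial>angles)"
    proof (rule nn_integral_mono_AE)
      show "AE x in angles. ennreal (U x powr q * sin x powr (1 - q)) \<le> ennreal (U x powr s) + ennreal (sin x powr - \<sigma>)"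
        using U_nonneg AE_space
      proof eventually_elim
        case (elim x)
        then have "U x powr q * sin x powr (1 - q) \<le> U x powr s + sin x powr - \<sigma>"
          unfolding \<sigma>_def by (intro powr_interpolation q qs) (auto intro: sin_gt_zero)
        then show ?case by (simp flip: ennreal_plus)
      qed
    qed
    also have "\<dots> = (\<integral>\<^sup>+x. ennreal (U x powr s) \<partial>angles) + (\<integral>\<^sup>+x. ennreal (sin x powr - \<sigma>) \<partial>angles)"
      by (intro nn_integral_add) auto
    also have "\<dots> \<le> ennreal A + ennreal B"
    proof (rule add_mono)
      show "(\<integral>\<^sup>+x. ennreal (U x powr s) \<partial>angles) \<le> ennreal A"
        unfolding A_def using q qs sM by (intro power_bound) auto
      show "(\<integral>\<^sup>+x. ennreal (sin x powr - \<sigma>) \<partial>angles) \<le> ennreal B"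
        unfolding B_def by (subst nn_integral_eq_integral) (auto intro: sin_powr_integrable \<sigma>)
    qed
    also have "\<dots> = ennreal (A + B)"
    proof (rule ennreal_plus[symmetric])
      show "0 \<le> A" using c by (simp add: A_def)
      show "0 \<le> B" by (simp add: B_def)
    qed
    finally show "(\<integral>\<^sup>+x. ennreal (U x powr q * sin x powr (1 - q)) \<partial>angles) \<le> ennreal (A + B)" .
  qed
qed

section \<open>Continuous dependence of the cosine moments\<close>

lemma moments_tendsto:
  assumes "\<And>j. boundary_data P (M j) (b j) (U j)" and "boundary_data P M' b' U'"
    and lim: "\<And>n. 0 < n \<Longrightarrow> (\<lambda>j. LINT x|angles. arctan (b j x) * sin (real n * x)) \<longlonglongrightarrow>
        (LINT x|angles. arctan (b' x) * sin (real n * x))"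
  shows "(\<lambda>j. LINT x|angles. U j x * cos (real k * x)) \<longlonglongrightarrow> (LINT x|angles. U' x * cos (real k * x))"
proof -
  interpret B: boundary_data P "M j" "b j" "U j" for j by (rule assms)
  interpret L: boundary_data P M' b' U' by (rule assms)
  let ?c = "\<lambda>b n. - (2 / pi) * (LINT x|angles. arctan (b x) * sin (real n * x))"
  have rec: "real (Suc n) * boundary_data.g U (Suc n) =
      (\<Sum>i\<le>n. real (Suc i) * ?c b (Suc i) * boundary_data.g U (n - i))"
    if "boundary_data P M b U" for P M b U n
  proof -
    interpret boundary_data P M b U by (rule that)
    obtain c where "\<And>n. real (Suc n) * g (Suc n) = (\<Sum>i\<le>n. real (Suc i) * c (Suc i) * g (n - i))"
      "\<And>n. 0 < n \<Longrightarrow> c n = ?c b n" using series_recursion by blast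
    then show ?thesis by simp
  qed
  have "(\<lambda>j. boundary_data.g (U j) k) \<longlonglongrightarrow> boundary_data.g U' k"
  proof (rule exp_series_tendsto[where c = "\<lambda>j. ?c (b j)" and c' = "?c b'"])
    show "(\<lambda>j. B.g j 0) \<longlonglongrightarrow> L.g 0" by (simp add: B.g_0 L.g_0)
    show "(\<lambda>j. ?c (b j) n) \<longlonglongrightarrow> ?c b' n" if "0 < n" for n
      by (intro tendsto_mult tendsto_const lim that)
  qed (rule rec[OF assms(1)] rec[OF assms(2)])+
  then have "(\<lambda>j. pi / poisson_coeff k * boundary_data.g (U j) k) \<longlonglongrightarrow> pi / poisson_coeff k * boundary_data.g U' k"
    by (intro tendsto_intros)
  then show ?thesis by (cases "k = 0") (simp_all add: B.g_def L.g_def poisson_coeff_def)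
qed

section \<open>The substitution by the cosine\<close>

lemma cos_image: "cos ` {0<..<pi} = itv"
proof -
  have "x \<in> cos ` {0<..<pi}" if "-1 < x" "x < 1" for x :: real
    using that arccos_lt_bounded[of x] by (intro image_eqI[of _ _ "arccos x"]) auto
  moreover have "-1 < cos x" "cos x < 1" if "0 < x" "x < pi" for x :: real
    using that cos_monotone_0_pi[of 0 x] cos_monotone_0_pi[of x pi] by auto
  ultimately show ?thesis by auto
qed

lemma cos_substitution_abs:
  "(\<lambda>x. sin x * u (cos x)) absolutely_integrable_on {0<..<pi} \<and> integral {0<..<pi} (\<lambda>x. sin x * u (cos x)) = B
   \<longleftrightarrow> u absolutely_integrable_on itv \<and> integral itv u = B"
proof -
  have sn: "\<bar>- sin x\<bar> = sin x" if "x \<in> {0<..<pi}" for x :: real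
    using sin_gt_zero[of x] that by simp
  have "(\<lambda>x. \<bar>- sin x\<bar> * u (cos x)) absolutely_integrable_on {0<..<pi} \<and> integral {0<..<pi} (\<lambda>x. \<bar>- sin x\<bar> * u (cos x)) = B
     \<longleftrightarrow> u absolutely_integrable_on cos ` {0<..<pi} \<and> integral (cos ` {0<..<pi}) u = B"
    by (rule has_absolute_integral_change_of_variables_1')
       (auto intro!: derivative_eq_intros simp: inj_on_def cos_inj_pi)
  moreover have "(\<lambda>x. \<bar>- sin x\<bar> * u (cos x)) absolutely_integrable_on {0<..<pi} \<longleftrightarrow> (\<lambda>x. sin x * u (cos x)) absolutely_integrable_on {0<..<pi}"
    by (rule set_integrable_cong) (use sn in auto)
  moreover have "integral {0<..<pi} (\<lambda>x. \<bar>- sin x\<bar> * u (cos x)) = integral {0<..<pi} (\<lambda>x. sin x * u (cos x))"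
    by (rule integral_cong) (use sn in auto)
  ultimately show ?thesis by (simp add: cos_image)
qed

lemma cos_substitution_integrable:
  "integrable leb_itv u \<longleftrightarrow> integrable angles (\<lambda>x. sin x * u (cos x))"
  using cos_substitution_abs[of u] by (auto simp: integrable_lebesgue_on_iff)

lemma cos_substitution:
  "(LINT x|leb_itv. u x) = (LINT x|angles. sin x * u (cos x))"
proof (cases "integrable leb_itv u")
  case True
  then have i: "integrable angles (\<lambda>x. sin x * u (cos x))" by (simp add: cos_substitution_integrable)
  have "(LINT x|leb_itv. u x) = integral itv u"
    by (rule lebesgue_integral_eq_integral[OF True]) simp
  also have "\<dots> = integral {0<..<pi} (\<lambda>x. sin x * u (cos x))"
    using cos_substitution_abs[of u] True i by (auto simp: integrable_lebesgue_on_iff)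
  also have "\<dots> = (LINT x|angles. sin x * u (cos x))"
    by (rule lebesgue_integral_eq_integral[OF i, symmetric]) simp
  finally show ?thesis .
next
  case False
  then show ?thesis by (simp add: cos_substitution_integrable not_integrable_integral_eq)
qed

text \<open>Bounded measurable functions are integrable, so the substitution rule applies to the truncations of \<open>u\<close>.\<close>
lemma cos_substitution_measurable:
  fixes u :: "real \<Rightarrow> real"
  assumes u: "u \<in> borel_measurable leb_itv"
  shows "(\<lambda>x. u (cos x)) \<in> borel_measurable angles"
proof -
  interpret finite_measure leb_itv by (rule finite_measure_lebesgue_on) simp
  have m: "(\<lambda>x. max (- real n) (min (real n) (u (cos x)))) \<in> borel_measurable angles" for n
  proof -
    have "integrable leb_itv (\<lambda>x. max (- real n) (min (real n) (u x)))"
      using u by (intro integrable_const_bound[where B = "real n"]) auto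
    then have [measurable]: "(\<lambda>x. sin x * max (- real n) (min (real n) (u (cos x)))) \<in> borel_measurable angles"
      by (simp add: cos_substitution_integrable borel_measurable_integrable)
    have "(\<lambda>x. (sin x * max (- real n) (min (real n) (u (cos x)))) / sin x) \<in> borel_measurable angles"
      by measurable
    then show ?thesis
      by (rule measurable_cong[THEN iffD1, rotated]) (use sin_gt_zero in force)
  qed
  show ?thesis
  proof (rule borel_measurable_LIMSEQ_real[OF _ m])
    fix x
    obtain k :: nat where k: "\<bar>u (cos x)\<bar> \<le> k" using real_arch_simple by blast
    show "(\<lambda>n. max (- real n) (min (real n) (u (cos x)))) \<longlonglongrightarrow> u (cos x)"
      by (rule tendsto_eventually, use eventually_ge_at_top[of k] in eventually_elim) (use k in auto)
  qed
qed

text \<open>A null set is the null set of its indicator function, whose integral the substitution preserves.\<close>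
lemma cos_substitution_AE:
  assumes "AE x in leb_itv. Q x"
  shows "AE x in angles. Q (cos x)"
proof -
  obtain N where N: "{x \<in> space leb_itv. \<not> Q x} \<subseteq> N" "N \<in> null_sets leb_itv"
    using assms unfolding eventually_ae_filter by blast
  then have Nm: "N \<in> sets leb_itv" by auto
  have i: "integrable leb_itv (indicator N :: real \<Rightarrow> real)" "(LINT x|leb_itv. indicator N x :: real) = 0"
    using N(2) sets.sets_into_space[OF Nm] by (auto simp: null_sets_def measure_def Int_absorb2)
  then have "integrable angles (\<lambda>x. sin x * (indicator N (cos x) :: real))" "(LINT x|angles. sin x * (indicator N (cos x) :: real)) = 0"
    unfolding cos_substitution_integrable cos_substitution by blast+
  moreover have "AE x in angles. 0 \<le> sin x * (indicator N (cos x) :: real)"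
    by (rule AE_I2) (use sin_gt_zero in \<open>force simp: indicator_def\<close>)
  ultimately have "AE x in angles. sin x * (indicator N (cos x) :: real) = 0"
    using integral_nonneg_eq_0_iff_AE by blast
  then show ?thesis
    using AE_space
  proof eventually_elim
    case (elim x)
    then have "sin x > 0" "cos x \<in> itv" using cos_image by (auto intro: sin_gt_zero)
    with elim have "cos x \<notin> N" by (auto simp: indicator_def split: if_splits)
    with N(1) \<open>cos x \<in> itv\<close> show ?case by auto
  qed
qed

section \<open>The logarithmic kernel\<close>

text \<open>The factor \<open>2\<close> makes the mean over the half circle vanish and turns the kernel into
  \<open>ln \<bar>1 - exp (\<i> (x + y))\<bar> + ln \<bar>1 - exp (\<i> (x - y))\<bar>\<close>.\<close>
definition log_kernel :: "real \<Rightarrow> real \<Rightarrow> real" where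
  "log_kernel x y = ln (2 * \<bar>cos x - cos y\<bar>)"

text \<open>The same expression on a circle of radius \<open>r < 1\<close>, where its cosine series converges absolutely.\<close>
definition log_mean :: "real \<Rightarrow> real \<Rightarrow> real \<Rightarrow> real" where
  "log_mean r x y = ln (norm (1 - rcis r (x + y))) + ln (norm (1 - rcis r (x - y)))"

lemma Ln_one_minus_series: "real_series (\<lambda>k. - 1 / real k) (\<lambda>w. Ln (1 - w))"
  unfolding real_series_def
proof (intro allI impI)
  fix w :: complex assume "norm w < 1"
  then have "(\<lambda>n. (-1) ^ Suc n / of_nat n * (- w) ^ n) sums Ln (1 + (- w))"
    by (intro Ln_series) simp
  moreover have "(\<lambda>n. (-1) ^ Suc n / of_nat n * (- w) ^ n) = (\<lambda>n. of_real (- 1 / real n) * w ^ n)"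
  proof (rule ext)
    fix n
    have "(-1) ^ n * (- w) ^ n = w ^ n" by (simp flip: power_mult_distrib)
    then show "(-1) ^ Suc n / of_nat n * (- w) ^ n = of_real (- 1 / real n) * w ^ n" by (simp add: divide_simps mult_ac)
  qed
  ultimately show "(\<lambda>k. of_real (- 1 / real k) * w ^ k) sums Ln (1 - w)"
    by (simp only: diff_conv_add_uminus[of 1 w])
qed

lemma one_minus_rcis_neq_0: "0 \<le> r \<Longrightarrow> r < 1 \<Longrightarrow> 1 - rcis r x \<noteq> 0"
  by (metis abs_of_nonneg eq_iff_diff_eq_0 less_irrefl norm_one complex_mod_rcis)

lemma ln_norm_series:
  assumes "0 \<le> r" "r < 1"
  shows "ln (norm (1 - rcis r x)) = (\<Sum>k. - 1 / real k * r ^ k * cos (real k * x))"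
    and "summable (\<lambda>k. - 1 / real k * r ^ k * cos (real k * x))"
proof -
  show "ln (norm (1 - rcis r x)) = (\<Sum>k. - 1 / real k * r ^ k * cos (real k * x))"
    using real_series_polar(1)[OF Ln_one_minus_series assms, of x] one_minus_rcis_neq_0[OF assms, of x] by simp
  show "summable (\<lambda>k. - 1 / real k * r ^ k * cos (real k * x))"
  proof (rule summable_comparison_test'[OF real_series_summable[OF Ln_one_minus_series assms], of 0])
    fix k
    have "\<bar>- 1 / real k * r ^ k\<bar> * \<bar>cos (real k * x)\<bar> \<le> \<bar>- 1 / real k * r ^ k\<bar> * 1"
      by (intro mult_left_mono) auto
    then show "norm (- 1 / real k * r ^ k * cos (real k * x)) \<le> \<bar>- 1 / real k * r ^ k\<bar>"
      by (simp only: real_norm_def abs_mult mult_1_right)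
  qed
qed

lemma log_mean_integral:
  assumes r: "0 \<le> r" "r < 1"
  shows "(LINT x|angles. log_mean r x y * cos (real n * x)) = - (pi / real n) * r ^ n * cos (real n * y)"
proof -
  let ?d = "\<lambda>k. - 2 / real k * r ^ k * cos (real k * y)"
  have "log_mean r x y = (\<Sum>k. - 1 / real k * r ^ k * cos (real k * (x + y)) + - 1 / real k * r ^ k * cos (real k * (x - y)))" for x
    unfolding log_mean_def ln_norm_series(1)[OF r] by (intro suminf_add ln_norm_series r)
  moreover have "- 1 / real k * r ^ k * cos (real k * (x + y)) + - 1 / real k * r ^ k * cos (real k * (x - y)) = ?d k * cos (real k * x)" for k x
    by (simp add: cos_add cos_diff distrib_left right_diff_distrib)
  ultimately have eq: "log_mean r x y = (\<Sum>k. ?d k * cos (real k * x))" for x by (simp only:)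
  have "summable (\<lambda>k. \<bar>?d k\<bar>)"
  proof (rule summable_comparison_test'[OF summable_mult[OF real_series_summable[OF Ln_one_minus_series r], of 2], of 0])
    fix k
    have "\<bar>- 2 / real k * r ^ k\<bar> * \<bar>cos (real k * y)\<bar> \<le> \<bar>- 2 / real k * r ^ k\<bar> * 1"
      by (intro mult_left_mono) auto
    then show "norm \<bar>?d k\<bar> \<le> 2 * \<bar>- 1 / real k * r ^ k\<bar>"
      by (simp add: abs_mult)
  qed
  from integral_cos_series[OF this, of n] show ?thesis
    unfolding eq by (cases "n = 0") auto
qed

lemma norm_one_minus_cis_product:
  "norm (1 - cis (x + y)) * norm (1 - cis (x - y)) = 2 * \<bar>cos x - cos y\<bar>"
proof -
  have n: "(norm (1 - cis a))\<^sup>2 = 2 - 2 * cos a" for a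
  proof -
    have "(norm (1 - cis a))\<^sup>2 = (1 - cos a)\<^sup>2 + (sin a)\<^sup>2" unfolding cmod_power2 by simp
    then show ?thesis using sin_cos_squared_add[of a] by (simp add: power2_diff)
  qed
  have "cos (x + y) * cos (x - y) = (cos x)\<^sup>2 + (cos y)\<^sup>2 - 1"
  proof -
    have "cos (x + y) * cos (x - y) = (cos x * cos y)\<^sup>2 - (sin x * sin y)\<^sup>2"
      by (simp add: cos_add cos_diff power2_eq_square algebra_simps)
    also have "\<dots> = (cos x)\<^sup>2 * (cos y)\<^sup>2 - (1 - (cos x)\<^sup>2) * (1 - (cos y)\<^sup>2)"
      by (simp add: power_mult_distrib sin_squared_eq)
    finally show ?thesis by (simp add: algebra_simps)
  qed
  moreover have "cos (x + y) + cos (x - y) = 2 * cos x * cos y" by (simp add: cos_add cos_diff)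
  moreover have "(norm (1 - cis (x + y)) * norm (1 - cis (x - y)))\<^sup>2 =
      4 - 4 * (cos (x + y) + cos (x - y)) + 4 * (cos (x + y) * cos (x - y))"
    unfolding power_mult_distrib n by (simp add: algebra_simps)
  ultimately have "(norm (1 - cis (x + y)) * norm (1 - cis (x - y)))\<^sup>2 = (2 * \<bar>cos x - cos y\<bar>)\<^sup>2"
    by (simp add: power2_eq_square algebra_simps)
  then show ?thesis by (rule power2_eq_imp_eq) auto
qed

lemma norm_one_minus_rcis_ge:
  assumes "0 \<le> r" "r \<le> 1"
  shows "norm (1 - cis a) \<le> 2 * norm (1 - rcis r a)"
proof -
  have "norm (1 - cis a) \<le> norm (1 - rcis r a) + norm (rcis r a - cis a)"
    by (metis diff_add_cancel norm_triangle_ineq add_diff_eq)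
  also have "rcis r a - cis a = of_real (r - 1) * cis a" by (simp add: rcis_def left_diff_distrib)
  also have "norm (of_real (r - 1) * cis a) = 1 - r" using assms by (simp add: norm_mult del: of_real_diff)
  also have "1 - r \<le> norm (1 - rcis r a)"
    using norm_triangle_ineq2[of 1 "rcis r a"] assms by simp
  finally show ?thesis by simp
qed

lemma ln_4: "ln (4::real) = 2 * ln 2"
  using ln_realpow[of "2::real" 2] by simp

text \<open>These bounds are uniform in \<open>r\<close> and provide the integrable majorant for \<open>r \<rightarrow> 1\<close>.\<close>
lemma log_mean_bounds:
  assumes r: "0 \<le> r" "r < 1"
  shows "log_mean r x y \<le> 2 * ln 2"
    and "cos x \<noteq> cos y \<Longrightarrow> log_kernel x y - 2 * ln 2 \<le> log_mean r x y"
proof -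
  have pos: "0 < norm (1 - rcis r a)" for a using one_minus_rcis_neq_0[OF r] by simp
  have "norm (1 - rcis r a) \<le> 2" for a
    using norm_triangle_ineq4[of 1 "rcis r a"] r by simp
  then have "ln (norm (1 - rcis r a)) \<le> ln 2" for a using pos by (simp add: ln_le_cancel_iff)
  from add_mono[OF this this] show "log_mean r x y \<le> 2 * ln 2" by (simp add: log_mean_def)
  assume "cos x \<noteq> cos y"
  then have p: "0 < 2 * \<bar>cos x - cos y\<bar>" by simp
  have "2 * \<bar>cos x - cos y\<bar> \<le> (2 * norm (1 - rcis r (x + y))) * (2 * norm (1 - rcis r (x - y)))"
    unfolding norm_one_minus_cis_product[symmetric] using r
    by (intro mult_mono norm_one_minus_rcis_ge) auto
  then have "log_kernel x y \<le> ln ((2 * norm (1 - rcis r (x + y))) * (2 * norm (1 - rcis r (x - y))))"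
    unfolding log_kernel_def using p pos by (subst ln_le_cancel_iff) auto
  also have "\<dots> = 2 * ln 2 + log_mean r x y"
    using pos one_minus_rcis_neq_0[OF r] by (simp add: log_mean_def ln_mult ln_4)
  finally show "log_kernel x y - 2 * ln 2 \<le> log_mean r x y" by simp
qed

lemma log_mean_tendsto:
  assumes "cos x \<noteq> cos y" and \<rho>: "\<And>j. 0 \<le> \<rho> j" "\<And>j. \<rho> j < (1::real)" "\<rho> \<longlonglongrightarrow> 1"
  shows "(\<lambda>j. log_mean (\<rho> j) x y) \<longlonglongrightarrow> log_kernel x y"
proof -
  have p: "norm (1 - cis (x + y)) * norm (1 - cis (x - y)) \<noteq> 0"
    using assms(1) by (simp only: norm_one_minus_cis_product) simp
  have l: "(\<lambda>j. norm (1 - rcis (\<rho> j) a)) \<longlonglongrightarrow> norm (1 - rcis 1 a)" for a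
    unfolding rcis_def by (intro tendsto_intros \<rho>)
  have "(\<lambda>j. log_mean (\<rho> j) x y) \<longlonglongrightarrow> ln (norm (1 - rcis 1 (x + y))) + ln (norm (1 - rcis 1 (x - y)))"
    unfolding log_mean_def using p by (intro tendsto_add tendsto_ln l) (auto simp: rcis_def)
  moreover have "ln (norm (1 - rcis 1 (x + y))) + ln (norm (1 - rcis 1 (x - y))) = log_kernel x y"
    using p by (simp add: log_kernel_def rcis_def ln_mult flip: norm_one_minus_cis_product)
  ultimately show ?thesis by simp
qed

lemma AE_angles_neq: "AE x in angles. x \<noteq> y"
proof -
  have "{y} \<in> null_sets lebesgue" by (simp flip: negligible_iff_null_sets)
  then have "AE x in lebesgue. x \<noteq> y" using AE_not_in[of "{y}"] by simp
  then show ?thesis by (subst AE_restrict_space_iff) auto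
qed

lemma AE_cos_neq:
  assumes "0 \<le> y" "y \<le> pi"
  shows "AE x in angles. cos x \<noteq> cos y"
  using AE_angles_neq[of y] AE_space
  by eventually_elim (use assms cos_inj_pi in auto)

lemma log_mean_continuous:
  assumes "0 \<le> r" "r < 1"
  shows "continuous_on A (\<lambda>x. log_mean r x y)"
proof -
  have c: "continuous_on A (\<lambda>x. rcis r (f x))" if "continuous_on A f" for f
    unfolding rcis_def cis_conv_exp by (intro continuous_intros that)
  show ?thesis
    unfolding log_mean_def using one_minus_rcis_neq_0[OF assms]
    by (intro continuous_on_add continuous_on_ln continuous_on_norm continuous_on_diff continuous_on_const
        c continuous_on_id) auto
qed

lemma log_kernel_meas [measurable]: "(\<lambda>x. log_kernel x y) \<in> borel_measurable angles"
  unfolding log_kernel_def by measurable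

text \<open>Integrability itself comes from the lemma of Fatou: the nonnegative functions
  \<open>2 ln 2 - log_mean r x y\<close> all have the integral \<open>2 \<pi> ln 2\<close>.  With it the cosine coefficients follow by
  dominated convergence.  At \<open>n = 0\<close> the right-hand side is zero by the convention \<open>x / 0 = 0\<close>, which is
  the true value.\<close>
lemma log_kernel_integrable:
  assumes y: "0 \<le> y" "y \<le> pi"
  shows "integrable angles (\<lambda>x. log_kernel x y)"
    and "(LINT x|angles. \<bar>log_kernel x y\<bar>) \<le> 4 * pi * ln 2"
    and "(LINT x|angles. log_kernel x y * cos (real n * x)) = - (pi / real n) * cos (real n * y)"
proof -
  define \<rho> where "\<rho> = radius"
  note \<rho> = radius_bounds[folded \<rho>_def] and \<rho>1 = radius_tendsto[folded \<rho>_def]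
  note AEn = AE_cos_neq[OF y]
  have i: "integrable angles (\<lambda>x. log_mean (\<rho> j) x y)" for j
    by (rule integrable_angles_continuous[OF log_mean_continuous[OF \<rho>]])
  let ?f = "\<lambda>x. 2 * ln 2 - log_kernel x y"
  have le2: "log_kernel x y \<le> 2 * ln 2" for x
  proof (cases "cos x = cos y")
    case False
    have "2 * \<bar>cos x - cos y\<bar> \<le> 4"
      using order_trans[OF abs_triangle_ineq4 add_mono[OF abs_cos_le_one abs_cos_le_one], of x y] by simp
    then have "log_kernel x y \<le> ln 4" unfolding log_kernel_def using False by (subst ln_le_cancel_iff) auto
    then show ?thesis by (simp add: ln_4)
  qed (simp add: log_kernel_def)
  have "(\<integral>\<^sup>+x. ennreal (?f x) \<partial>angles) = (\<integral>\<^sup>+x. liminf (\<lambda>j. ennreal (2 * ln 2 - log_mean (\<rho> j) x y)) \<partial>angles)"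
  proof (rule nn_integral_cong_AE)
    show "AE x in angles. ennreal (?f x) = liminf (\<lambda>j. ennreal (2 * ln 2 - log_mean (\<rho> j) x y))"
      using AEn
    proof eventually_elim
      case (elim x)
      have "(\<lambda>j. ennreal (2 * ln 2 - log_mean (\<rho> j) x y)) \<longlonglongrightarrow> ennreal (?f x)"
        by (intro tendsto_ennrealI tendsto_diff tendsto_const log_mean_tendsto elim \<rho> \<rho>1)
      then show ?case by (metis lim_imp_Liminf sequentially_bot)
    qed
  qed
  also have "\<dots> \<le> liminf (\<lambda>j. \<integral>\<^sup>+x. ennreal (2 * ln 2 - log_mean (\<rho> j) x y) \<partial>angles)"
    using i by (intro nn_integral_liminf) auto
  also have "\<dots> = liminf (\<lambda>j. ennreal (2 * pi * ln 2))"
  proof -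
    have "(\<integral>\<^sup>+x. ennreal (2 * ln 2 - log_mean (\<rho> j) x y) \<partial>angles) = ennreal (2 * pi * ln 2)" for j
    proof -
      have "(\<integral>\<^sup>+x. ennreal (2 * ln 2 - log_mean (\<rho> j) x y) \<partial>angles) = ennreal (LINT x|angles. 2 * ln 2 - log_mean (\<rho> j) x y)"
        using i log_mean_bounds(1)[OF \<rho>] by (intro nn_integral_eq_integral) auto
      also have "(LINT x|angles. 2 * ln 2 - log_mean (\<rho> j) x y) = 2 * pi * ln 2"
        using i log_mean_integral[OF \<rho>, of j y 0] by simp
      finally show ?thesis .
    qed
    then show ?thesis by simp
  qed
  finally have nn: "(\<integral>\<^sup>+x. ennreal (?f x) \<partial>angles) \<le> ennreal (2 * pi * ln 2)" by (simp add: Liminf_const)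
  have fi: "integrable angles ?f"
    by (rule integrableI_nonneg) (use nn le2 in \<open>auto elim: le_less_trans\<close>)
  from Bochner_Integration.integrable_diff[OF _ fi, of "\<lambda>_. 2 * ln 2"]
  show ki: "integrable angles (\<lambda>x. log_kernel x y)" by simp
  have "(\<integral>\<^sup>+x. ennreal (?f x) \<partial>angles) = ennreal (LINT x|angles. ?f x)"
    by (intro nn_integral_eq_integral fi) (use le2 in auto)
  with nn have fb: "(LINT x|angles. ?f x) \<le> 2 * pi * ln 2" by simp
  have "(LINT x|angles. \<bar>log_kernel x y\<bar>) \<le> (LINT x|angles. ?f x + 2 * ln 2)"
  proof (intro integral_mono integrable_abs ki Bochner_Integration.integrable_add fi)
    show "\<bar>log_kernel x y\<bar> \<le> ?f x + 2 * ln 2" for x using le2[of x] by (simp add: abs_le_iff)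
  qed auto
  also have "\<dots> = (LINT x|angles. ?f x) + 2 * pi * ln 2" by (subst Bochner_Integration.integral_add[OF fi]) auto
  finally show "(LINT x|angles. \<bar>log_kernel x y\<bar>) \<le> 4 * pi * ln 2" using fb by simp
  have cm [measurable]: "(\<lambda>x. cos (real n * x)) \<in> borel_measurable angles"
    by (intro measurable_angles_continuous continuous_intros)
  have "(\<lambda>j. LINT x|angles. log_mean (\<rho> j) x y * cos (real n * x)) \<longlonglongrightarrow> (LINT x|angles. log_kernel x y * cos (real n * x))"
  proof (rule integral_dominated_convergence[where w = "\<lambda>x. \<bar>log_kernel x y\<bar> + 2 * ln 2"])
    show "integrable angles (\<lambda>x. \<bar>log_kernel x y\<bar> + 2 * ln 2)"
      by (intro Bochner_Integration.integrable_add integrable_abs ki) auto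
    show "(\<lambda>x. log_kernel x y * cos (real n * x)) \<in> borel_measurable angles" by measurable
    show "(\<lambda>x. log_mean (\<rho> j) x y * cos (real n * x)) \<in> borel_measurable angles" for j
      using borel_measurable_integrable[OF i] by measurable
    show "AE x in angles. (\<lambda>j. log_mean (\<rho> j) x y * cos (real n * x)) \<longlonglongrightarrow> log_kernel x y * cos (real n * x)"
      using AEn by eventually_elim (intro tendsto_mult tendsto_const log_mean_tendsto \<rho> \<rho>1)
    show "AE x in angles. norm (log_mean (\<rho> j) x y * cos (real n * x)) \<le> \<bar>log_kernel x y\<bar> + 2 * ln 2" for j
      using AEn
    proof eventually_elim
      case (elim x)
      have "\<bar>log_mean (\<rho> j) x y\<bar> \<le> \<bar>log_kernel x y\<bar> + 2 * ln 2"
        using log_mean_bounds(1)[OF \<rho>, of j x y] log_mean_bounds(2)[OF \<rho> elim, of j] ln_gt_zero[of "2::real"] by linarith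
      then have "\<bar>log_mean (\<rho> j) x y\<bar> * \<bar>cos (real n * x)\<bar> \<le> (\<bar>log_kernel x y\<bar> + 2 * ln 2) * 1"
        by (intro mult_mono) auto
      then show ?case by (simp add: abs_mult)
    qed
  qed
  moreover have "(\<lambda>j. LINT x|angles. log_mean (\<rho> j) x y * cos (real n * x)) \<longlonglongrightarrow> - (pi / real n) * 1 ^ n * cos (real n * y)"
    unfolding log_mean_integral[OF \<rho>] by (intro tendsto_intros \<rho>1)
  ultimately show "(LINT x|angles. log_kernel x y * cos (real n * x)) = - (pi / real n) * cos (real n * y)"
    using LIMSEQ_unique by fastforce
qed

lemma log_kernel_meas_pair: "(\<lambda>(y, x). log_kernel x y) \<in> borel_measurable (angles \<Otimes>\<^sub>M angles)"
proof -
  have c: "cos \<in> borel_measurable angles"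
    by (intro measurable_angles_continuous continuous_intros)
  have [measurable]: "(\<lambda>z. cos (fst z)) \<in> borel_measurable (angles \<Otimes>\<^sub>M angles)" "(\<lambda>z. cos (snd z)) \<in> borel_measurable (angles \<Otimes>\<^sub>M angles)"
    by (rule measurable_compose[OF measurable_fst c] measurable_compose[OF measurable_snd c])+
  show ?thesis unfolding log_kernel_def case_prod_unfold by measurable
qed

section \<open>The weak equation on the half circle\<close>

definition log_potential :: "(real \<Rightarrow> real) \<Rightarrow> real \<Rightarrow> real" where
  "log_potential F y = (LINT x|angles. log_kernel x y * F x)"

lemma log_kernel_mult_integrable:
  assumes F: "F \<in> borel_measurable angles" "\<And>x. x \<in> {0<..<pi} \<Longrightarrow> \<bar>F x\<bar> \<le> C" and y: "0 \<le> y" "y \<le> pi"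
  shows "integrable angles (\<lambda>x. log_kernel x y * F x)"
  using F(2) by (intro integrable_mult_bounded[OF log_kernel_integrable(1)[OF y] F(1)] AE_I2) auto

lemma log_potential_bound:
  assumes F: "F \<in> borel_measurable angles" "\<And>x. x \<in> {0<..<pi} \<Longrightarrow> \<bar>F x\<bar> \<le> C" and y: "0 \<le> y" "y \<le> pi"
  shows "\<bar>log_potential F y\<bar> \<le> 4 * pi * ln 2 * C"
proof -
  have C: "0 \<le> C" using F(2)[of "pi / 2"] by auto
  have "\<bar>log_potential F y\<bar> \<le> (LINT x|angles. \<bar>log_kernel x y * F x\<bar>)"
    unfolding log_potential_def by (rule integral_abs_bound)
  also have "\<dots> \<le> (LINT x|angles. \<bar>log_kernel x y\<bar> * C)"
    by (rule integral_mono)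
       (use integrable_abs[OF log_kernel_mult_integrable[OF F y]] log_kernel_integrable(1)[OF y] F(2)
         in \<open>auto simp: abs_mult mult_left_mono\<close>)
  also have "\<dots> \<le> 4 * pi * ln 2 * C"
    using mult_right_mono[OF log_kernel_integrable(2)[OF y] C] by simp
  finally show ?thesis .
qed

lemma log_potential_meas:
  assumes "F \<in> borel_measurable angles"
  shows "log_potential F \<in> borel_measurable angles"
proof -
  have [measurable]: "(\<lambda>z. F (snd z)) \<in> borel_measurable (angles \<Otimes>\<^sub>M angles)"
    by (rule measurable_compose[OF measurable_snd assms])
  have "(\<lambda>(y, x). log_kernel x y * F x) \<in> borel_measurable (angles \<Otimes>\<^sub>M angles)"
    using log_kernel_meas_pair unfolding case_prod_unfold by measurable
  then show ?thesis
    unfolding log_potential_def[abs_def] by measurable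
qed

lemma log_potential_integrable:
  assumes F: "F \<in> borel_measurable angles" "\<And>x. x \<in> {0<..<pi} \<Longrightarrow> \<bar>F x\<bar> \<le> C" and U: "integrable angles U"
  shows "integrable angles (\<lambda>y. U y * log_potential F y)"
  using log_potential_bound[OF F]
  by (intro integrable_mult_bounded[OF U log_potential_meas[OF F(1)], where C = "4 * pi * ln 2 * C"] AE_I2) auto

text \<open>The equation tested with a function \<open>\<Phi>\<close> on the half circle whose derivative is \<open>F\<close>; here \<open>W\<close> stands for
  \<open>b U\<close>.\<close>
definition weak_identity :: "(real \<Rightarrow> real) \<Rightarrow> (real \<Rightarrow> real) \<Rightarrow> (real \<Rightarrow> real) \<Rightarrow> (real \<Rightarrow> real) \<Rightarrow> bool" where
  "weak_identity U W F \<Phi> \<longleftrightarrow> 1 / pi * (LINT y|angles. U y * log_potential F y) = (LINT y|angles. W y * \<Phi> y)"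

text \<open>The potentials of uniformly bounded functions are uniformly bounded, because
  \<open>\<integral> \<bar>log_kernel x y\<bar> dx\<close> is bounded in \<open>y\<close>.  Hence dominated convergence applies to
  both sides under bounded pointwise convergence of \<open>F\<close> and \<open>\<Phi>\<close>.\<close>
lemma weak_identity_limit:
  assumes U: "integrable angles U" and W: "integrable angles W"
    and wp: "\<And>j. weak_identity U W (F j) (\<Phi> j)"
    and Fm: "\<And>j. F j \<in> borel_measurable angles" "\<And>j. \<Phi> j \<in> borel_measurable angles"
    and bd: "\<And>j x. x \<in> {0<..<pi} \<Longrightarrow> \<bar>F j x\<bar> \<le> C" "\<And>j x. x \<in> {0<..<pi} \<Longrightarrow> \<bar>\<Phi> j x\<bar> \<le> C"
    and lim: "\<And>x. x \<in> {0<..<pi} \<Longrightarrow> (\<lambda>j. F j x) \<longlonglongrightarrow> F' x" "\<And>x. x \<in> {0<..<pi} \<Longrightarrow> (\<lambda>j. \<Phi> j x) \<longlonglongrightarrow> \<Phi>' x"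
  shows "weak_identity U W F' \<Phi>'"
proof -
  have m: "F' \<in> borel_measurable angles" "\<Phi>' \<in> borel_measurable angles"
    by (rule borel_measurable_LIMSEQ_metric[OF Fm(1)], use lim in force)
       (rule borel_measurable_LIMSEQ_metric[OF Fm(2)], use lim in force)
  have C: "0 \<le> C" using bd(1)[of "pi / 2"] by force
  have pot: "(\<lambda>j. log_potential (F j) y) \<longlonglongrightarrow> log_potential F' y" if y: "0 \<le> y" "y \<le> pi" for y
    unfolding log_potential_def
  proof (rule integral_dominated_convergence[where w = "\<lambda>x. \<bar>log_kernel x y\<bar> * C"])
    show "integrable angles (\<lambda>x. \<bar>log_kernel x y\<bar> * C)"
      using log_kernel_integrable(1)[OF y] by simp
    show "AE x in angles. (\<lambda>j. log_kernel x y * F j x) \<longlonglongrightarrow> log_kernel x y * F' x"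
      by (rule AE_I2) (use lim in \<open>auto intro!: tendsto_intros\<close>)
    show "AE x in angles. norm (log_kernel x y * F j x) \<le> \<bar>log_kernel x y\<bar> * C" for j
      by (rule AE_I2) (use bd in \<open>auto simp: abs_mult intro!: mult_left_mono\<close>)
  qed (use m Fm in measurable)
  have "(\<lambda>j. LINT y|angles. U y * log_potential (F j) y) \<longlonglongrightarrow> (LINT y|angles. U y * log_potential F' y)"
  proof (rule integral_dominated_convergence[where w = "\<lambda>y. \<bar>U y\<bar> * (4 * pi * ln 2 * C)"])
    show "AE y in angles. (\<lambda>j. U y * log_potential (F j) y) \<longlonglongrightarrow> U y * log_potential F' y"
      by (rule AE_I2) (use pot in \<open>auto intro!: tendsto_intros\<close>)
    show "AE y in angles. norm (U y * log_potential (F j) y) \<le> \<bar>U y\<bar> * (4 * pi * ln 2 * C)" for j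
    proof (rule AE_I2)
      fix y assume "y \<in> space angles"
      then have "\<bar>log_potential (F j) y\<bar> \<le> 4 * pi * ln 2 * C"
        using log_potential_bound[OF Fm(1) bd(1), of y j] by auto
      then show "norm (U y * log_potential (F j) y) \<le> \<bar>U y\<bar> * (4 * pi * ln 2 * C)"
        using mult_left_mono[of _ _ "\<bar>U y\<bar>"] by (simp only: real_norm_def abs_mult abs_ge_zero)
    qed
    show "integrable angles (\<lambda>y. \<bar>U y\<bar> * (4 * pi * ln 2 * C))"
      using U by (intro integrable_mult_left integrable_abs)
  qed (use U log_potential_meas[OF Fm(1)] log_potential_meas[OF m(1)] in measurable)
  then have "(\<lambda>j. 1 / pi * (LINT y|angles. U y * log_potential (F j) y)) \<longlonglongrightarrow> 1 / pi * (LINT y|angles. U y * log_potential F' y)"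
    by (intro tendsto_intros)
  moreover have "(\<lambda>j. LINT y|angles. W y * \<Phi> j y) \<longlonglongrightarrow> (LINT y|angles. W y * \<Phi>' y)"
  proof (rule integral_dominated_convergence[where w = "\<lambda>y. \<bar>W y\<bar> * C"])
    show "AE y in angles. (\<lambda>j. W y * \<Phi> j y) \<longlonglongrightarrow> W y * \<Phi>' y"
      by (rule AE_I2) (use lim in \<open>auto intro!: tendsto_intros\<close>)
    show "AE y in angles. norm (W y * \<Phi> j y) \<le> \<bar>W y\<bar> * C" for j
      by (rule AE_I2) (use bd in \<open>auto simp: abs_mult intro!: mult_left_mono\<close>)
    show "integrable angles (\<lambda>y. \<bar>W y\<bar> * C)"
      using W by (intro integrable_mult_left integrable_abs)
  qed (use W Fm(2) m(2) in measurable)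
  moreover have "(\<lambda>j. 1 / pi * (LINT y|angles. U y * log_potential (F j) y)) = (\<lambda>j. LINT y|angles. W y * \<Phi> j y)"
    using wp unfolding weak_identity_def by (rule ext)
  ultimately show ?thesis unfolding weak_identity_def by (simp only: LIMSEQ_unique)
qed

lemma log_potential_cos:
  assumes "0 \<le> y" "y \<le> pi"
  shows "log_potential (\<lambda>x. cos (real k * x)) y = - (pi / real k) * cos (real k * y)"
  unfolding log_potential_def by (rule log_kernel_integrable(3)[OF assms])

lemma weak_identity_sin_iff:
  assumes "0 < k"
  shows "weak_identity U W (\<lambda>x. real k * cos (real k * x)) (\<lambda>x. sin (real k * x)) \<longleftrightarrow>
    (LINT x|angles. W x * sin (real k * x)) = - (LINT x|angles. U x * cos (real k * x))"
proof -
  have "(LINT y|angles. U y * log_potential (\<lambda>x. real k * cos (real k * x)) y) = (LINT y|angles. - pi * (U y * cos (real k * y)))"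
  proof (rule Bochner_Integration.integral_cong[OF refl])
    fix y assume "y \<in> space angles"
    then have "log_potential (\<lambda>x. cos (real k * x)) y = - (pi / real k) * cos (real k * y)"
      by (intro log_potential_cos) auto
    moreover have "log_potential (\<lambda>x. real k * cos (real k * x)) y = real k * log_potential (\<lambda>x. cos (real k * x)) y"
      unfolding log_potential_def by (simp add: mult.left_commute)
    ultimately show "U y * log_potential (\<lambda>x. real k * cos (real k * x)) y = - pi * (U y * cos (real k * y))"
      using assms by simp
  qed
  then show ?thesis unfolding weak_identity_def by auto
qed

definition mean_free_primitive :: "(real \<Rightarrow> real) \<Rightarrow> real \<Rightarrow> real" where
  "mean_free_primitive F x = integral {0..x} F - x / pi * integral {0..pi} F"

lemma mean_free_primitive_bound:
  assumes F: "continuous_on {0..pi} F" "\<And>x. x \<in> {0..pi} \<Longrightarrow> \<bar>F x\<bar> \<le> C" and x: "x \<in> {0..pi}"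
  shows "\<bar>mean_free_primitive F x\<bar> \<le> 2 * pi * C"
proof -
  have C: "0 \<le> C" using F(2)[of 0] by auto
  have b: "\<bar>integral {0..y} F\<bar> \<le> C * y" if "y \<in> {0..pi}" for y
    using integral_bound[of 0 y F C] that F continuous_on_subset[OF F(1)] by auto
  have "\<bar>x / pi * integral {0..pi} F\<bar> \<le> 1 * (C * pi)"
    unfolding abs_mult using x b[of pi] by (intro mult_mono) auto
  moreover have "\<bar>integral {0..x} F\<bar> \<le> C * pi"
    using b[OF x] x C by (auto intro: order_trans mult_left_mono)
  ultimately show ?thesis
    using abs_triangle_ineq4[of "integral {0..x} F" "x / pi * integral {0..pi} F"]
    unfolding mean_free_primitive_def by (simp add: mult_ac)
qed

lemma mean_free_primitive_continuous:
  assumes "continuous_on {0..pi} F"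
  shows "continuous_on {0..pi} (mean_free_primitive F)"
  unfolding mean_free_primitive_def
  by (intro continuous_intros indefinite_integral_continuous_1 integrable_continuous_interval assms) simp

text \<open>By the moment conditions the identity holds for \<open>cos (k x)\<close> in place of \<open>F\<close>, including \<open>k = 0\<close>, where both
  sides vanish.  Both sides are linear in \<open>F\<close>, and polynomials in \<open>cos x\<close> are uniformly dense.\<close>
lemma weak_identity_continuous:
  assumes U: "integrable angles U" and W: "integrable angles W"
    and mom: "\<And>k. 0 < k \<Longrightarrow> (LINT x|angles. W x * sin (real k * x)) = - (LINT x|angles. U x * cos (real k * x))"
    and F: "continuous_on {0..pi} F"
  shows "weak_identity U W F (mean_free_primitive F)"
proof -
  define Q where "Q F \<longleftrightarrow> continuous_on {0..pi} F \<and> weak_identity U W F (mean_free_primitive F)" for F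
  note bdd = continuous_bounded_Icc[of 0 pi] and meas = measurable_angles_continuous
  have pi1: "integrable angles (\<lambda>x. log_kernel x y * F x)" if "continuous_on {0..pi} F" "y \<in> {0<..<pi}" for F y
    using bdd[OF that(1)] log_kernel_mult_integrable[OF meas[OF that(1)], of _ y] that(2) by fastforce
  have pi2: "integrable angles (\<lambda>y. U y * log_potential F y)" if "continuous_on {0..pi} F" for F
    using bdd[OF that(1)] log_potential_integrable[OF meas[OF that(1)] _ U] by fastforce
  note pi3 = integrable_mult_continuous[OF W]
  have add: "Q (\<lambda>x. f x + g x)" if "Q f" "Q g" for f g
  proof -
    have c: "continuous_on {0..pi} f" "continuous_on {0..pi} g" using that by (auto simp: Q_def)
    have "log_potential (\<lambda>x. f x + g x) y = log_potential f y + log_potential g y" if "y \<in> {0<..<pi}" for y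
      unfolding log_potential_def distrib_left by (intro Bochner_Integration.integral_add pi1 c that)
    then have "(LINT y|angles. U y * log_potential (\<lambda>x. f x + g x) y) = (LINT y|angles. U y * log_potential f y + U y * log_potential g y)"
      by (intro Bochner_Integration.integral_cong) (auto simp: distrib_left)
    also have "\<dots> = (LINT y|angles. U y * log_potential f y) + (LINT y|angles. U y * log_potential g y)"
      by (intro Bochner_Integration.integral_add pi2 c)
    finally have 1: "(LINT y|angles. U y * log_potential (\<lambda>x. f x + g x) y) = \<dots>" .
    have "mean_free_primitive (\<lambda>x. f x + g x) y = mean_free_primitive f y + mean_free_primitive g y" if "y \<in> {0<..<pi}" for y
    proof -
      have "integral {0..z} (\<lambda>x. f x + g x) = integral {0..z} f + integral {0..z} g" if "z \<le> pi" for z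
        using that by (intro Henstock_Kurzweil_Integration.integral_add integrable_continuous_interval continuous_on_subset[OF c(1)] continuous_on_subset[OF c(2)]) auto
      then show ?thesis using that by (simp add: mean_free_primitive_def algebra_simps add_divide_distrib)
    qed
    then have "(LINT y|angles. W y * mean_free_primitive (\<lambda>x. f x + g x) y) = (LINT y|angles. W y * mean_free_primitive f y + W y * mean_free_primitive g y)"
      by (intro Bochner_Integration.integral_cong) (auto simp: distrib_left)
    also have "\<dots> = (LINT y|angles. W y * mean_free_primitive f y) + (LINT y|angles. W y * mean_free_primitive g y)"
      by (intro Bochner_Integration.integral_add pi3 mean_free_primitive_continuous c)
    finally show ?thesis
      using that 1 c unfolding Q_def weak_identity_def by (auto simp: distrib_left intro!: continuous_intros)
  qed
  have scale: "Q (\<lambda>x. c * f x)" if "Q f" for f c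
  proof -
    have "log_potential (\<lambda>x. c * f x) y = c * log_potential f y" for y
      unfolding log_potential_def by (simp add: mult.left_commute)
    moreover have "mean_free_primitive (\<lambda>x. c * f x) y = c * mean_free_primitive f y" for y
      by (simp add: mean_free_primitive_def algebra_simps)
    ultimately show ?thesis
      using that unfolding Q_def weak_identity_def by (auto simp: mult.left_commute intro!: continuous_intros)
  qed
  have base: "Q (\<lambda>x. cos (real k * x))" for k
  proof (cases "k = 0")
    case True
    have "log_potential (\<lambda>x. cos (real 0 * x)) y = 0" if "y \<in> {0<..<pi}" for y
      using log_potential_cos[of y 0] that by simp
    then have "(LINT y|angles. U y * log_potential (\<lambda>x. cos (real 0 * x)) y) = (LINT y|angles. 0)"
      by (intro Bochner_Integration.integral_cong) auto
    moreover have "(LINT y|angles. W y * mean_free_primitive (\<lambda>x. cos (real 0 * x)) y) = (LINT y|angles. 0)"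
      by (intro Bochner_Integration.integral_cong) (auto simp: mean_free_primitive_def)
    ultimately show ?thesis unfolding Q_def weak_identity_def True by simp
  next
    case False
    have "Q (\<lambda>x. real k * cos (real k * x))"
    proof -
      have hi: "((\<lambda>x. real k * cos (real k * x)) has_integral (sin (real k * y) - sin (real k * 0))) {0..y}" if "0 \<le> y" for y
        by (rule fundamental_theorem_of_calculus)
           (use that in \<open>auto intro!: derivative_eq_intros simp flip: has_real_derivative_iff_has_vector_derivative\<close>)
      have I: "integral {0..y} (\<lambda>x. real k * cos (real k * x)) = sin (real k * y)" if "0 \<le> y" for y
        using integral_unique[OF hi[OF that]] by simp
      have "mean_free_primitive (\<lambda>x. real k * cos (real k * x)) y = sin (real k * y)" if "y \<in> {0<..<pi}" for y
      proof -
        have "0 \<le> y" using that by simp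
        then show ?thesis unfolding mean_free_primitive_def I[OF pi_ge_zero] by (simp only: I sin_npi mult_zero_right diff_0_right)
      qed
      then have "(LINT y|angles. W y * mean_free_primitive (\<lambda>x. real k * cos (real k * x)) y) = (LINT y|angles. W y * sin (real k * y))"
        by (intro Bochner_Integration.integral_cong) auto
      then show ?thesis
        using weak_identity_sin_iff[of k U W] mom[of k] False unfolding Q_def weak_identity_def
        by (auto intro!: continuous_intros)
    qed
    from scale[OF this, of "1 / real k"] show ?thesis using False by simp
  qed
  have poly: "Q (\<lambda>x. poly q (cos x))" for q
    by (rule cos_poly_induct[of Q, OF add scale base])
  have inv: "continuous_on {-1..1} (\<lambda>z. F (arccos z))"
    by (rule continuous_on_compose2[OF F continuous_on_arccos'[THEN continuous_on_subset]])
       (auto simp: arccos_lbound arccos_ubound)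
  have "\<exists>q. \<forall>z\<in>{-1..1}. \<bar>F (arccos z) - poly q z\<bar> < inverse (real (Suc j))" for j
    by (rule polynomial_uniform_approximation[OF _ inv]) auto
  then obtain q where q0: "\<And>j z. z \<in> {-1..1} \<Longrightarrow> \<bar>F (arccos z) - poly (q j) z\<bar> < inverse (real (Suc j))"
    by metis
  have q: "\<bar>F x - poly (q j) (cos x)\<bar> < inverse (real (Suc j))" if "x \<in> {0..pi}" for j x
    using q0[where z = "cos x" and j = j] that by (simp add: arccos_cos)
  obtain C where C: "\<forall>x\<in>{0..pi}. \<bar>F x\<bar> \<le> C" using bdd[OF F] by blast
  then have C0: "0 \<le> C" by (force dest: bspec[of _ _ 0])
  have bF: "\<bar>poly (q j) (cos x)\<bar> \<le> C + 1" if "x \<in> {0..pi}" for x j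
  proof -
    have "inverse (real (Suc j)) \<le> 1" by (simp add: field_simps)
    with q[OF that, of j] C that show ?thesis by fastforce
  qed
  have pc: "continuous_on {0..pi} (\<lambda>x. poly (q j) (cos x))" for j by (intro continuous_intros)
  have mdiff: "mean_free_primitive F x - mean_free_primitive (\<lambda>x. poly (q j) (cos x)) x =
      mean_free_primitive (\<lambda>x. F x - poly (q j) (cos x)) x" if "x \<in> {0..pi}" for x j
  proof -
    have I2: "integral {0..z} (\<lambda>x. F x - poly (q j) (cos x)) = integral {0..z} F - integral {0..z} (\<lambda>x. poly (q j) (cos x))"
      if "z \<le> pi" for z
      using that by (intro Henstock_Kurzweil_Integration.integral_diff integrable_continuous_interval
          continuous_on_subset[OF F] continuous_on_subset[OF pc]) auto
    show ?thesis using that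
      by (simp only: mean_free_primitive_def I2 order_refl atLeastAtMost_iff right_diff_distrib)
  qed
  show ?thesis
  proof (rule weak_identity_limit[OF U W])
    show "weak_identity U W (\<lambda>x. poly (q j) (cos x)) (mean_free_primitive (\<lambda>x. poly (q j) (cos x)))" for j
      using poly[of "q j"] by (simp add: Q_def)
    show "(\<lambda>x. poly (q j) (cos x)) \<in> borel_measurable angles" for j by (rule meas[OF pc])
    show "mean_free_primitive (\<lambda>x. poly (q j) (cos x)) \<in> borel_measurable angles" for j
      by (rule meas[OF mean_free_primitive_continuous[OF pc]])
    show "\<bar>poly (q j) (cos x)\<bar> \<le> 2 * pi * (C + 1)" if "x \<in> {0<..<pi}" for x j
    proof -
      have "1 * (C + 1) \<le> 2 * pi * (C + 1)" using C0 pi_gt3 by (intro mult_right_mono) auto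
      with bF[of x j] that show ?thesis by auto
    qed
    show "\<bar>mean_free_primitive (\<lambda>x. poly (q j) (cos x)) x\<bar> \<le> 2 * pi * (C + 1)" if "x \<in> {0<..<pi}" for x j
      using mean_free_primitive_bound[OF pc bF, of x j] that by auto
    show "(\<lambda>j. poly (q j) (cos x)) \<longlonglongrightarrow> F x" if "x \<in> {0<..<pi}" for x
    proof (rule LIM_zero_cancel, rule Lim_null_comparison[OF always_eventually LIMSEQ_inverse_real_of_nat], rule allI)
      show "norm (poly (q j) (cos x) - F x) \<le> inverse (real (Suc j))" for j
        using q[of x j] that by (simp add: abs_minus_commute)
    qed
    show "(\<lambda>j. mean_free_primitive (\<lambda>x. poly (q j) (cos x)) x) \<longlonglongrightarrow> mean_free_primitive F x" if "x \<in> {0<..<pi}" for x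
    proof (rule LIM_zero_cancel, rule Lim_null_comparison[OF always_eventually], rule allI)
      show "norm (mean_free_primitive (\<lambda>x. poly (q j) (cos x)) x - mean_free_primitive F x) \<le> 2 * pi * inverse (real (Suc j))" for j
      proof -
        have "\<bar>mean_free_primitive (\<lambda>x. F x - poly (q j) (cos x)) x\<bar> \<le> 2 * pi * inverse (real (Suc j))"
          using q[of _ j] that by (intro mean_free_primitive_bound continuous_intros F pc) (auto simp: less_imp_le)
        then show ?thesis using mdiff[of x j] that by (simp add: abs_minus_commute)
      qed
      show "(\<lambda>j. 2 * pi * inverse (real (Suc j))) \<longlonglongrightarrow> 0"
        using tendsto_mult[OF tendsto_const LIMSEQ_inverse_real_of_nat] by simp
    qed
  qed
qed

section \<open>Smooth functions of compact support\<close>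

text \<open>The class of functions \<open>poly q x * flat_power d a (1 - d - x\<^sup>2)\<close> is closed under differentiation, which makes
  smoothness a trivial induction.  The exponent \<open>a\<close> may become negative: the exponential factor keeps
  the function flat at \<open>0\<close>.\<close>
definition flat_power :: "real \<Rightarrow> real \<Rightarrow> real \<Rightarrow> real" where
  "flat_power d a s = (if 0 < s then s powr a * exp (- d / s) else 0)"

lemma flat_power_shift: "flat_power d a s = s\<^sup>2 * flat_power d (a - 2) s"
proof (cases "0 < s")
  case True
  have "s powr a = s\<^sup>2 * s powr (a - 2)"
    using True by (simp add: powr_diff powr_numeral)
  then show ?thesis using True by (simp add: flat_power_def)
qed (simp add: flat_power_def)

lemma flat_power_deriv:
  assumes d: "0 < d"
  shows "(flat_power d a has_real_derivative (a * s + d) * flat_power d (a - 2) s) (at s)"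
proof -
  consider "0 < s" | "s < 0" | "s = 0" by linarith
  then show ?thesis
  proof cases
    case 1
    have "((\<lambda>s. s powr a * exp (- d / s)) has_real_derivative (a * s + d) * flat_power d (a - 2) s) (at s)"
      using 1 by (auto intro!: derivative_eq_intros simp: flat_power_def powr_diff powr_numeral field_simps power2_eq_square)
    then show ?thesis
      by (rule has_field_derivative_transform_within_open[of _ _ _ "{0<..}"]) (use 1 in \<open>auto simp: flat_power_def\<close>)
  next
    case 2
    have "((\<lambda>_. 0) has_real_derivative (a * s + d) * flat_power d (a - 2) s) (at s)"
      using 2 by (simp add: flat_power_def)
    then show ?thesis
      by (rule has_field_derivative_transform_within_open[of _ _ _ "{..<0}"]) (use 2 in \<open>auto simp: flat_power_def\<close>)
  next
    case 3
    have "((\<lambda>s. s powr (a - 1) * exp (- d / s)) \<longlongrightarrow> 0) (at_right 0)"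
      using d by real_asymp
    moreover have "\<forall>\<^sub>F s in at_right 0. s powr (a - 1) * exp (- d / s) = flat_power d a s / s"
      using eventually_at_right_less[of 0] by eventually_elim (simp add: flat_power_def powr_diff)
    ultimately have "((\<lambda>s. flat_power d a s / s) \<longlongrightarrow> 0) (at_right 0)"
      by (rule Lim_transform_eventually)
    moreover have "((\<lambda>s. flat_power d a s / s) \<longlongrightarrow> 0) (at_left 0)"
    proof (rule tendsto_eventually)
      show "\<forall>\<^sub>F s in at_left 0. flat_power d a s / s = 0"
        by (subst eventually_at_left[of "-1"]) (auto simp: flat_power_def intro!: exI[of _ "-1"])
    qed
    ultimately have "((\<lambda>s. flat_power d a s / s) \<longlongrightarrow> 0) (at 0)"
      by (simp add: filterlim_split_at)
    then show ?thesis using 3 by (simp add: has_field_derivative_iff flat_power_def)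
  qed
qed

definition bump :: "real \<Rightarrow> real poly \<Rightarrow> real \<Rightarrow> real \<Rightarrow> real" where
  "bump d q a x = poly q x * flat_power d a (1 - d - x\<^sup>2)"

definition bump_deriv_poly :: "real \<Rightarrow> real poly \<Rightarrow> real \<Rightarrow> real poly" where
  "bump_deriv_poly d q a = pderiv q * [:1 - d, 0, -1:]\<^sup>2 + q * [:0, -2:] * (smult a [:1 - d, 0, -1:] + [:d:])"

lemma poly_bump_deriv_poly:
  "poly (bump_deriv_poly d q a) x =
    poly (pderiv q) x * (1 - d - x\<^sup>2)\<^sup>2 - 2 * x * poly q x * (a * (1 - d - x\<^sup>2) + d)"
proof -
  have "poly [:1 - d, 0, -1:] x = 1 - d - x\<^sup>2" by (simp add: power2_eq_square)
  then show ?thesis by (simp only: bump_deriv_poly_def poly_add poly_mult poly_power poly_smult) simp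
qed

lemma bump_deriv:
  assumes "0 < d"
  shows "(bump d q a has_real_derivative bump d (bump_deriv_poly d q a) (a - 2) x) (at x)"
proof -
  let ?s = "1 - d - x\<^sup>2"
  have "(bump d q a has_real_derivative
      poly (pderiv q) x * flat_power d a ?s + ((a * ?s + d) * flat_power d (a - 2) ?s * (- (2 * x))) * poly q x) (at x)"
    unfolding bump_def[abs_def]
    by (rule DERIV_mult poly_DERIV DERIV_chain2[OF flat_power_deriv[OF assms]])+
       (auto intro!: derivative_eq_intros)
  moreover have "poly (pderiv q) x * flat_power d a ?s + ((a * ?s + d) * flat_power d (a - 2) ?s * (- (2 * x))) * poly q x
      = bump d (bump_deriv_poly d q a) (a - 2) x"
    unfolding bump_def poly_bump_deriv_poly flat_power_shift[of d a] by (simp add: algebra_simps)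
  ultimately show ?thesis by simp
qed

lemma deriv_bump: "0 < d \<Longrightarrow> deriv (bump d q a) = bump d (bump_deriv_poly d q a) (a - 2)"
  using bump_deriv by (intro ext DERIV_imp_deriv)

lemma bump_test_function:
  assumes d: "0 < d" "d < 1"
  shows "bump d q a \<in> test_functions itv"
proof -
  have "\<exists>q' a'. (deriv ^^ k) (bump d q a) = bump d q' a'" for k
  proof (induction k)
    case (Suc k)
    then obtain q' a' where "(deriv ^^ k) (bump d q a) = bump d q' a'" by blast
    then have "(deriv ^^ Suc k) (bump d q a) = bump d (bump_deriv_poly d q' a') (a' - 2)"
      using deriv_bump[OF d(1)] by simp
    then show ?case by blast
  qed auto
  then have 1: "(deriv ^^ k) (bump d q a) field_differentiable (at x)" for k x
    using bump_deriv[OF d(1)] field_differentiable_def by metis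
  have "x \<in> {- sqrt (1 - d)..sqrt (1 - d)}" if "bump d q a x \<noteq> 0" for x
  proof -
    have "x\<^sup>2 < 1 - d" using that by (auto simp: bump_def flat_power_def split: if_splits)
    then have "\<bar>x\<bar> \<le> sqrt (1 - d)" by (simp add: real_le_rsqrt)
    then show ?thesis by auto
  qed
  then have sub: "closure {x. bump d q a x \<noteq> 0} \<subseteq> {- sqrt (1 - d)..sqrt (1 - d)}"
    by (intro closure_minimal) auto
  moreover have "{- sqrt (1 - d)..sqrt (1 - d)} \<subseteq> itv"
  proof
    fix x assume x: "x \<in> {- sqrt (1 - d)..sqrt (1 - d)}"
    have "sqrt (1 - d) < 1" using d by simp
    with x show "x \<in> itv" unfolding atLeastAtMost_iff greaterThanLessThan_iff by linarith
  qed
  ultimately have "closure {x. bump d q a x \<noteq> 0} \<subseteq> itv" by (rule subset_trans)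
  moreover have "compact (closure {x. bump d q a x \<noteq> 0})"
    using sub by (meson bounded_closed_interval bounded_subset closed_closure compact_eq_bounded_closed)
  ultimately show ?thesis using 1 by (simp add: test_functions_def)
qed

section \<open>The distributional equation on the half circle\<close>

lemma zero_ext_integral:
  "(LINT y|lebesgue. zero_ext g y * h y) = (LINT y|leb_itv. g y * h y)"
  by (subst integral_restrict_space) (auto simp: zero_ext_def indicator_def intro!: Bochner_Integration.integral_cong)

lemma integral_supported:
  fixes h :: "real \<Rightarrow> real"
  assumes "S \<in> sets lebesgue" "\<And>x. x \<notin> S \<Longrightarrow> h x = 0"
  shows "(LINT x|lebesgue_on S. h x) = (LINT x|lebesgue. h x)"
  by (subst integral_restrict_space) (use assms in \<open>auto simp: indicator_def intro!: Bochner_Integration.integral_cong\<close>)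

lemma ln_abs_integrable: "integrable (lebesgue_on {-2<..<2::real}) (\<lambda>x. ln \<bar>x\<bar>)"
proof -
  have "integrable angles (\<lambda>x. log_kernel x (pi / 2))" by (rule log_kernel_integrable(1)) auto
  then have "integrable angles (\<lambda>x. sin x * ln (2 * \<bar>cos x\<bar>))"
  proof (rule Bochner_Integration.integrable_bound)
    show "(\<lambda>x. sin x * ln (2 * \<bar>cos x\<bar>)) \<in> borel_measurable angles" by measurable
    show "AE x in angles. norm (sin x * ln (2 * \<bar>cos x\<bar>)) \<le> norm (log_kernel x (pi / 2))"
      by (rule AE_I2) (simp add: log_kernel_def abs_mult mult_left_le_one_le)
  qed
  then have "(\<lambda>x. ln (2 * \<bar>x\<bar>)) absolutely_integrable_on itv"
    using cos_substitution_integrable[of "\<lambda>x. ln (2 * \<bar>x\<bar>)"] by (simp add: integrable_lebesgue_on_iff)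
  then have a: "(\<lambda>x. \<bar>2\<bar> * ln \<bar>2 * x\<bar>) absolutely_integrable_on itv"
    by (simp add: abs_mult)
  have im: "(\<lambda>x. 2 * x) ` itv = {-2<..<2::real}"
    by (auto simp: image_iff intro!: bexI[of _ "_ / 2"])
  have "(\<lambda>x. ln \<bar>x\<bar>) absolutely_integrable_on (\<lambda>x. 2 * x) ` itv \<and>
      integral ((\<lambda>x. 2 * x) ` itv) (\<lambda>x. ln \<bar>x\<bar>) = integral itv (\<lambda>x. \<bar>2\<bar> * ln \<bar>2 * x\<bar>)"
    by (subst has_absolute_integral_change_of_variables_1'[symmetric, where g' = "\<lambda>_. 2"])
       (use a in \<open>auto intro!: derivative_eq_intros simp: inj_on_def\<close>)
  then show ?thesis by (simp add: im integrable_lebesgue_on_iff)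
qed

lemma
  assumes "\<phi> \<in> test_functions itv"
  shows test_function_deriv: "(\<phi> has_real_derivative deriv \<phi> x) (at x)"
    and test_function_deriv_continuous: "continuous_on A (deriv \<phi>)"
    and test_function_outside: "x \<notin> itv \<Longrightarrow> \<phi> x = 0"
    and test_function_deriv_outside: "x \<notin> itv \<Longrightarrow> deriv \<phi> x = 0"
    and test_function_deriv_bounded: "\<exists>B. \<forall>x. \<bar>deriv \<phi> x\<bar> \<le> B"
proof -
  have fd: "(deriv ^^ k) \<phi> field_differentiable (at x)" for k x
    using assms by (auto simp: test_functions_def)
  have K: "closure {x. \<phi> x \<noteq> 0} \<subseteq> itv"
    using assms by (auto simp: test_functions_def)
  show d: "(\<phi> has_real_derivative deriv \<phi> x) (at x)" for x
    using fd[of 0 x] by (simp add: field_differentiable_derivI)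
  have "deriv \<phi> field_differentiable (at x)" for x using fd[of 1 x] by simp
  then show c: "continuous_on A (deriv \<phi>)" for A
    by (intro continuous_at_imp_continuous_on ballI field_differentiable_imp_continuous_at)
  show z: "\<phi> x = 0" if "x \<notin> itv" for x
    using that K closure_subset[of "{x. \<phi> x \<noteq> 0}"] by auto
  show od: "deriv \<phi> x = 0" if "x \<notin> itv" for x
  proof (rule DERIV_imp_deriv)
    have "((\<lambda>_. 0) has_real_derivative 0) (at x)" by simp
    then show "(\<phi> has_real_derivative 0) (at x)"
    proof (rule has_field_derivative_transform_within_open[of _ _ _ "- closure {x. \<phi> x \<noteq> 0}"])
      show "x \<in> - closure {x. \<phi> x \<noteq> 0}" using that K by auto
      show "0 = \<phi> y" if "y \<in> - closure {x. \<phi> x \<noteq> 0}" for y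
        using that closure_subset[of "{x. \<phi> x \<noteq> 0}"] by auto
    qed auto
  qed
  obtain B where B: "\<And>x. x \<in> {-1..1} \<Longrightarrow> \<bar>deriv \<phi> x\<bar> \<le> B" using continuous_bounded_Icc[OF c] by blast
  have "\<bar>deriv \<phi> x\<bar> \<le> B" for x
  proof (cases "x \<in> itv")
    case False
    then show ?thesis using od[OF False] B[of 0] by auto
  qed (use B in auto)
  then show "\<exists>B. \<forall>x. \<bar>deriv \<phi> x\<bar> \<le> B" by blast
qed

lemma deriv_convolution:
  assumes t: "integrable leb_itv t" and \<phi>: "\<phi> \<in> test_functions itv"
  shows "deriv (\<lambda>x. LINT y|leb_itv. t y * \<phi> (x + y)) x = (LINT y|leb_itv. t y * deriv \<phi> (x + y))"
proof (rule DERIV_imp_deriv)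
  interpret finite_measure leb_itv by (rule finite_measure_lebesgue_on) simp
  obtain B where B: "\<And>x. \<bar>deriv \<phi> x\<bar> \<le> B" using test_function_deriv_bounded[OF \<phi>] by blast
  have B0: "0 \<le> B" using B[of 0] by linarith
  note td = test_function_deriv[OF \<phi>]
  have lip: "\<bar>\<phi> x - \<phi> y\<bar> \<le> B * \<bar>x - y\<bar>" for x y
    using field_differentiable_bound[of UNIV \<phi> "deriv \<phi>" B x y] td B by simp
  have id [measurable]: "(\<lambda>x. x) \<in> borel_measurable leb_itv"
    by (intro continuous_imp_measurable_on_sets_lebesgue continuous_intros) auto
  have "continuous_on UNIV \<phi>" using td by (meson DERIV_continuous_on)
  then have \<phi>m: "\<phi> \<in> borel_measurable borel" by (rule borel_measurable_continuous_onI)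
  have Dm: "deriv \<phi> \<in> borel_measurable borel"
    by (rule borel_measurable_continuous_onI[OF test_function_deriv_continuous[OF \<phi>]])
  note [measurable] = \<phi>m Dm borel_measurable_integrable[OF t]
  have mm: "(\<lambda>y. \<phi> (z + y)) \<in> borel_measurable leb_itv" "(\<lambda>y. deriv \<phi> (z + y)) \<in> borel_measurable leb_itv" for z
    by measurable
  have \<phi>B: "\<bar>\<phi> z\<bar> \<le> 2 * B" for z
  proof (cases "z \<in> itv")
    case True
    then have "B * \<bar>z - 1\<bar> \<le> B * 2" using B0 by (intro mult_left_mono) auto
    then show ?thesis using lip[of z 1] test_function_outside[OF \<phi>, of 1] by simp
  qed (use B0 test_function_outside[OF \<phi>] in auto)
  have i\<phi>: "integrable leb_itv (\<lambda>y. t y * \<phi> (z + y))" for z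
    using \<phi>B by (intro integrable_mult_bounded[OF t mm(1), where C = "2 * B"]) simp
  have "((\<lambda>h. ((LINT y|leb_itv. t y * \<phi> (x + h + y)) - (LINT y|leb_itv. t y * \<phi> (x + y))) / h) \<longlongrightarrow>
     (LINT y|leb_itv. t y * deriv \<phi> (x + y))) (at 0)"
    unfolding tendsto_at_iff_sequentially o_def
  proof (intro allI impI)
    fix S :: "nat \<Rightarrow> real" assume S: "\<forall>i. S i \<in> UNIV - {0}" "S \<longlonglongrightarrow> 0"
    have "(\<lambda>n. LINT y|leb_itv. t y * ((\<phi> (x + S n + y) - \<phi> (x + y)) / S n)) \<longlonglongrightarrow> (LINT y|leb_itv. t y * deriv \<phi> (x + y))"
    proof (rule integral_dominated_convergence[where w = "\<lambda>y. \<bar>t y\<bar> * B"])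
      show "integrable leb_itv (\<lambda>y. \<bar>t y\<bar> * B)" using t by simp
      show "(\<lambda>y. t y * deriv \<phi> (x + y)) \<in> borel_measurable leb_itv" using mm by measurable
      show "(\<lambda>y. t y * ((\<phi> (x + S n + y) - \<phi> (x + y)) / S n)) \<in> borel_measurable leb_itv" for n
        using mm(1)[of x] mm(1)[of "x + S n"] by measurable
      show "AE y in leb_itv. (\<lambda>n. t y * ((\<phi> (x + S n + y) - \<phi> (x + y)) / S n)) \<longlonglongrightarrow> t y * deriv \<phi> (x + y)"
      proof (rule AE_I2, rule tendsto_mult[OF tendsto_const])
        fix y
        have "((\<lambda>h. (\<phi> (x + y + h) - \<phi> (x + y)) / h) \<longlongrightarrow> deriv \<phi> (x + y)) (at 0)"
          using td[of "x + y"] by (simp add: DERIV_def)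
        then have "((\<lambda>h. (\<phi> (x + y + h) - \<phi> (x + y)) / h) \<circ> S) \<longlonglongrightarrow> deriv \<phi> (x + y)"
          using S unfolding tendsto_at_iff_sequentially by blast
        then show "(\<lambda>n. (\<phi> (x + S n + y) - \<phi> (x + y)) / S n) \<longlonglongrightarrow> deriv \<phi> (x + y)"
          by (simp add: o_def add_ac)
      qed
      show "AE y in leb_itv. norm (t y * ((\<phi> (x + S n + y) - \<phi> (x + y)) / S n)) \<le> \<bar>t y\<bar> * B" for n
      proof (rule AE_I2)
        fix y
        have "\<bar>(\<phi> (x + S n + y) - \<phi> (x + y)) / S n\<bar> \<le> B"
          using lip[of "x + S n + y" "x + y"] S(1) by (simp add: abs_divide pos_divide_le_eq)
        then show "norm (t y * ((\<phi> (x + S n + y) - \<phi> (x + y)) / S n)) \<le> \<bar>t y\<bar> * B"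
          using mult_left_mono[of _ B "\<bar>t y\<bar>"] by (simp only: real_norm_def abs_mult abs_ge_zero)
      qed
    qed
    moreover have "(LINT y|leb_itv. t y * ((\<phi> (x + S n + y) - \<phi> (x + y)) / S n)) =
        ((LINT y|leb_itv. t y * \<phi> (x + S n + y)) - (LINT y|leb_itv. t y * \<phi> (x + y))) / S n" for n
      by (subst Bochner_Integration.integral_diff[OF i\<phi> i\<phi>, symmetric])
         (simp add: right_diff_distrib diff_divide_distrib flip: integral_divide_zero)
    ultimately show "(\<lambda>n. ((LINT y|leb_itv. t y * \<phi> (x + S n + y)) - (LINT y|leb_itv. t y * \<phi> (x + y))) / S n) \<longlonglongrightarrow>
        (LINT y|leb_itv. t y * deriv \<phi> (x + y))" by (simp only:)
  qed
  then show "((\<lambda>x. LINT y|leb_itv. t y * \<phi> (x + y)) has_real_derivative (LINT y|leb_itv. t y * deriv \<phi> (x + y))) (at x)"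
    by (simp add: DERIV_def)
qed

text \<open>Unfold the derivative of \<open>ln \<bar>x\<bar>\<close>, differentiate under the integral and exchange the order of
  integration.  The support of \<open>\<phi>\<close> restricts the first variable to \<open>(-2, 2)\<close>.\<close>
lemma distr_conv_pv:
  assumes t: "integrable leb_itv t" and \<phi>: "\<phi> \<in> test_functions itv"
  shows "distr_conv pv_inverse (zero_ext t) \<phi> =
    - (LINT y|leb_itv. t y * (LINT z|leb_itv. ln \<bar>z - y\<bar> * deriv \<phi> z))"
proof -
  let ?S = "{-2<..<2::real}"
  let ?M = "lebesgue_on ?S"
  let ?D = "deriv \<phi>"
  interpret I: finite_measure leb_itv by (rule finite_measure_lebesgue_on) simp
  interpret S: finite_measure ?M by (rule finite_measure_lebesgue_on) simp
  interpret pair_sigma_finite ?M leb_itv ..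
  obtain B where B: "\<And>x. \<bar>?D x\<bar> \<le> B" using test_function_deriv_bounded[OF \<phi>] by blast
  note D0 = test_function_deriv_outside[OF \<phi>]
  have idI [measurable]: "(\<lambda>x. x) \<in> borel_measurable leb_itv" and idS [measurable]: "(\<lambda>x. x) \<in> borel_measurable ?M"
    by (intro continuous_imp_measurable_on_sets_lebesgue continuous_intros; simp)+
  have Dm [measurable]: "?D \<in> borel_measurable borel"
    by (rule borel_measurable_continuous_onI[OF test_function_deriv_continuous[OF \<phi>]])
  have Dsm: "(\<lambda>x. ?D (x + y)) \<in> borel_measurable borel" for y
    by (intro borel_measurable_continuous_onI continuous_on_compose2[OF test_function_deriv_continuous[OF \<phi>, of UNIV]]
        continuous_intros) auto
  have tm: "t \<in> borel_measurable leb_itv" using t by simp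
  have meas: "(\<lambda>(x, y). ln \<bar>x\<bar> * (t y * ?D (x + y))) \<in> borel_measurable (?M \<Otimes>\<^sub>M leb_itv)"
  proof -
    have [measurable]: "(\<lambda>z. fst z) \<in> borel_measurable (?M \<Otimes>\<^sub>M leb_itv)" "(\<lambda>z. snd z) \<in> borel_measurable (?M \<Otimes>\<^sub>M leb_itv)"
      "(\<lambda>z. t (snd z)) \<in> borel_measurable (?M \<Otimes>\<^sub>M leb_itv)"
      using measurable_compose[OF measurable_fst idS, of leb_itv] measurable_compose[OF measurable_snd idI, of ?M]
        measurable_compose[OF measurable_snd tm, of ?M] by auto
    show ?thesis unfolding case_prod_unfold by measurable
  qed
  have inner: "integrable leb_itv (\<lambda>y. t y * ?D (x + y))" for x
  proof (rule integrable_mult_bounded[OF t])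
    show "(\<lambda>y. ?D (x + y)) \<in> borel_measurable leb_itv" by measurable
    show "AE y in leb_itv. \<bar>?D (x + y)\<bar> \<le> B" using B by simp
  qed
  have prod: "integrable (?M \<Otimes>\<^sub>M leb_itv) (\<lambda>(x, y). ln \<bar>x\<bar> * (t y * ?D (x + y)))"
  proof (rule Fubini_integrable[OF meas])
    show "AE x in ?M. integrable leb_itv (\<lambda>y. case (x, y) of (x, y) \<Rightarrow> ln \<bar>x\<bar> * (t y * ?D (x + y)))"
      using inner by simp
    show "integrable ?M (\<lambda>x. LINT y|leb_itv. norm (case (x, y) of (x, y) \<Rightarrow> ln \<bar>x\<bar> * (t y * ?D (x + y))))"
    proof (rule Bochner_Integration.integrable_bound[OF integrable_mult_left[OF ln_abs_integrable, of "LINT y|leb_itv. \<bar>t y\<bar> * B"]])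
      show "(\<lambda>x. LINT y|leb_itv. norm (case (x, y) of (x, y) \<Rightarrow> ln \<bar>x\<bar> * (t y * ?D (x + y)))) \<in> borel_measurable ?M"
        using meas by measurable
      have "(LINT y|leb_itv. \<bar>t y * ?D (x + y)\<bar>) \<le> (LINT y|leb_itv. \<bar>t y\<bar> * B)" for x
        using B by (intro integral_mono integrable_abs inner integrable_mult_left t) (simp add: abs_mult mult_left_mono)
      then have "\<bar>ln \<bar>x\<bar>\<bar> * (LINT y|leb_itv. \<bar>t y * ?D (x + y)\<bar>) \<le> \<bar>ln \<bar>x\<bar>\<bar> * \<bar>LINT y|leb_itv. \<bar>t y\<bar> * B\<bar>" for x
        by (rule mult_left_mono[OF order_trans[OF _ abs_ge_self] abs_ge_zero])
      then show "AE x in ?M. norm (LINT y|leb_itv. norm (case (x, y) of (x, y) \<Rightarrow> ln \<bar>x\<bar> * (t y * ?D (x + y)))) \<le>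
         norm (ln \<bar>x\<bar> * (LINT y|leb_itv. \<bar>t y\<bar> * B))"
        by (intro AE_I2) (simp add: abs_mult)
    qed
  qed
  let ?c = "\<lambda>x. LINT y|leb_itv. t y * ?D (x + y)"
  have "distr_conv pv_inverse (zero_ext t) \<phi> = - (LINT x|lebesgue. ln \<bar>x\<bar> * ?c x)"
    by (simp add: distr_conv_def pv_inverse_def distr_deriv_def distr_of_def zero_ext_integral
        deriv_convolution[OF t \<phi>, THEN ext[where f = "deriv _"]] del: atLeastAtMost_iff)
  also have "(LINT x|lebesgue. ln \<bar>x\<bar> * ?c x) = (LINT x|?M. ln \<bar>x\<bar> * ?c x)"
  proof (rule integral_supported[symmetric])
    fix x :: real assume "x \<notin> ?S"
    then have "?D (x + y) = 0" if "y \<in> itv" for y using that by (intro D0) auto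
    then have "?c x = (LINT y|leb_itv. 0)" by (intro Bochner_Integration.integral_cong) auto
    then show "ln \<bar>x\<bar> * ?c x = 0" by simp
  qed simp
  also have "\<dots> = (LINT x|?M. LINT y|leb_itv. ln \<bar>x\<bar> * (t y * ?D (x + y)))" by simp
  also have "\<dots> = (LINT y|leb_itv. LINT x|?M. ln \<bar>x\<bar> * (t y * ?D (x + y)))"
    using Fubini_integral[OF prod] by simp
  also have "\<dots> = (LINT y|leb_itv. t y * (LINT z|leb_itv. ln \<bar>z - y\<bar> * ?D z))"
  proof (rule Bochner_Integration.integral_cong[OF refl])
    fix y assume "y \<in> space leb_itv"
    then have y: "y \<in> itv" by simp
    have "(LINT x|?M. ln \<bar>x\<bar> * ?D (x + y)) = (LINT x|lebesgue. ln \<bar>x\<bar> * ?D (x + y))"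
    proof (rule integral_supported)
      fix x :: real assume "x \<notin> ?S"
      then have "?D (x + y) = 0" using y by (intro D0) auto
      then show "ln \<bar>x\<bar> * ?D (x + y) = 0" by simp
    qed simp
    also have "\<dots> = (LINT x|lborel. ln \<bar>x\<bar> * ?D (x + y))"
      by (rule integral_completion) (use Dsm[of y] in simp)
    also have "\<dots> = (LINT z|lborel. ln \<bar>z - y\<bar> * ?D z)"
      by (subst lborel_integral_real_affine[of 1 _ "- y"]) (simp_all add: algebra_simps)
    also have "\<dots> = (LINT z|lebesgue. ln \<bar>z - y\<bar> * ?D z)"
      by (rule integral_completion[symmetric]) (use Dm in simp)
    also have "\<dots> = (LINT z|leb_itv. ln \<bar>z - y\<bar> * ?D z)"
      by (rule integral_supported[symmetric]) (use D0 in auto)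
    finally show "(LINT x|?M. ln \<bar>x\<bar> * (t y * ?D (x + y))) = t y * (LINT z|leb_itv. ln \<bar>z - y\<bar> * ?D z)"
      by (simp add: mult.left_commute)
  qed
  finally show ?thesis .
qed

text \<open>The substitution \<open>x = cos \<theta>\<close> in all integrals.  Replacing \<open>ln \<bar>cos x - cos y\<bar>\<close> by \<open>log_kernel\<close> changes the
  potential by a multiple of the integral of the derivative of \<open>\<phi> (cos x)\<close>, which is zero.\<close>
lemma weak_equation_iff:
  assumes t: "integrable leb_itv t" and \<phi>: "\<phi> \<in> test_functions itv"
    and U: "U = (\<lambda>x. - (sin x * t (cos x)))" and W: "W = (\<lambda>x. f (cos x) * U x)"
  shows "- (1 / pi) * distr_conv pv_inverse (zero_ext t) \<phi> + distr_of (zero_ext (\<lambda>x. f x * t x)) \<phi> = 0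
    \<longleftrightarrow> weak_identity U W (\<lambda>x. - (deriv \<phi> (cos x) * sin x)) (\<lambda>x. \<phi> (cos x))"
proof -
  let ?D = "deriv \<phi>" and ?F = "\<lambda>x. - (deriv \<phi> (cos x) * sin x)"
  obtain B where B: "\<And>x. \<bar>?D x\<bar> \<le> B" using test_function_deriv_bounded[OF \<phi>] by blast
  have Fc: "continuous_on {0..pi} ?F"
    by (intro continuous_intros continuous_on_compose2[OF test_function_deriv_continuous[OF \<phi>, of UNIV]]) auto
  have Fi: "integrable angles ?F" by (rule integrable_angles_continuous[OF Fc])
  have FB: "\<bar>?F x\<bar> \<le> B" for x
    using B[of "cos x"] abs_sin_le_one[of x] mult_mono[of "\<bar>?D (cos x)\<bar>" B "\<bar>sin x\<bar>" 1] by (simp add: abs_mult)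
  have "(?F has_integral (\<phi> (cos pi) - \<phi> (cos 0))) {0..pi}"
  proof (rule fundamental_theorem_of_calculus)
    fix x assume "x \<in> {0..pi}"
    have "((\<lambda>x. \<phi> (cos x)) has_real_derivative ?D (cos x) * - sin x) (at x within {0..pi})"
      by (rule DERIV_chain2[OF test_function_deriv[OF \<phi>]]) (auto intro!: derivative_eq_intros)
    then show "((\<lambda>x. \<phi> (cos x)) has_vector_derivative ?F x) (at x within {0..pi})"
      by (simp add: has_real_derivative_iff_has_vector_derivative)
  qed simp
  then have F0: "(LINT x|angles. ?F x) = 0"
    using integral_angles_continuous[OF Fc] test_function_outside[OF \<phi>] by simp
  then have F0': "(LINT x|angles. ?D (cos x) * sin x) = 0" by simp
  have pot: "(LINT z|leb_itv. ln \<bar>z - cos y\<bar> * ?D z) = - log_potential ?F y" if "y \<in> {0<..<pi}" for y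
  proof -
    have y: "0 \<le> y" "y \<le> pi" using that by auto
    have Ki: "integrable angles (\<lambda>x. log_kernel x y * ?F x)"
      using log_kernel_mult_integrable[of ?F B y] Fi FB y by auto
    have "(LINT z|leb_itv. ln \<bar>z - cos y\<bar> * ?D z) = (LINT x|angles. sin x * (ln \<bar>cos x - cos y\<bar> * ?D (cos x)))"
      by (rule cos_substitution)
    also have "\<dots> = (LINT x|angles. ln 2 * ?F x - log_kernel x y * ?F x)"
    proof (rule integral_cong_AE)
      have [measurable]: "?D \<in> borel_measurable borel"
        by (rule borel_measurable_continuous_onI[OF test_function_deriv_continuous[OF \<phi>]])
      show "(\<lambda>x. sin x * (ln \<bar>cos x - cos y\<bar> * ?D (cos x))) \<in> borel_measurable angles" by measurable
      show "(\<lambda>x. ln 2 * ?F x - log_kernel x y * ?F x) \<in> borel_measurable angles" by measurable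
      show "AE x in angles. sin x * (ln \<bar>cos x - cos y\<bar> * ?D (cos x)) = ln 2 * ?F x - log_kernel x y * ?F x"
        using AE_cos_neq[OF y] by eventually_elim (simp add: log_kernel_def ln_mult algebra_simps)
    qed
    also have "\<dots> = - log_potential ?F y"
      unfolding log_potential_def
      by (subst Bochner_Integration.integral_diff[OF integrable_mult_right[OF Fi] Ki]) (simp add: F0')
    finally show ?thesis .
  qed
  have "(LINT y|leb_itv. t y * (LINT z|leb_itv. ln \<bar>z - y\<bar> * ?D z)) = (LINT x|angles. U x * log_potential ?F x)"
    unfolding cos_substitution[of "\<lambda>y. t y * (LINT z|leb_itv. ln \<bar>z - y\<bar> * ?D z)"]
    by (rule Bochner_Integration.integral_cong) (use pot in \<open>auto simp: U\<close>)
  then have 1: "distr_conv pv_inverse (zero_ext t) \<phi> = - (LINT x|angles. U x * log_potential ?F x)"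
    using distr_conv_pv[OF t \<phi>] by simp
  have "distr_of (zero_ext (\<lambda>x. f x * t x)) \<phi> = (LINT x|leb_itv. (f x * t x) * \<phi> x)"
    by (simp add: distr_of_def zero_ext_integral)
  also have "\<dots> = (LINT x|angles. - (W x * \<phi> (cos x)))"
    unfolding cos_substitution[of "\<lambda>x. (f x * t x) * \<phi> x"] by (simp add: W U mult_ac)
  finally have 2: "distr_of (zero_ext (\<lambda>x. f x * t x)) \<phi> = - (LINT x|angles. W x * \<phi> (cos x))"
    by simp
  show ?thesis unfolding 1 2 weak_identity_def by auto
qed

section \<open>From test functions to moments\<close>

lemma flat_power_tendsto:
  assumes "d \<longlonglongrightarrow> 0" "v \<longlonglongrightarrow> s" "0 < s"
  shows "(\<lambda>j. flat_power (d j) a (v j)) \<longlonglongrightarrow> s powr a"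
proof -
  have "(\<lambda>j. v j powr a * exp (- d j / v j)) \<longlonglongrightarrow> s powr a * exp (- 0 / s)"
    using assms by (intro tendsto_intros) auto
  moreover have "\<forall>\<^sub>F j in sequentially. v j powr a * exp (- d j / v j) = flat_power (d j) a (v j)"
    using order_tendstoD(1)[OF assms(2,3)] by eventually_elim (simp add: flat_power_def)
  ultimately show ?thesis using Lim_transform_eventually by fastforce
qed

lemma flat_power_le:
  assumes "0 < d" "0 \<le> a"
  shows "0 \<le> flat_power d a s" "s \<le> 1 \<Longrightarrow> flat_power d a s \<le> 1"
proof -
  show "0 \<le> flat_power d a s" by (simp add: flat_power_def)
  assume s: "s \<le> 1"
  show "flat_power d a s \<le> 1"
  proof (cases "0 < s")
    case True
    have "s powr a * exp (- d / s) \<le> 1 * 1"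
      using True s assms by (intro mult_mono powr_le1) auto
    then show ?thesis using True by (simp add: flat_power_def)
  qed (simp add: flat_power_def)
qed

text \<open>With \<open>w = d / v\<close> the left-hand side is \<open>(1/2 + w) sqrt (1 + w) exp (- w)\<close>.\<close>
lemma flat_power_edge_bound:
  assumes d: "0 < d"
  shows "\<bar>(v / 2 + d) * flat_power d (- 3 / 2) v * sqrt (v + d)\<bar> \<le> 4"
proof (cases "0 < v")
  case True
  define w where "w = d / v"
  have w: "0 < w" "d = w * v" using True d by (auto simp: w_def)
  have "v * (v powr (- 3 / 2) * sqrt v) = 1"
  proof -
    have "v * (v powr (- 3 / 2) * sqrt v) = v powr 1 * (v powr (- 3 / 2) * v powr (1 / 2))"
      using True by (simp add: powr_half_sqrt)
    also have "\<dots> = v powr (1 + (- 3 / 2 + 1 / 2))" by (simp only: powr_add)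
    finally show ?thesis using True by simp
  qed
  moreover have "(v / 2 + d) * flat_power d (- 3 / 2) v * sqrt (v + d) =
      (v * (v powr (- 3 / 2) * sqrt v)) * ((1 / 2 + w) * sqrt (1 + w) * exp (- w))"
  proof -
    have "sqrt (v + d) = sqrt v * sqrt (1 + w)"
      unfolding w(2) real_sqrt_mult[symmetric] by (simp add: algebra_simps)
    moreover have "v / 2 + d = v * (1 / 2 + w)" unfolding w(2) by (simp add: algebra_simps)
    moreover have "d / v = w" by (simp add: w_def)
    ultimately show ?thesis using True by (simp add: flat_power_def mult_ac)
  qed
  ultimately have eq: "(v / 2 + d) * flat_power d (- 3 / 2) v * sqrt (v + d) = (1 / 2 + w) * sqrt (1 + w) * exp (- w)"
    by simp
  have "sqrt (1 + w) \<le> 1 + w" using w(1) by (simp add: real_le_lsqrt power2_eq_square)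
  then have "(1 / 2 + w) * sqrt (1 + w) * exp (- w) \<le> (1 + w) * (1 + w) * exp (- w)"
    using w(1) by (intro mult_mono) auto
  also have "(1 + w) * (1 + w) \<le> 4 * exp w"
  proof -
    have "1 + w / 2 \<le> exp (w / 2)" by (rule exp_ge_add_one_self)
    then have "(1 + w / 2) * (1 + w / 2) \<le> exp (w / 2) * exp (w / 2)"
      using w(1) by (intro mult_mono) auto
    also have "\<dots> = exp w" by (simp flip: exp_add)
    finally have "4 * ((1 + w / 2) * (1 + w / 2)) \<le> 4 * exp w" by simp
    moreover have "(1 + w) * (1 + w) \<le> 4 * ((1 + w / 2) * (1 + w / 2))"
      using w(1) by (simp add: algebra_simps)
    ultimately show ?thesis by linarith
  qed
  then have "(1 + w) * (1 + w) * exp (- w) \<le> 4 * exp w * exp (- w)"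
    by (intro mult_right_mono) auto
  also have "\<dots> = 4" by (simp flip: exp_add)
  finally show ?thesis unfolding eq using w(1) by (simp add: abs_of_nonneg)
qed (simp add: flat_power_def)

text \<open>The function \<open>sin (k x)\<close> is \<open>sqrt (1 - z\<^sup>2) q z\<close> in the variable \<open>z = cos x\<close>, for a polynomial \<open>q\<close>, and is not an
  admissible test function.  It is approximated by \<open>bump d q (1/2)\<close>, where the square root is replaced
  by \<open>sqrt (1 - d - z\<^sup>2) exp (- d / (1 - d - z\<^sup>2))\<close>.  Using the same \<open>d\<close> for the support and for the exponential
  keeps the derivatives with respect to \<open>x\<close> bounded as \<open>d \<rightarrow> 0\<close>.\<close>
lemma weak_imp_moments:
  assumes U: "integrable angles U" and W: "integrable angles W"
    and weak: "\<And>\<phi>. \<phi> \<in> test_functions itv \<Longrightarrow>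
      weak_identity U W (\<lambda>x. - (deriv \<phi> (cos x) * sin x)) (\<lambda>x. \<phi> (cos x))"
    and k: "0 < k"
  shows "(LINT x|angles. W x * sin (real k * x)) = - (LINT x|angles. U x * cos (real k * x))"
proof -
  obtain q where q: "\<And>x. sin (real k * x) = sin x * poly q (cos x)" using sin_multiple_poly by blast
  have kcos: "real k * cos (real k * x) = cos x * poly q (cos x) - (sin x)\<^sup>2 * poly (pderiv q) (cos x)" for x
  proof (rule DERIV_unique)
    show "((\<lambda>x. sin (real k * x)) has_real_derivative real k * cos (real k * x)) (at x)"
      by (auto intro!: derivative_eq_intros)
    have "((\<lambda>x. sin x * poly q (cos x)) has_real_derivative cos x * poly q (cos x) + (poly (pderiv q) (cos x) * (- sin x)) * sin x) (at x)"
      by (intro DERIV_mult DERIV_sin DERIV_chain2[OF poly_DERIV DERIV_cos])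
    then show "((\<lambda>x. sin (real k * x)) has_real_derivative cos x * poly q (cos x) - (sin x)\<^sup>2 * poly (pderiv q) (cos x)) (at x)"
      unfolding q by (simp add: power2_eq_square algebra_simps)
  qed
  define d where "d j = inverse (real (Suc (Suc j)))" for j
  have d: "0 < d j" "d j < 1" for j by (auto simp: d_def field_simps)
  have dlim: "d \<longlonglongrightarrow> 0"
    unfolding d_def using LIMSEQ_Suc[OF LIMSEQ_inverse_real_of_nat] by simp
  define \<phi> where "\<phi> j = bump (d j) q (1 / 2)" for j
  have \<phi>t: "\<phi> j \<in> test_functions itv" for j unfolding \<phi>_def by (rule bump_test_function[OF d])
  have pbd: "\<exists>C. \<forall>z\<in>{-1..1}. \<bar>poly p z\<bar> \<le> C" for p :: "real poly"
    using continuous_bounded_Icc[OF continuous_on_poly[OF continuous_on_id], of "-1" 1 p] by blast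
  obtain C1 where C1: "\<And>z. z \<in> {-1..1} \<Longrightarrow> \<bar>poly (pderiv q) z\<bar> \<le> C1" using pbd by blast
  obtain C2 where C2: "\<And>z. z \<in> {-1..1} \<Longrightarrow> \<bar>poly q z\<bar> \<le> C2" using pbd by blast
  have C0: "0 \<le> C1" "0 \<le> C2" using C1[of 0] C2[of 0] by auto
  let ?v = "\<lambda>j x. 1 - d j - (cos x)\<^sup>2"
  have v: "?v j x + d j = (sin x)\<^sup>2" for j x by (simp add: sin_squared_eq)
  have F: "- (deriv (\<phi> j) (cos x) * sin x) =
      - (poly (pderiv q) (cos x) * flat_power (d j) (1 / 2) (?v j x) * sin x) +
      2 * cos x * poly q (cos x) * ((?v j x / 2 + d j) * flat_power (d j) (- 3 / 2) (?v j x) * sin x)" for j x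
  proof -
    have a: "1 / 2 - 2 = (- 3 / 2 :: real)" by simp
    have "deriv (\<phi> j) (cos x) = (poly (pderiv q) (cos x) * (?v j x)\<^sup>2 - 2 * cos x * poly q (cos x) * (1 / 2 * ?v j x + d j)) *
        flat_power (d j) (- 3 / 2) (?v j x)"
      unfolding \<phi>_def deriv_bump[OF d(1)] bump_def poly_bump_deriv_poly a ..
    moreover have "flat_power (d j) (1 / 2) (?v j x) = (?v j x)\<^sup>2 * flat_power (d j) (- 3 / 2) (?v j x)"
      using flat_power_shift[of "d j" "1 / 2" "?v j x"] unfolding a .
    moreover have "- ((A * V\<^sup>2 - 2 * C * Q * (1 / 2 * V + D)) * E * S) =
        - (A * (V\<^sup>2 * E) * S) + 2 * C * Q * ((V / 2 + D) * E * S)" for A V C Q D E S :: real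
      by (simp add: algebra_simps)
    ultimately show ?thesis by (simp only:)
  qed
  have sq: "sin x = sqrt (?v j x + d j)" if "x \<in> {0<..<pi}" for j x
    using that sin_gt_zero[of x] unfolding v by simp
  have cb: "cos x \<in> {-1..1}" for x :: real by simp
  have "weak_identity U W (\<lambda>x. real k * cos (real k * x)) (\<lambda>x. sin (real k * x))"
  proof (rule weak_identity_limit[OF U W weak[OF \<phi>t]])
    have cD: "continuous_on {0..pi} (\<lambda>x. - (deriv (\<phi> j) (cos x) * sin x))" for j
      by (intro continuous_intros continuous_on_compose2[OF test_function_deriv_continuous[OF \<phi>t, of UNIV]]) auto
    show "(\<lambda>x. - (deriv (\<phi> j) (cos x) * sin x)) \<in> borel_measurable angles" for j
      by (rule measurable_angles_continuous[OF cD])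
    have "continuous_on UNIV (\<phi> j)" for j using test_function_deriv[OF \<phi>t] by (meson DERIV_continuous_on)
    then have c\<phi>: "continuous_on {0..pi} (\<lambda>x. \<phi> j (cos x))" for j
      by (rule continuous_on_compose2) (auto intro!: continuous_intros)
    show "(\<lambda>x. \<phi> j (cos x)) \<in> borel_measurable angles" for j
      by (rule measurable_angles_continuous[OF c\<phi>])
    show "\<bar>- (deriv (\<phi> j) (cos x) * sin x)\<bar> \<le> C1 + 8 * C2" if x: "x \<in> {0<..<pi}" for j x
    proof -
      have fp: "\<bar>flat_power (d j) (1 / 2) (?v j x)\<bar> \<le> 1"
      proof -
        have "?v j x \<le> 1" using d(1)[of j] zero_le_power2[of "cos x"] by linarith
        then show ?thesis using flat_power_le[OF d(1)[of j], of "1 / 2" "?v j x"] by simp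
      qed
      have "\<bar>poly (pderiv q) (cos x)\<bar> * \<bar>flat_power (d j) (1 / 2) (?v j x)\<bar> * \<bar>sin x\<bar> \<le> C1 * 1 * 1"
        using C1[OF cb] C0 fp by (intro mult_mono) auto
      moreover have "\<bar>2 * cos x\<bar> * \<bar>poly q (cos x)\<bar> * \<bar>(?v j x / 2 + d j) * flat_power (d j) (- 3 / 2) (?v j x) * sin x\<bar> \<le> 2 * C2 * 4"
      proof -
        have "\<bar>2 * cos x\<bar> \<le> 2" by (simp add: abs_mult)
        then show ?thesis
          using C2[OF cb] C0 flat_power_edge_bound[OF d(1)[of j], of "?v j x"] unfolding sq[OF x, of j, symmetric]
          by (intro mult_mono) auto
      qed
      moreover have T: "\<bar>- (a * b * c) + e * f * g\<bar> \<le> \<bar>a\<bar> * \<bar>b\<bar> * \<bar>c\<bar> + \<bar>e\<bar> * \<bar>f\<bar> * \<bar>g\<bar>" for a b c e f g :: real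
        using abs_triangle_ineq[of "- (a * b * c)" "e * f * g"] by (simp add: abs_mult)
      ultimately show ?thesis
        unfolding F by (intro order_trans[OF T]) linarith
    qed
    show "\<bar>\<phi> j (cos x)\<bar> \<le> C1 + 8 * C2" if x: "x \<in> {0<..<pi}" for j x
    proof -
      have fp: "\<bar>flat_power (d j) (1 / 2) (?v j x)\<bar> \<le> 1"
      proof -
        have "?v j x \<le> 1" using d(1)[of j] zero_le_power2[of "cos x"] by linarith
        then show ?thesis using flat_power_le[OF d(1)[of j], of "1 / 2" "?v j x"] by simp
      qed
      have "\<bar>poly q (cos x)\<bar> * \<bar>flat_power (d j) (1 / 2) (?v j x)\<bar> \<le> C2 * 1"
        using C2[OF cb] C0 fp by (intro mult_mono) auto
      then show ?thesis using C0 by (simp add: \<phi>_def bump_def abs_mult)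
    qed
    fix x :: real assume x: "x \<in> {0<..<pi}"
    then have sx: "0 < sin x" using sin_gt_zero by simp
    have vl: "(\<lambda>j. ?v j x) \<longlonglongrightarrow> 1 - 0 - (cos x)\<^sup>2" by (intro tendsto_intros dlim)
    have s: "1 - 0 - (cos x)\<^sup>2 = (sin x)\<^sup>2" by (simp add: sin_squared_eq)
    have fl: "(\<lambda>j. flat_power (d j) a (?v j x)) \<longlonglongrightarrow> ((sin x)\<^sup>2) powr a" for a
      using flat_power_tendsto[OF dlim vl[unfolded s]] sx by simp
    have h: "((sin x)\<^sup>2) powr a = sin x powr (2 * a)" for a
      using sx by (simp add: powr_powr flip: powr_numeral)
    have "(\<lambda>j. - (poly (pderiv q) (cos x) * flat_power (d j) (1 / 2) (?v j x) * sin x) +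
      2 * cos x * poly q (cos x) * ((?v j x / 2 + d j) * flat_power (d j) (- 3 / 2) (?v j x) * sin x)) \<longlonglongrightarrow>
      - (poly (pderiv q) (cos x) * (((sin x)\<^sup>2) powr (1 / 2)) * sin x) +
      2 * cos x * poly q (cos x) * (((sin x)\<^sup>2 / 2 + 0) * (((sin x)\<^sup>2) powr (- 3 / 2)) * sin x)"
      using vl[unfolded s] by (intro tendsto_intros fl dlim) auto
    moreover have "- (poly (pderiv q) (cos x) * (((sin x)\<^sup>2) powr (1 / 2)) * sin x) +
      2 * cos x * poly q (cos x) * (((sin x)\<^sup>2 / 2 + 0) * (((sin x)\<^sup>2) powr (- 3 / 2)) * sin x) = real k * cos (real k * x)"
    proof -
      have "((sin x)\<^sup>2) powr (1 / 2) = sin x" using sx h[of "1/2"] by simp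
      moreover have "((sin x)\<^sup>2) powr (- 3 / 2) = 1 / (sin x ^ 3)" using sx h[of "-3/2"] by (simp add: powr_minus powr_numeral divide_simps)
      ultimately show ?thesis
        unfolding kcos using sx by (simp add: power2_eq_square power3_eq_cube)
    qed
    ultimately show "(\<lambda>j. - (deriv (\<phi> j) (cos x) * sin x)) \<longlonglongrightarrow> real k * cos (real k * x)"
      unfolding F by simp
    have "(\<lambda>j. poly q (cos x) * flat_power (d j) (1 / 2) (?v j x)) \<longlonglongrightarrow> poly q (cos x) * ((sin x)\<^sup>2) powr (1 / 2)"
      by (intro tendsto_intros fl)
    then show "(\<lambda>j. \<phi> j (cos x)) \<longlonglongrightarrow> sin (real k * x)"
      unfolding q using sx h[of "1/2"] by (simp add: \<phi>_def bump_def mult.commute)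
  qed
  then show ?thesis using weak_identity_sin_iff[OF k] by simp
qed

section \<open>Solutions and boundary data\<close>

lemma Lq_integrable:
  assumes "1 < q" "t \<in> Lq q"
  shows "integrable leb_itv t"
proof -
  interpret finite_measure leb_itv by (rule finite_measure_lebesgue_on) simp
  have t: "t \<in> borel_measurable leb_itv" "integrable leb_itv (\<lambda>x. \<bar>t x\<bar> powr q)" using assms by (auto simp: Lq_def)
  show ?thesis
  proof (rule Bochner_Integration.integrable_bound[OF Bochner_Integration.integrable_add[OF integrable_const[of 1] t(2)] t(1)])
    show "AE x in leb_itv. norm (t x) \<le> norm (1 + \<bar>t x\<bar> powr q)"
    proof (rule AE_I2)
      fix x
      have "\<bar>t x\<bar> \<le> 1 + \<bar>t x\<bar> powr q"
      proof (cases "\<bar>t x\<bar> \<le> 1")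
        case False
        then have "\<bar>t x\<bar> powr 1 \<le> \<bar>t x\<bar> powr q" using assms(1) by (intro powr_mono) auto
        with False show ?thesis by simp
      qed (simp add: add_increasing2)
      then show "norm (t x) \<le> norm (1 + \<bar>t x\<bar> powr q)" by simp
    qed
  qed
qed

lemma solution_boundary_data:
  assumes sol: "is_solution P f t" and P: "0 < P" and f: "f \<in> borel_measurable leb_itv"
    and M: "0 \<le> M" "AE x in leb_itv. \<bar>f x\<bar> \<le> M"
  shows "boundary_data P M (\<lambda>x. f (cos x)) (\<lambda>x. - (sin x * t (cos x)))"
proof -
  let ?U = "\<lambda>x. - (sin x * t (cos x))" and ?b = "\<lambda>x. f (cos x)"
  obtain q where q: "1 < q" "t \<in> Lq q" using sol by (auto simp: is_solution_def)
  have t: "integrable leb_itv t" by (rule Lq_integrable[OF q])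
  then have U: "integrable angles ?U" by (simp add: cos_substitution_integrable)
  have neg: "AE x in angles. t (cos x) \<le> 0"
    using sol unfolding is_solution_def by (intro cos_substitution_AE) auto
  have b: "?b \<in> borel_measurable angles" by (rule cos_substitution_measurable[OF f])
  have bM: "AE x in angles. \<bar>?b x\<bar> \<le> M" by (rule cos_substitution_AE[OF M(2)])
  have W: "integrable angles (\<lambda>x. ?b x * ?U x)"
    using integrable_mult_bounded[OF U b bM] by (simp add: mult.commute)
  have mom: "(LINT x|angles. (?b x * ?U x) * sin (real k * x)) = - (LINT x|angles. ?U x * cos (real k * x))"
    if "0 < k" for k
  proof (rule weak_imp_moments[OF U W _ that])
    show "weak_identity ?U (\<lambda>x. ?b x * ?U x) (\<lambda>x. - (deriv \<phi> (cos x) * sin x)) (\<lambda>x. \<phi> (cos x))"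
      if "\<phi> \<in> test_functions itv" for \<phi>
      using sol that weak_equation_iff[OF t that refl refl] unfolding is_solution_def by blast
  qed
  show ?thesis
  proof
    show "AE x in angles. 0 \<le> ?U x"
      using neg AE_space by eventually_elim (auto simp: mult_nonneg_nonpos sin_gt_zero less_imp_le)
    show "(LINT x|angles. ?U x) = P"
      using sol cos_substitution[of t] by (simp add: is_solution_def)
    show "(LINT x|angles. ?U x * (cos (real k * x) + ?b x * sin (real k * x))) = 0" if "0 < k" for k
    proof -
      have "?U x * (cos (real k * x) + ?b x * sin (real k * x)) = ?U x * cos (real k * x) + (?b x * ?U x) * sin (real k * x)" for x
        by (simp add: algebra_simps)
      then have "(LINT x|angles. ?U x * (cos (real k * x) + ?b x * sin (real k * x))) =
         (LINT x|angles. ?U x * cos (real k * x) + (?b x * ?U x) * sin (real k * x))" by (simp only:)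
      also have "\<dots> = (LINT x|angles. ?U x * cos (real k * x)) + (LINT x|angles. (?b x * ?U x) * sin (real k * x))"
        by (intro Bochner_Integration.integral_add integrable_mult_continuous U W continuous_intros)
      finally show ?thesis using mom[OF that] by simp
    qed
  qed (use P M U b bM in auto)
qed

lemma boundary_data_solution:
  assumes bd: "boundary_data P M (\<lambda>x. f (cos x)) (\<lambda>x. - (sin x * t (cos x)))"
    and t: "t \<in> Lq q" "1 < q" and neg: "AE x in leb_itv. t x \<le> 0"
  shows "is_solution P f t"
proof -
  let ?U = "\<lambda>x. - (sin x * t (cos x))" and ?b = "\<lambda>x. f (cos x)"
  interpret boundary_data P M ?b ?U by (rule bd)
  have ti: "integrable leb_itv t" by (rule Lq_integrable[OF t(2,1)])
  have W: "integrable angles (\<lambda>x. ?b x * ?U x)" using V_int by (simp add: V_def[abs_def])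
  have mom: "(LINT x|angles. (?b x * ?U x) * sin (real k * x)) = - (LINT x|angles. ?U x * cos (real k * x))"
    if "0 < k" for k
    using V_sin[OF that] by (simp add: V_def)
  have weak: "weak_identity ?U (\<lambda>x. ?b x * ?U x) (\<lambda>x. - (deriv \<phi> (cos x) * sin x)) (\<lambda>x. \<phi> (cos x))"
    if \<phi>: "\<phi> \<in> test_functions itv" for \<phi>
  proof -
    let ?F = "\<lambda>x. - (deriv \<phi> (cos x) * sin x)"
    have Fc: "continuous_on {0..pi} ?F"
      by (intro continuous_intros continuous_on_compose2[OF test_function_deriv_continuous[OF \<phi>, of UNIV]]) auto
    have hi: "(?F has_integral (\<phi> (cos y) - \<phi> (cos 0))) {0..y}" if "0 \<le> y" for y
    proof (rule fundamental_theorem_of_calculus[OF that])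
      fix x assume "x \<in> {0..y}"
      have "((\<lambda>x. \<phi> (cos x)) has_real_derivative deriv \<phi> (cos x) * - sin x) (at x within {0..y})"
        by (rule DERIV_chain2[OF test_function_deriv[OF \<phi>]]) (auto intro!: derivative_eq_intros)
      then show "((\<lambda>x. \<phi> (cos x)) has_vector_derivative ?F x) (at x within {0..y})"
        by (simp add: has_real_derivative_iff_has_vector_derivative)
    qed
    have "integral {0..y} ?F = \<phi> (cos y)" if "0 \<le> y" for y
      using integral_unique[OF hi[OF that]] test_function_outside[OF \<phi>, of 1] by simp
    then have "mean_free_primitive ?F y = \<phi> (cos y)" if "0 \<le> y" for y
      using that test_function_outside[OF \<phi>, of "-1"] by (simp add: mean_free_primitive_def)
    then have "(LINT y|angles. (?b y * ?U y) * mean_free_primitive ?F y) = (LINT y|angles. (?b y * ?U y) * \<phi> (cos y))"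
      by (intro Bochner_Integration.integral_cong) auto
    with weak_identity_continuous[OF U_int W mom Fc] show ?thesis
      unfolding weak_identity_def by simp
  qed
  show ?thesis
    unfolding is_solution_def
  proof (intro conjI ballI)
    show "t \<in> (\<Union>q\<in>{1<..}. Lq q)" using t by auto
    show "AE x in leb_itv. t x \<le> 0" by (rule neg)
    show "(LINT x|leb_itv. t x) = - P" using U_mass cos_substitution[of t] by simp
    fix \<phi> assume "\<phi> \<in> test_functions itv"
    then show "- (1 / pi) * distr_conv pv_inverse (zero_ext t) \<phi> + distr_of (zero_ext (\<lambda>x. f x * t x)) \<phi> = 0"
      using weak weak_equation_iff[OF ti _ refl refl] by blast
  qed
qed

section \<open>The solution for a constant coefficient\<close>

text \<open>On the upper half circle \<open>(1 - w) / (1 + w) = - \<i> sin x / (1 + cos x)\<close>, and the argument of \<open>- \<i>\<close> is \<open>- \<pi> / 2\<close>.\<close>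
lemma constant_boundary_values:
  assumes x: "0 < x" "x < pi" and \<rho>: "\<And>j. 0 \<le> \<rho> j" "\<And>j. \<rho> j < 1" "\<rho> \<longlonglongrightarrow> 1"
  shows "(\<lambda>j. Re (rcis (\<rho> j) x ^ k * exp (of_real e * (Ln (1 - rcis (\<rho> j) x) - Ln (1 + rcis (\<rho> j) x)))))
     \<longlonglongrightarrow> (sin x / (1 + cos x)) powr e * cos (real k * x - pi * e / 2)"
proof -
  define \<tau> where "\<tau> = sin x / (1 + cos x)"
  have s: "0 < sin x" using x by (rule sin_gt_zero)
  have c: "-1 < cos x" "cos x < 1" using cos_image x by auto
  have \<tau>: "0 < \<tau>" using s c by (simp add: \<tau>_def)
  have n1: "1 - cis x \<notin> \<real>\<^sub>\<le>\<^sub>0" "1 + cis x \<notin> \<real>\<^sub>\<le>\<^sub>0"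
    using c s by (auto simp: complex_nonpos_Reals_iff)
  have "(\<lambda>j. rcis (\<rho> j) x) \<longlonglongrightarrow> of_real 1 * cis x"
    unfolding rcis_def by (intro tendsto_intros \<rho>)
  then have l: "(\<lambda>j. rcis (\<rho> j) x) \<longlonglongrightarrow> cis x" by simp
  have L: "Ln (1 - cis x) - Ln (1 + cis x) = of_real (ln \<tau>) - \<i> * of_real (pi / 2)"
  proof -
    let ?d = "Ln (1 - cis x) - Ln (1 + cis x)"
    have p: "0 < Re (1 - cis x)" "0 < Re (1 + cis x)" using c by auto
    have "1 - cis x = (1 + cis x) * (- \<i> * of_real \<tau>)"
    proof (rule complex_eqI)
      have "sin x * \<tau> = (sin x)\<^sup>2 / (1 + cos x)" by (simp add: \<tau>_def power2_eq_square)
      also have "\<dots> = 1 - cos x"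
        using c by (simp add: sin_squared_eq divide_simps power2_eq_square algebra_simps)
      finally show "Re (1 - cis x) = Re ((1 + cis x) * (- \<i> * of_real \<tau>))" by simp
      show "Im (1 - cis x) = Im ((1 + cis x) * (- \<i> * of_real \<tau>))"
        using c by (simp add: \<tau>_def)
    qed
    moreover have "1 + cis x \<noteq> 0" "1 - cis x \<noteq> 0" using p by (auto simp: complex_eq_iff)
    ultimately have "exp ?d = - \<i> * of_real \<tau>"
      by (simp add: exp_diff)
    moreover have "- pi < Im ?d" "Im ?d \<le> pi"
      using Re_Ln_pos_lt_imp[OF p(1)] Re_Ln_pos_lt_imp[OF p(2)] by (auto simp: abs_less_iff)
    ultimately have "?d = Ln (- \<i> * of_real \<tau>)" by (metis Ln_exp)
    also have "\<dots> = Ln (of_real \<tau> * (- \<i>))" by (simp add: mult.commute)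
    also have "\<dots> = of_real (ln \<tau>) + Ln (- \<i>)" using \<tau> by (subst Ln_times_of_real) (auto simp: Ln_of_real)
    also have "Ln (- \<i>) = - (\<i> * of_real pi / 2)" by simp
    finally show ?thesis by simp
  qed
  have "(\<lambda>j. Re (rcis (\<rho> j) x ^ k * exp (of_real e * (Ln (1 - rcis (\<rho> j) x) - Ln (1 + rcis (\<rho> j) x))))) \<longlonglongrightarrow>
     Re (cis x ^ k * exp (of_real e * (Ln (1 - cis x) - Ln (1 + cis x))))"
    by (intro tendsto_intros l n1)
  also have "cis x ^ k * exp (of_real e * (Ln (1 - cis x) - Ln (1 + cis x))) = of_real (\<tau> powr e) * cis (real k * x - pi * e / 2)"
  proof -
    have "of_real e * (Ln (1 - cis x) - Ln (1 + cis x)) = of_real (e * ln \<tau>) + \<i> * of_real (- (pi * e / 2))"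
      unfolding L by (simp add: algebra_simps)
    then have E: "exp (of_real e * (Ln (1 - cis x) - Ln (1 + cis x))) = of_real (\<tau> powr e) * cis (- (pi * e / 2))"
      using \<tau> by (simp only: exp_add exp_of_real) (simp add: powr_def cis_conv_exp)
    have "cis x ^ k * exp (of_real e * (Ln (1 - cis x) - Ln (1 + cis x))) =
        cis (real k * x) * (of_real (\<tau> powr e) * cis (- (pi * e / 2)))"
      unfolding E Complex.DeMoivre ..
    also have "\<dots> = of_real (\<tau> powr e) * (cis (real k * x) * cis (- (pi * e / 2)))"
      by (rule mult.left_commute)
    finally show ?thesis by (simp only: cis_mult diff_conv_add_uminus)
  qed
  finally show ?thesis by (simp add: \<tau>_def)
qed

text \<open>Both \<open>\<bar>1 - w\<bar>\<close> and \<open>\<bar>1 + w\<bar>\<close> lie between \<open>sin x / 2\<close> and \<open>2\<close>.\<close>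
lemma ratio_power_bound:
  assumes x: "0 < x" "x < pi" and r: "0 \<le> r" "r < 1"
  shows "norm (rcis r x ^ k * exp (of_real e * (Ln (1 - rcis r x) - Ln (1 + rcis r x)))) \<le> 4 powr \<bar>e\<bar> * sin x powr - \<bar>e\<bar>"
proof -
  have s: "0 < sin x" using x by (rule sin_gt_zero)
  let ?m = "norm (1 - rcis r x)" and ?p = "norm (1 + rcis r x)"
  have eqp: "1 + rcis r x = 1 - rcis r (x + pi)" by (simp add: rcis_def flip: cis_mult)
  have lower: "sin x / 2 \<le> ?m" "sin x / 2 \<le> ?p"
  proof -
    have "sin x \<le> norm (1 - cis x)" "sin x \<le> norm (1 - cis (x + pi))"
      using abs_Im_le_cmod[of "1 - cis x"] abs_Im_le_cmod[of "1 - cis (x + pi)"] by auto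
    moreover have "norm (1 - cis x) \<le> 2 * ?m" "norm (1 - cis (x + pi)) \<le> 2 * ?p"
      unfolding eqp using r by (intro norm_one_minus_rcis_ge; simp)+
    ultimately show "sin x / 2 \<le> ?m" "sin x / 2 \<le> ?p" by linarith+
  qed
  have upper: "?m \<le> 2" "?p \<le> 2"
    using norm_triangle_ineq4[of 1 "rcis r x"] norm_triangle_ineq[of 1 "rcis r x"] r by auto
  have pos: "0 < ?m" "0 < ?p" using lower s by linarith+
  have ratio: "?m / ?p \<le> 4 / sin x" "?p / ?m \<le> 4 / sin x"
    using pos lower upper s frac_le[of 2 ?m "sin x / 2" ?p] frac_le[of 2 ?p "sin x / 2" ?m] by auto
  have "norm (exp (of_real e * (Ln (1 - rcis r x) - Ln (1 + rcis r x)))) = exp (e * (ln ?m - ln ?p))"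
    using pos by (simp add: norm_exp_eq_Re)
  also have "\<dots> = (?m / ?p) powr e"
    using pos by (simp add: powr_def ln_div)
  also have "\<dots> \<le> (4 / sin x) powr \<bar>e\<bar>"
  proof (cases "0 \<le> e")
    case True
    then show ?thesis using ratio pos by (simp add: powr_mono2)
  next
    case False
    have "(?m / ?p) powr e = (?p / ?m) powr - e"
      using pos by (simp add: powr_minus powr_divide divide_simps)
    also have "\<dots> \<le> (4 / sin x) powr - e" using False ratio pos by (intro powr_mono2) auto
    finally show ?thesis using False by simp
  qed
  also have "\<dots> = 4 powr \<bar>e\<bar> * sin x powr - \<bar>e\<bar>"
    using s by (simp add: powr_divide powr_minus divide_simps)
  finally have b: "norm (exp (of_real e * (Ln (1 - rcis r x) - Ln (1 + rcis r x)))) \<le> 4 powr \<bar>e\<bar> * sin x powr - \<bar>e\<bar>" .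
  have "norm (rcis r x ^ k) \<le> 1" using r by (simp add: norm_power power_le_one)
  from mult_mono[OF this b] show ?thesis by (simp add: norm_mult)
qed

text \<open>Mean value property of \<open>((1 - w) / (1 + w))\<^sup>e w\<^sup>k\<close> on circles of radius \<open>r < 1\<close>, and dominated convergence for
  \<open>r \<rightarrow> 1\<close>.\<close>
lemma constant_moment_integrals:
  fixes e :: real
  assumes e: "\<bar>e\<bar> < 1"
  shows "integrable angles (\<lambda>x. (sin x / (1 + cos x)) powr e)"
    and "(LINT x|angles. (sin x / (1 + cos x)) powr e * cos (real k * x - pi * e / 2)) = (if k = 0 then pi else 0)"
proof -
  define \<rho> where "\<rho> = radius"
  note \<rho> = radius_bounds[folded \<rho>_def] and \<rho>1 = radius_tendsto[folded \<rho>_def]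
  let ?F = "\<lambda>w::complex. w ^ k * exp (of_real e * (Ln (1 - w) - Ln (1 + w)))"
  let ?g = "\<lambda>x. 4 powr \<bar>e\<bar> * sin x powr - \<bar>e\<bar>"
  have gi: "integrable angles ?g" using e by (intro integrable_mult_right sin_powr_integrable) auto
  have n: "1 - w \<notin> \<real>\<^sub>\<le>\<^sub>0" "1 + w \<notin> \<real>\<^sub>\<le>\<^sub>0" if "norm w < 1" for w :: complex
    using that abs_Re_le_cmod[of w] by (auto simp: complex_nonpos_Reals_iff)
  have hol: "?F holomorphic_on ball 0 1"
    using n by (intro holomorphic_intros) auto
  have sym: "?F (cnj w) = cnj (?F w)" if "norm w < 1" for w
    using n[OF that] by (simp add: cnj_Ln exp_cnj)
  have cm: "(\<lambda>x. cos (real k * x - pi * e / 2)) \<in> borel_measurable angles"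
    by (intro measurable_angles_continuous continuous_intros) simp
  show "integrable angles (\<lambda>x. (sin x / (1 + cos x)) powr e)"
  proof (rule Bochner_Integration.integrable_bound[OF gi])
    show "(\<lambda>x. (sin x / (1 + cos x)) powr e) \<in> borel_measurable angles" by measurable
    show "AE x in angles. norm ((sin x / (1 + cos x)) powr e) \<le> norm (?g x)"
    proof (rule AE_I2)
      fix x assume "x \<in> space angles"
      then have x: "0 < x" "x < pi" by auto
      have s: "0 < sin x" using x by (rule sin_gt_zero)
      have c: "-1 < cos x" "cos x < 1" using cos_image x by auto
      have sc: "sin x * sin x = (1 - cos x) * (1 + cos x)"
        using sin_squared_eq[of x] by (simp add: power2_eq_square algebra_simps)
      have r: "sin x / (1 + cos x) \<le> 4 / sin x" "(1 + cos x) / sin x \<le> 4 / sin x"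
        using s c by (auto simp: divide_simps sc)
      have "(sin x / (1 + cos x)) powr e \<le> (4 / sin x) powr \<bar>e\<bar>"
      proof (cases "0 \<le> e")
        case True
        then show ?thesis using r s c by (simp add: powr_mono2)
      next
        case False
        have "(sin x / (1 + cos x)) powr e = ((1 + cos x) / sin x) powr - e"
          using s c by (simp add: powr_minus powr_divide divide_simps)
        also have "\<dots> \<le> (4 / sin x) powr - e" using False r s c by (intro powr_mono2) auto
        finally show ?thesis using False by simp
      qed
      then show "norm ((sin x / (1 + cos x)) powr e) \<le> norm (?g x)"
        using s by (simp add: powr_divide powr_minus divide_simps)
    qed
  qed
  have i: "integrable angles (\<lambda>x. Re (?F (rcis (\<rho> j) x)))" for j
    by (intro integrable_angles_continuous continuous_intros continuous_on_circle[OF hol] \<rho>)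
  have "(\<lambda>j. LINT x|angles. Re (?F (rcis (\<rho> j) x))) \<longlonglongrightarrow>
      (LINT x|angles. (sin x / (1 + cos x)) powr e * cos (real k * x - pi * e / 2))"
  proof (rule integral_dominated_convergence[OF _ _ gi])
    show "(\<lambda>x. (sin x / (1 + cos x)) powr e * cos (real k * x - pi * e / 2)) \<in> borel_measurable angles"
      using cm by measurable
    show "(\<lambda>x. Re (?F (rcis (\<rho> j) x))) \<in> borel_measurable angles" for j using i by blast
    show "AE x in angles. (\<lambda>j. Re (?F (rcis (\<rho> j) x))) \<longlonglongrightarrow> (sin x / (1 + cos x)) powr e * cos (real k * x - pi * e / 2)"
      by (rule AE_I2) (use constant_boundary_values[OF _ _ \<rho> \<rho>1] in auto)
    show "AE x in angles. norm (Re (?F (rcis (\<rho> j) x))) \<le> ?g x" for j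
    proof (rule AE_I2)
      fix x assume "x \<in> space angles"
      then have "norm (?F (rcis (\<rho> j) x)) \<le> ?g x" using ratio_power_bound[OF _ _ \<rho>] by auto
      then show "norm (Re (?F (rcis (\<rho> j) x))) \<le> ?g x"
        using abs_Re_le_cmod[of "?F (rcis (\<rho> j) x)"] unfolding real_norm_def by linarith
    qed
  qed
  moreover have "(LINT x|angles. Re (?F (rcis (\<rho> j) x))) = (if k = 0 then pi else 0)" for j
  proof -
    from real_series_exists[OF hol sym] obtain c where "real_series c ?F" ..
    from real_series_mean[OF this \<rho>] show ?thesis by (simp add: power_0_left)
  qed
  ultimately have "(\<lambda>j::nat. (if k = 0 then pi else 0)) \<longlonglongrightarrow>
      (LINT x|angles. (sin x / (1 + cos x)) powr e * cos (real k * x - pi * e / 2))"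
    by simp
  from LIMSEQ_unique[OF this tendsto_const]
  show "(LINT x|angles. (sin x / (1 + cos x)) powr e * cos (real k * x - pi * e / 2)) = (if k = 0 then pi else 0)" .
qed

lemma const_solution_angles:
  assumes x: "0 < x" "x < pi"
  shows "- (sin x * const_solution P c (cos x)) =
    P / (pi * sqrt (1 + c\<^sup>2)) * (sin x / (1 + cos x)) powr (2 * alpha c)"
proof -
  define a where "a = alpha c"
  have s: "0 < sin x" using x by (rule sin_gt_zero)
  have c: "-1 < cos x" "cos x < 1" using cos_image x by auto
  have s2: "sin x = (1 + cos x) powr (1/2) * (1 - cos x) powr (1/2)"
  proof -
    have "(sin x)\<^sup>2 = (1 + cos x) * (1 - cos x)" by (simp add: sin_squared_eq algebra_simps power2_eq_square)
    then have "sin x = sqrt ((1 + cos x) * (1 - cos x))" using s by (metis abs_of_pos real_sqrt_abs)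
    then show ?thesis using c by (simp add: powr_half_sqrt real_sqrt_mult)
  qed
  have p: "0 < 1 + cos x" "0 < 1 - cos x" using c by auto
  have "sin x / ((1 + cos x) powr (1/2 + a) * (1 - cos x) powr (1/2 - a)) = (1 + cos x) powr - a * (1 - cos x) powr a"
  proof -
    have "sin x / ((1 + cos x) powr (1/2 + a) * (1 - cos x) powr (1/2 - a)) =
        ((1 + cos x) powr (1/2) / (1 + cos x) powr (1/2 + a)) * ((1 - cos x) powr (1/2) / (1 - cos x) powr (1/2 - a))"
      by (subst s2) simp
    also have "\<dots> = (1 + cos x) powr (1/2 - (1/2 + a)) * (1 - cos x) powr (1/2 - (1/2 - a))"
      by (simp only: powr_diff)
    finally show ?thesis by simp
  qed
  also have "\<dots> = (sin x / (1 + cos x)) powr (2 * a)"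
  proof -
    have "sin x / (1 + cos x) = (1 - cos x) powr (1/2) * (1 + cos x) powr - (1/2)"
    proof -
      have "sin x / (1 + cos x) = (1 - cos x) powr (1/2) * ((1 + cos x) powr (1/2) / (1 + cos x))"
        by (subst s2) simp
      also have "(1 + cos x) powr (1/2) / (1 + cos x) = (1 + cos x) powr - (1/2)"
        using powr_diff[of "1 + cos x" "1/2" 1] p by simp
      finally show ?thesis .
    qed
    then show ?thesis using p by (simp add: powr_mult powr_powr mult.commute)
  qed
  finally have "sin x / ((1 + cos x) powr (1/2 + a) * (1 - cos x) powr (1/2 - a)) = (sin x / (1 + cos x)) powr (2 * a)" .
  then show ?thesis unfolding const_solution_def a_def[symmetric]
    by (simp add: mult.assoc flip: times_divide_eq_right) (simp add: divide_simps)
qed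

text \<open>With \<open>a = arctan c\<close> one has \<open>cos (k x) + c sin (k x) = cos (k x - a) / cos a\<close>, so that the moments are those of
  \<open>constant_moment_integrals\<close> for \<open>e = 2 a / \<pi>\<close>.\<close>
lemma constant_boundary_data:
  assumes P: "0 < P"
  shows "boundary_data P \<bar>c\<bar> (\<lambda>_. c) (\<lambda>x. - (sin x * const_solution P c (cos x)))"
proof -
  let ?U = "\<lambda>x. - (sin x * const_solution P c (cos x))"
  define e where "e = 2 * alpha c"
  define K where "K = P / (pi * sqrt (1 + c\<^sup>2))"
  let ?T = "\<lambda>x. (sin x / (1 + cos x)) powr e"
  have K: "0 < K" unfolding K_def using P by (intro divide_pos_pos mult_pos_pos) (auto simp: add_pos_nonneg)
  have e: "\<bar>e\<bar> < 1" using arctan_bounded[of c] by (auto simp: e_def alpha_def abs_less_iff field_simps)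
  have U: "?U x = K * ?T x" if "x \<in> {0<..<pi}" for x
    using const_solution_angles[of x P c] that by (simp add: K_def e_def)
  have ae: "pi * e / 2 = arctan c" by (simp add: e_def alpha_def)
  have sec: "cos (real k * x) + c * sin (real k * x) = sqrt (1 + c\<^sup>2) * cos (real k * x - arctan c)" for k x
  proof -
    have "sqrt (1 + c\<^sup>2) \<noteq> 0" by (simp add: add_nonneg_eq_0_iff)
    then show ?thesis by (simp add: cos_diff cos_arctan sin_arctan distrib_left)
  qed
  have int: "(LINT x|angles. ?U x * (cos (real k * x) + c * sin (real k * x))) = (if k = 0 then P else 0)" for k
  proof -
    have "(LINT x|angles. ?U x * (cos (real k * x) + c * sin (real k * x))) =
       (LINT x|angles. (K * sqrt (1 + c\<^sup>2)) * (?T x * cos (real k * x - pi * e / 2)))"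
      by (rule Bochner_Integration.integral_cong) (auto simp: U sec ae simp del: mult_minus_left)
    also have "\<dots> = (K * sqrt (1 + c\<^sup>2)) * (if k = 0 then pi else 0)"
      using constant_moment_integrals(2)[OF e, of k] by simp
    also have "K * sqrt (1 + c\<^sup>2) = P / pi"
    proof -
      have "sqrt (1 + c\<^sup>2) \<noteq> 0" by (simp add: add_nonneg_eq_0_iff)
      then show ?thesis by (simp add: K_def)
    qed
    finally show ?thesis by simp
  qed
  show ?thesis
  proof
    have "integrable angles (\<lambda>x. K * ?T x)" using constant_moment_integrals(1)[OF e] by simp
    then show "integrable angles ?U"
      by (rule Bochner_Integration.integrable_cong[THEN iffD1, rotated -1]) (simp_all add: U)
    show "AE x in angles. 0 \<le> ?U x" by (rule AE_I2) (use U K in auto)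
    show "(LINT x|angles. ?U x) = P" using int[of 0] by simp
    show "(LINT x|angles. ?U x * (cos (real k * x) + c * sin (real k * x))) = 0" if "0 < k" for k
      using int[of k] that by simp
  qed (use P in auto)
qed

section \<open>Uniform bounds in the Lebesgue spaces\<close>

text \<open>For \<open>U = - t (cos x) sin x\<close> the substitution turns \<open>\<bar>t\<bar>\<^sup>q dx\<close> into \<open>U\<^sup>q (sin x)\<close> to the power \<open>1 - q\<close>.\<close>
lemma Lq_uniform_bound:
  assumes P: "0 < P" and M: "0 \<le> M" and q: "1 < q" "q < inverse (1/2 + arctan M / pi)"
  shows "\<exists>C. \<forall>b t. t \<in> borel_measurable leb_itv \<longrightarrow> boundary_data P M b (\<lambda>x. - (sin x * t (cos x))) \<longrightarrow>
    t \<in> Lq q \<and> (LINT x|leb_itv. \<bar>t x\<bar> powr q) \<le> C"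
proof -
  obtain C where C: "\<And>b U. boundary_data P M b U \<Longrightarrow>
      (\<integral>\<^sup>+x. ennreal (U x powr q * sin x powr (1 - q)) \<partial>angles) \<le> ennreal C"
    using uniform_weighted_power_bound[OF assms] by blast
  show ?thesis
  proof (intro exI[of _ "max C 0"] allI impI conjI)
    fix b t assume t: "t \<in> borel_measurable leb_itv" and bd: "boundary_data P M b (\<lambda>x. - (sin x * t (cos x)))"
    let ?U = "\<lambda>x. - (sin x * t (cos x))"
    interpret boundary_data P M b ?U by (rule bd)
    have eq: "AE x in angles. ?U x powr q * sin x powr (1 - q) = sin x * \<bar>t (cos x)\<bar> powr q"
      using U_nonneg AE_space
    proof eventually_elim
      case (elim x)
      then have s: "0 < sin x" by (intro sin_gt_zero) auto
      then have "t (cos x) \<le> 0" using elim(1) by (simp add: mult_le_0_iff)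
      then have "?U x = sin x * \<bar>t (cos x)\<bar>" by simp
      then show ?case using s by (simp add: powr_mult powr_diff)
    qed
    have m [measurable]: "(\<lambda>x. sin x * \<bar>t (cos x)\<bar> powr q) \<in> borel_measurable angles"
    proof -
      note [measurable] = cos_substitution_measurable[OF t]
      show ?thesis by measurable
    qed
    have nn: "(\<integral>\<^sup>+x. ennreal (sin x * \<bar>t (cos x)\<bar> powr q) \<partial>angles) \<le> ennreal C"
    proof -
      have "(\<integral>\<^sup>+x. ennreal (sin x * \<bar>t (cos x)\<bar> powr q) \<partial>angles) = (\<integral>\<^sup>+x. ennreal (?U x powr q * sin x powr (1 - q)) \<partial>angles)"
        by (rule nn_integral_cong_AE) (use eq in \<open>eventually_elim, simp\<close>)
      then show ?thesis using C[OF bd] by simp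
    qed
    have pos: "AE x in angles. 0 \<le> sin x * \<bar>t (cos x)\<bar> powr q"
      by (rule AE_I2) (use sin_gt_zero in \<open>force intro: mult_nonneg_nonneg less_imp_le\<close>)
    have i: "integrable angles (\<lambda>x. sin x * \<bar>t (cos x)\<bar> powr q)"
      by (rule integrableI_nonneg[OF m pos]) (use nn in \<open>auto elim: le_less_trans\<close>)
    then show "t \<in> Lq q" using t by (simp add: Lq_def cos_substitution_integrable)
    have "ennreal (LINT x|angles. sin x * \<bar>t (cos x)\<bar> powr q) \<le> ennreal C"
      using nn_integral_eq_integral[OF i pos] nn by simp
    then show "(LINT x|leb_itv. \<bar>t x\<bar> powr q) \<le> max C 0"
      unfolding cos_substitution[of "\<lambda>x. \<bar>t x\<bar> powr q"]
    proof -
      assume "ennreal (LINT x|angles. sin x * \<bar>t (cos x)\<bar> powr q) \<le> ennreal C"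
      also have "\<dots> \<le> ennreal (max C 0)" by (rule ennreal_leI) simp
      finally show "(LINT x|angles. sin x * \<bar>t (cos x)\<bar> powr q) \<le> max C 0"
        by (subst (asm) ennreal_le_iff) auto
    qed
  qed
qed

section \<open>Weak convergence\<close>

text \<open>Young's inequality with a free parameter takes the place of the inequality of Hoelder: the first term is
  small for small \<open>\<eta>\<close>, the second one once \<open>b\<close> is small in the dual space.\<close>
lemma scaled_Young:
  fixes a b :: real
  assumes q: "1 < q" and \<eta>: "0 < \<eta>"
  shows "\<bar>a * b\<bar> \<le> \<eta> * \<bar>a\<bar> powr q + \<eta> powr (- 1 / (q - 1)) * \<bar>b\<bar> powr (q / (q - 1))"
proof -
  define q' where "q' = q / (q - 1)"
  have q': "1 < q'" "1 / q + 1 / q' = 1" using q by (auto simp: q'_def divide_simps)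
  define A where "A = \<eta> powr (1 / q) * \<bar>a\<bar>"
  define B where "B = \<eta> powr (- (1 / q)) * \<bar>b\<bar>"
  have "A * B \<le> A powr q / q + B powr q' / q'"
    by (rule Youngs_inequality) (use q q' \<eta> in \<open>auto simp: A_def B_def\<close>)
  also have "\<dots> \<le> A powr q + B powr q'"
  proof -
    have "c / r \<le> c" if "0 \<le> c" "1 < r" for c r :: real
      using that mult_left_mono[of 1 r c] by (simp add: divide_le_eq)
    then show ?thesis using q q' by (intro add_mono) auto
  qed
  also have "A powr q = \<eta> * \<bar>a\<bar> powr q" using q \<eta> by (simp add: A_def powr_mult powr_powr)
  also have "B powr q' = \<eta> powr (- 1 / (q - 1)) * \<bar>b\<bar> powr q'"
  proof -
    have "- (1 / q) * q' = - 1 / (q - 1)" using q by (simp add: q'_def divide_simps)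
    then show ?thesis using \<eta> by (simp add: B_def powr_mult powr_powr)
  qed
  also have "A * B = \<bar>a * b\<bar>" using \<eta> by (simp add: A_def B_def abs_mult powr_minus)
  finally show ?thesis by (simp add: q'_def)
qed

lemma Lq_pairing:
  fixes u g :: "real \<Rightarrow> real"
  assumes q: "1 < q" and u: "u \<in> borel_measurable leb_itv" "integrable leb_itv (\<lambda>x. \<bar>u x\<bar> powr q)"
    and g: "g \<in> borel_measurable leb_itv" "integrable leb_itv (\<lambda>x. \<bar>g x\<bar> powr (q / (q - 1)))"
    and \<eta>: "0 < \<eta>"
  shows "integrable leb_itv (\<lambda>x. u x * g x)"
    and "\<bar>LINT x|leb_itv. u x * g x\<bar> \<le>
      \<eta> * (LINT x|leb_itv. \<bar>u x\<bar> powr q) + \<eta> powr (- 1 / (q - 1)) * (LINT x|leb_itv. \<bar>g x\<bar> powr (q / (q - 1)))"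
proof -
  let ?R = "\<lambda>x. \<eta> * \<bar>u x\<bar> powr q + \<eta> powr (- 1 / (q - 1)) * \<bar>g x\<bar> powr (q / (q - 1))"
  have R: "integrable leb_itv ?R"
    by (intro Bochner_Integration.integrable_add integrable_mult_right u g)
  show i: "integrable leb_itv (\<lambda>x. u x * g x)"
  proof (rule Bochner_Integration.integrable_bound[OF R])
    show "(\<lambda>x. u x * g x) \<in> borel_measurable leb_itv" using u(1) g(1) by (rule borel_measurable_times)
    show "AE x in leb_itv. norm (u x * g x) \<le> norm (?R x)"
      unfolding real_norm_def by (intro AE_I2 order_trans[OF scaled_Young[OF q \<eta>] abs_ge_self])
  qed
  have "\<bar>LINT x|leb_itv. u x * g x\<bar> \<le> (LINT x|leb_itv. \<bar>u x * g x\<bar>)" by (rule integral_abs_bound)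
  also have "\<dots> \<le> (LINT x|leb_itv. ?R x)"
    by (intro integral_mono integrable_abs i R scaled_Young q \<eta>)
  also have "\<dots> = \<eta> * (LINT x|leb_itv. \<bar>u x\<bar> powr q) + \<eta> powr (- 1 / (q - 1)) * (LINT x|leb_itv. \<bar>g x\<bar> powr (q / (q - 1)))"
    by (subst Bochner_Integration.integral_add) (auto intro: integrable_mult_right u g)
  finally show "\<bar>LINT x|leb_itv. u x * g x\<bar> \<le>
      \<eta> * (LINT x|leb_itv. \<bar>u x\<bar> powr q) + \<eta> powr (- 1 / (q - 1)) * (LINT x|leb_itv. \<bar>g x\<bar> powr (q / (q - 1)))" .
qed

text \<open>A uniform bound in \<open>L\<^sup>q\<close> extends the convergence from a dense set of test functions to all of the dual
  space.\<close>
lemma weak_convergence_from_polynomials: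
  assumes q: "1 < q" and u: "\<And>n. 1 \<le> n \<Longrightarrow> u n \<in> Lq q" and v: "v \<in> Lq q"
    and B: "\<And>n. 1 \<le> n \<Longrightarrow> (LINT x|leb_itv. \<bar>u n x\<bar> powr q) \<le> B"
    and w: "continuous_on {-1..1} w" "\<And>x. -1 < x \<Longrightarrow> x < 1 \<Longrightarrow> 0 < w x"
    and lim: "\<And>p. (\<lambda>n. LINT x|leb_itv. u n x * (w x * poly p x)) \<longlonglongrightarrow> (LINT x|leb_itv. v x * (w x * poly p x))"
  shows "weakly_converges q u v"
  unfolding weakly_converges_def
proof (intro conjI allI impI ballI u v)
  let ?q' = "q / (q - 1)"
  interpret finite_measure leb_itv by (rule finite_measure_lebesgue_on) simp
  have q': "0 < ?q'" using q by simp
  fix g assume "g \<in> Lq ?q'"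
  then have g: "g \<in> borel_measurable leb_itv" "integrable leb_itv (\<lambda>x. \<bar>g x\<bar> powr ?q')" by (auto simp: Lq_def)
  have um: "u n \<in> borel_measurable leb_itv" "integrable leb_itv (\<lambda>x. \<bar>u n x\<bar> powr q)" if "1 \<le> n" for n
    using u[OF that] by (auto simp: Lq_def)
  have vm: "v \<in> borel_measurable leb_itv" "integrable leb_itv (\<lambda>x. \<bar>v x\<bar> powr q)" using v by (auto simp: Lq_def)
  define B' where "B' = max B (LINT x|leb_itv. \<bar>v x\<bar> powr q) + 1"
  have "0 \<le> (LINT x|leb_itv. \<bar>v x\<bar> powr q)" by simp
  also have "\<dots> \<le> max B (LINT x|leb_itv. \<bar>v x\<bar> powr q)" by simp
  finally have B': "0 < B'" "B \<le> B'" "(LINT x|leb_itv. \<bar>v x\<bar> powr q) \<le> B'" by (auto simp: B'_def)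
  show "(\<lambda>n. LINT x|leb_itv. u n x * g x) \<longlonglongrightarrow> (LINT x|leb_itv. v x * g x)"
  proof (rule LIMSEQ_I)
    fix \<epsilon> :: real assume \<epsilon>: "0 < \<epsilon>"
    define \<eta> where "\<eta> = \<epsilon> / (8 * B')"
    have \<eta>: "0 < \<eta>" using \<epsilon> B' by (simp add: \<eta>_def)
    define D where "D = \<eta> powr (- 1 / (q - 1))"
    have D: "0 < D" using \<eta> by (simp add: D_def)
    obtain p where p: "integrable leb_itv (\<lambda>x. \<bar>g x - w x * poly p x\<bar> powr ?q')"
      "(LINT x|leb_itv. \<bar>g x - w x * poly p x\<bar> powr ?q') < \<epsilon> / (8 * D)"
      using weighted_polynomial_density[OF g q', of "\<epsilon> / (8 * D)" w "\<lambda>x. x"] \<epsilon> D w by auto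
    let ?p = "\<lambda>x. w x * poly p x"
    have pc: "continuous_on {-1..1} ?p" by (intro continuous_intros w)
    have pm: "?p \<in> borel_measurable leb_itv"
      by (rule continuous_imp_measurable_on_sets_lebesgue) (auto intro: continuous_on_subset[OF pc])
    have gpm: "(\<lambda>x. g x - ?p x) \<in> borel_measurable leb_itv" using g(1) pm by (rule borel_measurable_diff)
    have est: "\<bar>(LINT x|leb_itv. z x * g x) - (LINT x|leb_itv. z x * ?p x)\<bar> \<le> \<epsilon> / 4"
      if z: "z \<in> borel_measurable leb_itv" "integrable leb_itv (\<lambda>x. \<bar>z x\<bar> powr q)" "(LINT x|leb_itv. \<bar>z x\<bar> powr q) \<le> B'" for z
    proof -
      have i1: "integrable leb_itv (\<lambda>x. z x * g x)" by (rule Lq_pairing(1)[OF q z(1,2) g \<eta>])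
      have i2: "integrable leb_itv (\<lambda>x. z x * (g x - ?p x))" by (rule Lq_pairing(1)[OF q z(1,2) gpm p(1) \<eta>])
      have i3: "integrable leb_itv (\<lambda>x. z x * ?p x)"
        using Bochner_Integration.integrable_diff[OF i1 i2] by (simp add: right_diff_distrib)
      have "(LINT x|leb_itv. z x * g x) - (LINT x|leb_itv. z x * ?p x) = (LINT x|leb_itv. z x * (g x - ?p x))"
        using Bochner_Integration.integral_diff[OF i1 i3] by (simp add: right_diff_distrib)
      also have "\<bar>\<dots>\<bar> \<le> \<eta> * (LINT x|leb_itv. \<bar>z x\<bar> powr q) + D * (LINT x|leb_itv. \<bar>g x - ?p x\<bar> powr ?q')"
        unfolding D_def by (rule Lq_pairing(2)[OF q z(1,2) gpm p(1) \<eta>])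
      also have "\<dots> \<le> \<eta> * B' + D * (\<epsilon> / (8 * D))"
        using z(3) p(2) \<eta> D by (intro add_mono mult_left_mono) auto
      also have "\<dots> = \<epsilon> / 4" using D B' by (simp add: \<eta>_def)
      finally show ?thesis .
    qed
    obtain N where N: "\<And>n. n \<ge> N \<Longrightarrow> norm ((LINT x|leb_itv. u n x * ?p x) - (LINT x|leb_itv. v x * ?p x)) < \<epsilon> / 4"
      using LIMSEQ_D[OF lim[of p], of "\<epsilon> / 4"] \<epsilon> by auto
    show "\<exists>N. \<forall>n\<ge>N. norm ((LINT x|leb_itv. u n x * g x) - (LINT x|leb_itv. v x * g x)) < \<epsilon>"
    proof (intro exI[of _ "max N 1"] allI impI)
      fix n assume n: "max N 1 \<le> n"
      have "\<bar>(LINT x|leb_itv. u n x * g x) - (LINT x|leb_itv. u n x * ?p x)\<bar> \<le> \<epsilon> / 4"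
        using n B B' by (intro est um) (auto intro: order_trans)
      moreover have "\<bar>(LINT x|leb_itv. v x * g x) - (LINT x|leb_itv. v x * ?p x)\<bar> \<le> \<epsilon> / 4"
        by (intro est vm B')
      moreover have "\<bar>(LINT x|leb_itv. u n x * ?p x) - (LINT x|leb_itv. v x * ?p x)\<bar> < \<epsilon> / 4"
        using N[of n] n by simp
      ultimately show "norm ((LINT x|leb_itv. u n x * g x) - (LINT x|leb_itv. v x * g x)) < \<epsilon>"
        unfolding real_norm_def using \<epsilon> by linarith
    qed
  qed
qed

section \<open>Periodic coefficients\<close>

lemma periodic_int:
  assumes "\<And>x. p (x + 2) = p (x::real)"
  shows "p (x + 2 * of_int k) = p x"
proof (induction k rule: int_induct[of _ 0])
  case (step1 i)
  then show ?case using assms[of "x + 2 * of_int i"] by (simp add: algebra_simps)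
next
  case (step2 i)
  then show ?case using assms[of "x + 2 * of_int (i - 1)"] by (simp add: algebra_simps)
qed simp

lemma even_shift_into_unit_interval:
  "\<exists>k::int. -1 \<le> x - 2 * of_int k \<and> x - 2 * of_int k < (1::real)"
proof -
  define k where "k = \<lfloor>(x + 1) / 2\<rfloor>"
  have "of_int k \<le> (x + 1) / 2" "(x + 1) / 2 < of_int k + 1"
    unfolding k_def by (rule of_int_floor_le, rule real_of_int_floor_add_one_gt)
  then show ?thesis by (intro exI[of _ k]) auto
qed

lemma interval_cell:
  fixes a :: "nat \<Rightarrow> real"
  assumes "a 0 < x" "x < a m" "\<And>i. i \<le> m \<Longrightarrow> x \<noteq> a i"
  shows "\<exists>i<m. a i < x \<and> x < a (Suc i)"
  using assms
proof (induction m)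
  case (Suc m)
  show ?case
  proof (cases "x < a m")
    case True
    then show ?thesis using Suc by (meson le_Suc_eq less_Suc_eq)
  next
    case False
    then show ?thesis using Suc.prems(2) Suc.prems(3)[of m] by (auto intro!: exI[of _ m])
  qed
qed simp

text \<open>Outside the even translates of the division points \<open>p\<close> is continuous, and these are countably many.\<close>
lemma piecewise_lipschitz_bounded_measurable:
  assumes pl: "piecewise_lipschitz p" and per: "\<And>x. p (x + 2) = p (x::real)"
  shows "\<exists>B. \<forall>x. \<bar>p x\<bar> \<le> B" and "p \<in> borel_measurable borel"
proof -
  obtain m :: nat and a :: "nat \<Rightarrow> real" where a: "a 0 = -1" "a m = 1"
    and lip: "\<And>i. i < m \<Longrightarrow> a i < a (Suc i) \<and> (\<exists>L. L-lipschitz_on {a i<..<a (Suc i)} p)"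
    using pl unfolding piecewise_lipschitz_def by blast
  let ?I = "\<lambda>i. {a i<..<a (Suc i)}"
  have cell: "\<exists>i<m. x \<in> ?I i" if "-1 \<le> x" "x < 1" "x \<notin> a ` {..m}" for x
  proof -
    have "x \<noteq> a 0" using that(3) by auto
    then show ?thesis using interval_cell[of a x m] a that by auto
  qed
  have red: "\<exists>k::int. -1 \<le> x - 2 * of_int k \<and> x - 2 * of_int k < 1" for x :: real
    by (rule even_shift_into_unit_interval)
  have pk: "p (x - 2 * of_int k) = p x" for x k
    using periodic_int[of p, OF per, of "x - 2 * of_int k" k] by simp
  have "bounded (p ` ?I i)" if "i < m" for i
    using lip[OF that] by (auto intro!: bounded_uniformly_continuous_image lipschitz_on_uniformly_continuous)
  then have "bounded (\<Union>i<m. p ` ?I i)" by (intro bounded_UN) auto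
  moreover have "bounded (p ` a ` {..m})" by (intro finite_imp_bounded) auto
  ultimately have "bounded ((\<Union>i<m. p ` ?I i) \<union> p ` a ` {..m})" by simp
  then obtain B where B: "\<And>y. y \<in> (\<Union>i<m. p ` ?I i) \<union> p ` a ` {..m} \<Longrightarrow> \<bar>y\<bar> \<le> B" unfolding bounded_iff by force
  have "\<bar>p x\<bar> \<le> B" for x
  proof -
    obtain k :: int where k: "-1 \<le> x - 2 * of_int k" "x - 2 * of_int k < 1" using red by blast
    have "p (x - 2 * of_int k) \<in> (\<Union>i<m. p ` ?I i) \<union> p ` a ` {..m}"
      using cell[OF k] by blast
    then show ?thesis using B pk[of x k] by metis
  qed
  then show "\<exists>B. \<forall>x. \<bar>p x\<bar> \<le> B" by blast
  define X where "X = (\<lambda>(y, k::int). y + 2 * of_int k) ` (a ` {..m} \<times> UNIV)"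
  have "countable X" unfolding X_def by (intro countable_image countable_SIGMA) (auto intro: countable_finite)
  moreover have "continuous_on (- X) p"
  proof (rule continuous_at_imp_continuous_on, rule ballI)
    fix x assume x: "x \<in> - X"
    obtain k :: int where k: "-1 \<le> x - 2 * of_int k" "x - 2 * of_int k < 1" using red by blast
    have "x - 2 * of_int k \<notin> a ` {..m}"
    proof
      assume "x - 2 * of_int k \<in> a ` {..m}"
      then have "(\<lambda>(y, k::int). y + 2 * of_int k) (x - 2 * of_int k, k) \<in> X" unfolding X_def by blast
      with x show False by simp
    qed
    from cell[OF k this] obtain i where i: "i < m" "x - 2 * of_int k \<in> ?I i" by blast
    have "continuous_on (?I i) p" using lip[OF i(1)] lipschitz_on_continuous_on by blast
    then have "isCont p (x - 2 * of_int k)" using i(2) by (simp add: continuous_on_eq_continuous_at)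
    moreover have "isCont (\<lambda>z. z - 2 * of_int k) x" by (intro continuous_intros)
    ultimately have "isCont (\<lambda>z. p (z - 2 * of_int k)) x" by (rule isCont_o2[rotated])
    then show "isCont p x" by (simp add: pk)
  qed
  ultimately show "p \<in> borel_measurable borel"
    by (rule borel_measurable_continuous_countable_exceptions)
qed

lemma AE_leb_itv_from_lborel:
  assumes "AE x in lborel. Q x"
  shows "AE x in leb_itv. Q x"
proof -
  have "AE x in lebesgue. Q x" using assms by (rule AE_completion)
  then show ?thesis by (subst AE_restrict_space_iff) auto
qed

text \<open>The essential bound on one period holds on the whole line by periodicity, and scaling preserves null sets.\<close>
lemma AE_bound_rescaled:
  assumes per: "\<And>x. p (x + 2) = p (x::real)" and m: "p \<in> borel_measurable borel"
    and ae: "AE x in leb_itv. \<bar>p x\<bar> \<le> M" and n: "1 \<le> n"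
  shows "AE x in leb_itv. \<bar>rescale p n x\<bar> \<le> M"
proof -
  note [measurable] = m
  define Q where "Q x \<longleftrightarrow> (x \<in> itv \<longrightarrow> \<bar>p x\<bar> \<le> M)" for x
  have Qm [measurable]: "Measurable.pred borel Q" unfolding Q_def by measurable
  have "AE x in lebesgue. Q x" using ae unfolding Q_def by (subst (asm) AE_restrict_space_iff) auto
  then have "AE x in lborel. Q x" by (subst (asm) AE_completion_iff) auto
  then have "AE x in lborel. Q (- (2 * of_int k) + 1 * x)" for k :: int
    by (intro AE_borel_affine[OF _ Qm, of 1]) simp
  then have 1: "AE x in lborel. \<forall>k::int. Q (- (2 * of_int k) + 1 * x)" by (simp add: AE_all_countable)
  have "range (\<lambda>k::int. 2 * of_int k - 1 :: real) \<in> null_sets lborel"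
    by (rule countable_imp_null_set_lborel) simp
  then have 2: "AE x in lborel. x \<notin> range (\<lambda>k::int. 2 * of_int k - 1 :: real)" by (rule AE_not_in)
  have 3: "AE x in lborel. \<bar>p x\<bar> \<le> M"
    using 1 2
  proof eventually_elim
    case (elim x)
    obtain k :: int where "-1 \<le> x - 2 * of_int k" "x - 2 * of_int k < 1"
      using even_shift_into_unit_interval by blast
    moreover have "x - 2 * of_int k \<noteq> -1" using elim(2) by (auto simp: algebra_simps)
    ultimately have "x - 2 * of_int k \<in> itv" by auto
    then have "\<bar>p (x - 2 * of_int k)\<bar> \<le> M" using elim(1)[rule_format, of k] by (simp add: Q_def)
    then show ?case using periodic_int[of p, OF per, of "x - 2 * of_int k" k] by simp
  qed
  have "AE x in lborel. \<bar>p (0 + real n * x)\<bar> \<le> M"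
    by (rule AE_borel_affine[OF _ _ 3]) (use n in auto)
  then show ?thesis unfolding rescale_def by (intro AE_leb_itv_from_lborel) simp
qed

lemma borel_imp_leb_itv: "f \<in> borel_measurable borel \<Longrightarrow> f \<in> borel_measurable leb_itv"
  by (intro measurable_restrict_space1 measurable_completion) simp

lemma LINT_itv_eq_integral:
  fixes h :: "real \<Rightarrow> real"
  assumes "integrable leb_itv h"
  shows "(LINT x|leb_itv. h x) = integral {-1..1} h"
proof -
  have "(LINT x|leb_itv. h x) = integral itv h" by (rule lebesgue_integral_eq_integral[OF assms]) simp
  then show ?thesis by (simp add: integral_open_interval_real)
qed

lemma bounded_borel_integrable_on:
  fixes B :: "real \<Rightarrow> real"
  assumes "B \<in> borel_measurable borel" "\<And>x. x \<in> {a..b} \<Longrightarrow> \<bar>B x\<bar> \<le> C"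
  shows "B integrable_on {a..b}"
proof (rule measurable_bounded_by_integrable_imp_integrable[where g = "\<lambda>_. C"])
  show "B \<in> borel_measurable (lebesgue_on {a..b})"
    using assms(1) by (intro measurable_restrict_space1 measurable_completion) simp
qed (use assms(2) in auto)

text \<open>The interval has the length of a period, but for even \<open>k\<close> it does not start at an end point of \<open>[-1, 1]\<close>;
  the induction moves it in steps of half a period.\<close>
lemma periodic_integral_zero:
  fixes B :: "real \<Rightarrow> real"
  assumes m: "B \<in> borel_measurable borel" and bd: "\<And>x. \<bar>B x\<bar> \<le> C"
    and per: "\<And>x. B (x + 2) = B x" and zero: "integral {-1..1} B = 0"
  shows "(B has_integral 0) {of_int k..of_int k + 2}"
proof -
  have int: "B integrable_on {a..b}" for a b using bounded_borel_integrable_on[OF m bd] .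
  have shift: "integral {a + 2..b + 2} B = integral {a..b} B" if "a \<le> b" for a b
  proof -
    have "((\<lambda>x. B (1 *\<^sub>R x + 2)) has_integral integral {a + 2..b + 2} B /\<^sub>R 1 ^ DIM(real)) (cbox ((a + 2 - 2) /\<^sub>R 1) ((b + 2 - 2) /\<^sub>R 1))"
      by (rule has_integral_affinity') (use int[of "a + 2" "b + 2"] in \<open>auto simp: has_integral_integral\<close>)
    then have "(B has_integral integral {a + 2..b + 2} B) {a..b}" by (simp add: per)
    then show ?thesis by (simp add: integral_unique)
  qed
  have step: "integral {a + 1..a + 1 + 2} B = integral {a..a + 2} B" for a
  proof -
    have "integral {a..a + 1} B + integral {a + 1..a + 2} B = integral {a..a + 2} B"
      "integral {a + 1..a + 2} B + integral {a + 2..a + 3} B = integral {a + 1..a + 3} B"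
      by (intro Henstock_Kurzweil_Integration.integral_combine int; simp)+
    moreover have "integral {a + 2..a + 3} B = integral {a..a + 1} B"
      using shift[of a "a + 1"] by (simp add: add.assoc)
    ultimately show ?thesis by (simp add: add.assoc)
  qed
  have "integral {of_int k..of_int k + 2} B = 0"
  proof (induction k rule: int_induct[of _ "-1"])
    case base
    then show ?case using zero by simp
  next
    case (step1 i)
    then show ?case using step[of "of_int i"] by simp
  next
    case (step2 i)
    then show ?case using step[of "of_int (i - 1)"] by simp
  qed
  then show ?thesis using int has_integral_integral by metis
qed

text \<open>Cut \<open>[-1, 1]\<close> into \<open>n\<close> cells of length \<open>2 / n\<close>.  On each of them \<open>B (n x)\<close> has mean zero, so \<open>q\<close> may be
  replaced by its oscillation, which is at most \<open>2 L / n\<close>.\<close>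
lemma oscillating_integral_tendsto_zero:
  fixes B q :: "real \<Rightarrow> real"
  assumes m: "B \<in> borel_measurable borel" and bd: "\<And>x. \<bar>B x\<bar> \<le> C"
    and per: "\<And>x. B (x + 2) = B x" and zero: "integral {-1..1} B = 0"
    and q: "L-lipschitz_on {-1..1} q"
  shows "(\<lambda>n. integral {-1..1} (\<lambda>x. B (real n * x) * q x)) \<longlonglongrightarrow> 0"
proof -
  have C: "0 \<le> C" using bd[of 0] by linarith
  have L: "0 \<le> L" using q lipschitz_on_nonneg by blast
  have qc: "continuous_on {-1..1} q" using q lipschitz_on_continuous_on by blast
  have bound: "\<bar>integral {-1..1} (\<lambda>x. B (real n * x) * q x)\<bar> \<le> 4 * C * L * inverse (real n)" if n: "0 < n" for n
  proof -
    let ?h = "\<lambda>x. B (real n * x) * q x"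
    let ?c = "\<lambda>i::nat. -1 + 2 * real i / real n"
    have cn: "?c n = 1" using n by simp
    have mono: "?c i \<le> ?c j" if "i \<le> j" for i j using that n by (simp add: divide_right_mono)
    have Bn: "(\<lambda>x. B (real n * x)) \<in> borel_measurable borel" using m by measurable
    have hint: "?h integrable_on {-1..1}"
    proof -
      obtain D where D: "\<And>x. x \<in> {-1..1} \<Longrightarrow> \<bar>q x\<bar> \<le> D" using continuous_bounded_Icc[OF qc] by blast
      show ?thesis
      proof (rule measurable_bounded_by_integrable_imp_integrable[where g = "\<lambda>_. C * D"])
        show "?h \<in> borel_measurable (lebesgue_on {-1..1})"
          using Bn by (intro borel_measurable_times measurable_restrict_space1[OF measurable_completion]
            continuous_imp_measurable_on_sets_lebesgue qc) auto
        show "norm (?h x) \<le> C * D" if "x \<in> {-1..1}" for x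
          using bd[of "real n * x"] D[OF that] C by (auto simp: abs_mult intro!: mult_mono)
      qed auto
    qed
    have hint': "?h integrable_on {?c i..?c j}" if "j \<le> n" for i j
      using mono[of j n] cn that by (intro integrable_subinterval_real[OF hint]) auto
    have cell: "\<bar>integral {?c i..?c (Suc i)} ?h\<bar> \<le> 4 * C * L / (real n * real n)" if i: "i < n" for i
    proof -
      let ?S = "{?c i..?c (Suc i)}"
      have sub: "?S \<subseteq> {-1..1}" using mono[of "Suc i" n] mono[of 0 i] cn i by auto
      have len: "?c (Suc i) - ?c i = 2 / real n" using n by (simp add: field_simps)
      have "((\<lambda>x. B (real n *\<^sub>R x + 0)) has_integral 0 /\<^sub>R real n ^ DIM(real))
          (cbox ((of_int (2 * int i - int n) - 0) /\<^sub>R real n) ((of_int (2 * int i - int n) + 2 - 0) /\<^sub>R real n))"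
        by (rule has_integral_affinity') (use periodic_integral_zero[OF m bd per zero, of "2 * int i - int n"] n in auto)
      moreover have "(of_int (2 * int i - int n) - 0) /\<^sub>R real n = ?c i"
        "(of_int (2 * int i - int n) + 2 - 0) /\<^sub>R real n = ?c (Suc i)" using n by (auto simp: field_simps)
      ultimately have B0: "((\<lambda>x. B (real n * x)) has_integral 0) ?S" by simp
      have "((\<lambda>x. ?h x - q (?c i) * B (real n * x)) has_integral (integral ?S ?h - q (?c i) * 0)) ?S"
        using i by (intro has_integral_diff has_integral_mult_right B0 integrable_integral hint') auto
      then have eq: "((\<lambda>x. B (real n * x) * (q x - q (?c i))) has_integral integral ?S ?h) ?S"
        by (simp add: algebra_simps)
      have "norm (integral ?S ?h) \<le> (C * (L * (2 / real n))) * measure lborel ?S"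
      proof (rule has_integral_bound_real[OF _ finite.emptyI eq])
        show "0 \<le> C * (L * (2 / real n))" using C L by simp
        fix x assume "x \<in> ?S - {}"
        then have x: "x \<in> ?S" by simp
        moreover have "?c i \<in> ?S" using mono[of i "Suc i"] by simp
        ultimately have x': "x \<in> {-1..1}" "?c i \<in> {-1..1}" using sub by blast+
        have "\<bar>q x - q (?c i)\<bar> \<le> L * \<bar>x - ?c i\<bar>"
          using lipschitz_onD[OF q x'] by (simp add: dist_real_def)
        also have "\<dots> \<le> L * (2 / real n)"
          using x len L by (intro mult_left_mono) auto
        finally show "norm (B (real n * x) * (q x - q (?c i))) \<le> C * (L * (2 / real n))"
          using bd[of "real n * x"] C unfolding real_norm_def abs_mult by (intro mult_mono) auto
      qed
      also have "measure lborel ?S = 2 / real n"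
        using mono[of i "Suc i"] len by simp
      finally show ?thesis by (simp add: mult_ac)
    qed
    have "\<bar>integral {?c 0..?c k} ?h\<bar> \<le> real k * (4 * C * L / (real n * real n))" if "k \<le> n" for k
      using that
    proof (induction k)
      case (Suc k)
      have "integral {?c 0..?c k} ?h + integral {?c k..?c (Suc k)} ?h = integral {?c 0..?c (Suc k)} ?h"
        using Suc.prems mono[of 0 k] mono[of k "Suc k"] hint'[of "Suc k" 0]
        by (intro Henstock_Kurzweil_Integration.integral_combine) auto
      moreover have tri: "\<bar>u + v\<bar> \<le> real (Suc k) * K" if "\<bar>u\<bar> \<le> real k * K" "\<bar>v\<bar> \<le> K" for u v K :: real
      proof -
        have "real (Suc k) * K = real k * K + K" by (simp add: distrib_right)
        then show ?thesis using that by linarith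
      qed
      have "\<bar>integral {?c 0..?c k} ?h + integral {?c k..?c (Suc k)} ?h\<bar> \<le> real (Suc k) * (4 * C * L / (real n * real n))"
        by (rule tri[OF Suc.IH cell]) (use Suc.prems in auto)
      ultimately show ?case by (simp only:)
    qed simp
    from this[of n] cn show ?thesis using n by (simp add: field_simps)
  qed
  show ?thesis
  proof (rule Lim_null_comparison)
    show "\<forall>\<^sub>F n in sequentially. norm (integral {-1..1} (\<lambda>x. B (real n * x) * q x)) \<le> 4 * C * L * inverse (real n)"
      using eventually_gt_at_top[of 0] by eventually_elim (use bound in simp)
    show "(\<lambda>n. 4 * C * L * inverse (real n)) \<longlonglongrightarrow> 0"
      using tendsto_mult[OF tendsto_const lim_inverse_n] by simp
  qed
qed

lemma poly_lipschitz: "\<exists>L. L-lipschitz_on {-1..1} (poly (q :: real poly))"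
proof -
  obtain L where L: "0 < L" "\<And>x. x \<in> {-1..1} \<Longrightarrow> \<bar>poly (pderiv q) x\<bar> \<le> L"
    using continuous_bounded_Icc[OF continuous_on_poly[OF continuous_on_id], of "-1" 1 "pderiv q"] by blast
  have "L-lipschitz_on {-1..1} (poly q)"
  proof (rule lipschitz_onI)
    fix x y :: real assume xy: "x \<in> {-1..1}" "y \<in> {-1..1}"
    have "norm (poly q x - poly q y) \<le> L * norm (x - y)"
      by (rule field_differentiable_bound[of "{-1..1}" "poly q" "poly (pderiv q)"])
         (use xy L in \<open>auto intro: DERIV_subset[OF poly_DERIV]\<close>)
    then show "dist (poly q x) (poly q y) \<le> L * dist x y" by (simp add: dist_norm)
  qed (use L in simp)
  then show ?thesis by blast
qed

lemma periodic_mean_tendsto: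
  assumes m: "A \<in> borel_measurable borel" and bd: "\<And>x. \<bar>A x\<bar> \<le> C" and per: "\<And>x. A (x + 2) = A (x::real)"
  shows "(\<lambda>n. LINT x|leb_itv. A (real n * x) * poly q x) \<longlonglongrightarrow> (LINT x|leb_itv. mean A * poly q x)"
proof -
  interpret finite_measure leb_itv by (rule finite_measure_lebesgue_on) simp
  define B where "B x = A x - mean A" for x
  have Bm: "B \<in> borel_measurable borel" unfolding B_def using m by measurable
  have Bb: "\<bar>B x\<bar> \<le> C + \<bar>mean A\<bar>" for x using bd[of x] unfolding B_def by linarith
  have Bp: "B (x + 2) = B x" for x by (simp add: B_def per)
  obtain L where L: "L-lipschitz_on {-1..1} (poly q)" using poly_lipschitz by blast
  have qc: "continuous_on {-1..1} (poly q)" by (intro continuous_intros)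
  obtain D where D: "\<And>x. x \<in> {-1..1} \<Longrightarrow> \<bar>poly q x\<bar> \<le> D" using continuous_bounded_Icc[OF qc] by blast
  have int: "integrable leb_itv (\<lambda>x. f (real n * x) * poly q x)"
    if f: "f \<in> borel_measurable borel" "\<And>x. \<bar>f x\<bar> \<le> K" for f n K
  proof (rule integrable_const_bound[where B = "K * D"])
    have "(\<lambda>x. f (real n * x)) \<in> borel_measurable borel" using f(1) by measurable
    moreover have "poly q \<in> borel_measurable borel" by (intro borel_measurable_continuous_onI continuous_intros)
    ultimately show "(\<lambda>x. f (real n * x) * poly q x) \<in> borel_measurable leb_itv"
      by (intro borel_imp_leb_itv borel_measurable_times)
    have "0 \<le> K" using f(2)[of 0] by linarith
    then show "AE x in leb_itv. norm (f (real n * x) * poly q x) \<le> K * D"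
      using f(2) D by (intro AE_I2) (auto simp: abs_mult intro!: mult_mono)
  qed
  have Bi: "integrable leb_itv B"
    using Bb by (intro integrable_const_bound[where B = "C + \<bar>mean A\<bar>"] borel_imp_leb_itv Bm) auto
  have Ai: "integrable leb_itv A"
    using bd by (intro integrable_const_bound[where B = C] borel_imp_leb_itv m) auto
  have "(LINT x|leb_itv. B x) = (LINT x|leb_itv. A x) - (LINT x|leb_itv. mean A)"
    unfolding B_def by (intro Bochner_Integration.integral_diff Ai) simp
  also have "\<dots> = 0" by (simp add: mean_def measure_restrict_space)
  finally have "integral {-1..1} B = 0" using LINT_itv_eq_integral[OF Bi] by simp
  from oscillating_integral_tendsto_zero[OF Bm Bb Bp this L]
  have "(\<lambda>n. LINT x|leb_itv. B (real n * x) * poly q x) \<longlonglongrightarrow> 0"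
    using LINT_itv_eq_integral[OF int[OF Bm Bb]] by simp
  moreover have "(LINT x|leb_itv. B (real n * x) * poly q x) =
      (LINT x|leb_itv. A (real n * x) * poly q x) - (LINT x|leb_itv. mean A * poly q x)" for n
    unfolding B_def left_diff_distrib
    by (rule Bochner_Integration.integral_diff[OF int[OF m bd] int[of "\<lambda>_. mean A" "\<bar>mean A\<bar>" 0]]) auto
  ultimately show ?thesis by (simp add: LIM_zero_iff)
qed

section \<open>Convergence of the solutions\<close>

text \<open>The moments of \<open>b U\<close> against odd functions reduce to those of \<open>U\<close> against even ones by the equation.
  This turns the limit of a product into a limit of \<open>U\<close> alone.\<close>
lemma polynomial_moments_tendsto:
  assumes bd: "\<And>j. boundary_data P M (b j) (U j)" and bd': "boundary_data P M b' U'"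
    and lim: "\<And>n. 0 < n \<Longrightarrow> (\<lambda>j. LINT x|angles. arctan (b j x) * sin (real n * x)) \<longlonglongrightarrow>
        (LINT x|angles. arctan (b' x) * sin (real n * x))"
  shows "(\<lambda>j. LINT x|angles. U j x * poly q (cos x)) \<longlonglongrightarrow> (LINT x|angles. U' x * poly q (cos x))"
    and "(\<lambda>j. LINT x|angles. (b j x * U j x) * (sin x * poly q (cos x))) \<longlonglongrightarrow>
        (LINT x|angles. (b' x * U' x) * (sin x * poly q (cos x)))"
proof -
  note mt = moments_tendsto[OF bd bd' lim]
  have gen: "Q = (\<lambda>f. continuous_on {0..pi} f \<and> (\<lambda>j. LINT x|angles. v j x * f x) \<longlonglongrightarrow> (LINT x|angles. v' x * f x)) \<Longrightarrow>
     (\<forall>f g. Q f \<longrightarrow> Q g \<longrightarrow> Q (\<lambda>x. f x + g x)) \<and> (\<forall>f c. Q f \<longrightarrow> Q (\<lambda>x. c * f x))"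
    if v: "\<And>j. integrable angles (v j)" "integrable angles v'" for Q :: "(real \<Rightarrow> real) \<Rightarrow> bool" and v :: "nat \<Rightarrow> real \<Rightarrow> real" and v'
  proof (intro conjI allI impI)
    fix f g assume Q: "Q = (\<lambda>f. continuous_on {0..pi} f \<and> (\<lambda>j. LINT x|angles. v j x * f x) \<longlonglongrightarrow> (LINT x|angles. v' x * f x))"
      and "Q f" "Q g"
    then have c: "continuous_on {0..pi} f" "continuous_on {0..pi} g"
      and l: "(\<lambda>j. LINT x|angles. v j x * f x) \<longlonglongrightarrow> (LINT x|angles. v' x * f x)"
        "(\<lambda>j. LINT x|angles. v j x * g x) \<longlonglongrightarrow> (LINT x|angles. v' x * g x)" by auto
    have "(LINT x|angles. w x * (f x + g x)) = (LINT x|angles. w x * f x) + (LINT x|angles. w x * g x)"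
      if "integrable angles w" for w
      unfolding distrib_left
      by (intro Bochner_Integration.integral_add integrable_mult_continuous that c)
    then show "Q (\<lambda>x. f x + g x)"
      using tendsto_add[OF l] v c unfolding Q by (auto intro!: continuous_intros)
  next
    fix f and c :: real assume Q: "Q = (\<lambda>f. continuous_on {0..pi} f \<and> (\<lambda>j. LINT x|angles. v j x * f x) \<longlonglongrightarrow> (LINT x|angles. v' x * f x))"
      and "Q f"
    then have cf: "continuous_on {0..pi} f" and l: "(\<lambda>j. LINT x|angles. v j x * f x) \<longlonglongrightarrow> (LINT x|angles. v' x * f x)" by auto
    from tendsto_mult[OF tendsto_const[of c] l] show "Q (\<lambda>x. c * f x)"
      using cf unfolding Q by (auto simp: mult.left_commute intro!: continuous_intros)
  qed
  have Ui: "integrable angles (U j)" "integrable angles U'" for j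
    using boundary_data.U_int[OF bd] boundary_data.U_int[OF bd'] by auto
  have W: "integrable angles (\<lambda>x. b x * U x)"
    and Wsin: "0 < k \<Longrightarrow> (LINT x|angles. (b x * U x) * sin (real k * x)) = - (LINT x|angles. U x * cos (real k * x))"
    if "boundary_data P M b U" for b U k
  proof -
    interpret boundary_data P M b U by (rule that)
    show "integrable angles (\<lambda>x. b x * U x)" using V_int by (simp add: V_def[abs_def])
    show "0 < k \<Longrightarrow> (LINT x|angles. (b x * U x) * sin (real k * x)) = - (LINT x|angles. U x * cos (real k * x))"
      using V_sin[of k] by (simp add: V_def)
  qed
  define Q1 where "Q1 = (\<lambda>f. continuous_on {0..pi} f \<and> (\<lambda>j. LINT x|angles. U j x * f x) \<longlonglongrightarrow> (LINT x|angles. U' x * f x))"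
  have "Q1 (\<lambda>x. cos (real k * x))" for k
    unfolding Q1_def using mt[of k] by (auto intro!: continuous_intros)
  with gen[OF Ui Q1_def] have "Q1 (\<lambda>x. poly q (cos x))"
    by (intro cos_poly_induct[of Q1]) blast+
  then show "(\<lambda>j. LINT x|angles. U j x * poly q (cos x)) \<longlonglongrightarrow> (LINT x|angles. U' x * poly q (cos x))"
    by (simp add: Q1_def)
  define Q2 where "Q2 = (\<lambda>f. continuous_on {0..pi} f \<and> (\<lambda>j. LINT x|angles. (b j x * U j x) * f x) \<longlonglongrightarrow> (LINT x|angles. (b' x * U' x) * f x))"
  have "Q2 (\<lambda>x. sin (real k * x))" if "0 < k" for k
    unfolding Q2_def Wsin[OF bd that] Wsin[OF bd' that] using tendsto_minus[OF mt[of k]] by (auto intro!: continuous_intros)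
  with gen[OF W[OF bd] W[OF bd'] Q2_def] have "Q2 (\<lambda>x. sin x * poly q (cos x))"
    by (intro sin_poly_induct[of Q2]) blast+
  then show "(\<lambda>j. LINT x|angles. (b j x * U j x) * (sin x * poly q (cos x))) \<longlonglongrightarrow>
        (LINT x|angles. (b' x * U' x) * (sin x * poly q (cos x)))"
    by (simp add: Q2_def)
qed

text \<open>In the variable \<open>x\<close> the odd trigonometric polynomials are \<open>sqrt (1 - x\<^sup>2)\<close> times polynomials, which is the
  weight used for the products.\<close>
lemma weak_convergence_of_data:
  fixes t :: "nat \<Rightarrow> real \<Rightarrow> real" and f :: "nat \<Rightarrow> real \<Rightarrow> real"
  assumes P: "0 < P" and M: "0 \<le> M" and q: "1 < q" "q < inverse (1/2 + arctan M / pi)"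
    and tm: "\<And>n. 1 \<le> n \<Longrightarrow> t n \<in> borel_measurable leb_itv" "t' \<in> borel_measurable leb_itv"
    and fm: "\<And>n. 1 \<le> n \<Longrightarrow> f n \<in> borel_measurable leb_itv" "f' \<in> borel_measurable leb_itv"
    and fM: "\<And>n. 1 \<le> n \<Longrightarrow> AE x in leb_itv. \<bar>f n x\<bar> \<le> M" "AE x in leb_itv. \<bar>f' x\<bar> \<le> M"
    and bd: "\<And>n. 1 \<le> n \<Longrightarrow> boundary_data P M (\<lambda>x. f n (cos x)) (\<lambda>x. - (sin x * t n (cos x)))"
    and bd': "boundary_data P M (\<lambda>x. f' (cos x)) (\<lambda>x. - (sin x * t' (cos x)))"
    and lim: "\<And>k. 0 < k \<Longrightarrow> (\<lambda>n. LINT x|angles. arctan (f n (cos x)) * sin (real k * x)) \<longlonglongrightarrow>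
        (LINT x|angles. arctan (f' (cos x)) * sin (real k * x))"
  shows "weakly_converges q t t'" and "weakly_converges q (\<lambda>n x. f n x * t n x) (\<lambda>x. f' x * t' x)"
proof -
  obtain C where C: "\<And>b t. t \<in> borel_measurable leb_itv \<Longrightarrow> boundary_data P M b (\<lambda>x. - (sin x * t (cos x))) \<Longrightarrow>
    t \<in> Lq q \<and> (LINT x|leb_itv. \<bar>t x\<bar> powr q) \<le> C"
    using Lq_uniform_bound[OF P M q] by blast
  let ?U = "\<lambda>j x. - (sin x * t (Suc j) (cos x))" and ?U' = "\<lambda>x. - (sin x * t' (cos x))"
  have bdS: "boundary_data P M (\<lambda>x. f (Suc j) (cos x)) (?U j)" for j by (rule bd) simp
  have limS: "(\<lambda>j. LINT x|angles. arctan (f (Suc j) (cos x)) * sin (real k * x)) \<longlonglongrightarrow>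
        (LINT x|angles. arctan (f' (cos x)) * sin (real k * x))" if "0 < k" for k
    using LIMSEQ_Suc[OF lim[OF that]] .
  note pm = polynomial_moments_tendsto[OF bdS bd' limS]
  show "weakly_converges q t t'"
  proof (rule weak_convergence_from_polynomials[where w = "\<lambda>_. 1" and B = C])
    show "(\<lambda>n. LINT x|leb_itv. t n x * (1 * poly p x)) \<longlonglongrightarrow> (LINT x|leb_itv. t' x * (1 * poly p x))" for p
    proof (rule LIMSEQ_imp_Suc)
      have eq: "(LINT x|leb_itv. z x * (1 * poly p x)) = - (LINT x|angles. - (sin x * z (cos x)) * poly p (cos x))" for z :: "real \<Rightarrow> real"
        by (subst cos_substitution) (simp add: mult.assoc)
      show "(\<lambda>n. LINT x|leb_itv. t (Suc n) x * (1 * poly p x)) \<longlonglongrightarrow> (LINT x|leb_itv. t' x * (1 * poly p x))"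
        unfolding eq by (intro tendsto_minus pm)
    qed
  qed (use C tm bd bd' q in \<open>auto intro!: continuous_intros\<close>)
  have prod: "(\<lambda>x. h x * z x) \<in> Lq q \<and> (LINT x|leb_itv. \<bar>h x * z x\<bar> powr q) \<le> M powr q * C"
    if z: "z \<in> Lq q" "(LINT x|leb_itv. \<bar>z x\<bar> powr q) \<le> C" and h: "h \<in> borel_measurable leb_itv" "AE x in leb_itv. \<bar>h x\<bar> \<le> M" for h z :: "real \<Rightarrow> real"
  proof -
    have zm [measurable]: "z \<in> borel_measurable leb_itv" and zi: "integrable leb_itv (\<lambda>x. \<bar>z x\<bar> powr q)" using z by (auto simp: Lq_def)
    note [measurable] = h(1)
    have ae: "AE x in leb_itv. \<bar>h x * z x\<bar> powr q \<le> M powr q * \<bar>z x\<bar> powr q"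
      using h(2)
    proof eventually_elim
      case (elim x)
      then have "\<bar>h x\<bar> powr q \<le> M powr q" using q(1) by (intro powr_mono2) auto
      then show ?case by (simp add: abs_mult powr_mult mult_right_mono)
    qed
    have m: "(\<lambda>x. \<bar>h x * z x\<bar> powr q) \<in> borel_measurable leb_itv" by measurable
    have i: "integrable leb_itv (\<lambda>x. \<bar>h x * z x\<bar> powr q)"
      by (rule Bochner_Integration.integrable_bound[OF integrable_mult_right[OF zi, of "M powr q"] m]) (use ae in auto)
    have "(LINT x|leb_itv. \<bar>h x * z x\<bar> powr q) \<le> (LINT x|leb_itv. M powr q * \<bar>z x\<bar> powr q)"
      by (rule integral_mono_AE[OF i integrable_mult_right[OF zi] ae])
    also have "\<dots> \<le> M powr q * C" using z(2) by (simp add: mult_left_mono)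
    finally show ?thesis using i by (simp add: Lq_def)
  qed
  show "weakly_converges q (\<lambda>n x. f n x * t n x) (\<lambda>x. f' x * t' x)"
  proof (rule weak_convergence_from_polynomials[where w = "\<lambda>x. sqrt (1 - x\<^sup>2)" and B = "M powr q * C"])
    show "(\<lambda>n. LINT x|leb_itv. (f n x * t n x) * (sqrt (1 - x\<^sup>2) * poly p x)) \<longlonglongrightarrow>
        (LINT x|leb_itv. (f' x * t' x) * (sqrt (1 - x\<^sup>2) * poly p x))" for p
    proof (rule LIMSEQ_imp_Suc)
      have eq: "(LINT x|leb_itv. (h x * z x) * (sqrt (1 - x\<^sup>2) * poly p x)) =
          - (LINT x|angles. (h (cos x) * - (sin x * z (cos x))) * (sin x * poly p (cos x)))" for h z :: "real \<Rightarrow> real"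
      proof -
        have "(LINT x|leb_itv. (h x * z x) * (sqrt (1 - x\<^sup>2) * poly p x)) =
          (LINT x|angles. - ((h (cos x) * - (sin x * z (cos x))) * (sin x * poly p (cos x))))"
          unfolding cos_substitution[of "\<lambda>x. (h x * z x) * (sqrt (1 - x\<^sup>2) * poly p x)"]
        proof (rule Bochner_Integration.integral_cong[OF refl])
          fix x assume "x \<in> space angles"
          then have "0 < sin x" by (intro sin_gt_zero) auto
          then have "sqrt (1 - (cos x)\<^sup>2) = sin x" by (simp flip: sin_squared_eq)
          then show "sin x * (h (cos x) * z (cos x) * (sqrt (1 - (cos x)\<^sup>2) * poly p (cos x))) =
             - ((h (cos x) * - (sin x * z (cos x))) * (sin x * poly p (cos x)))" by simp
        qed
        then show ?thesis by (simp only: integral_minus)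
      qed
      show "(\<lambda>n. LINT x|leb_itv. (f (Suc n) x * t (Suc n) x) * (sqrt (1 - x\<^sup>2) * poly p x)) \<longlonglongrightarrow>
        (LINT x|leb_itv. (f' x * t' x) * (sqrt (1 - x\<^sup>2) * poly p x))"
        unfolding eq by (intro tendsto_minus pm)
    qed
    show "0 < sqrt (1 - x\<^sup>2)" if "-1 < x" "x < 1" for x :: real
      using that abs_square_less_1[of x] by (simp add: abs_less_iff)
    show "(\<lambda>x. f n x * t n x) \<in> Lq q" "(LINT x|leb_itv. \<bar>f n x * t n x\<bar> powr q) \<le> M powr q * C" if "1 \<le> n" for n
      using prod[OF _ _ fm(1)[OF that] fM(1)[OF that]] C[OF tm(1)[OF that] bd[OF that]] by auto
    show "(\<lambda>x. f' x * t' x) \<in> Lq q"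
      using prod[OF _ _ fm(2) fM(2)] C[OF tm(2) bd'] by auto
  qed (use q in \<open>auto intro!: continuous_intros\<close>)
qed

lemma boundary_data_mono:
  assumes "boundary_data P M b U" "M \<le> M'"
  shows "boundary_data P M' b U"
proof -
  interpret boundary_data P M b U by (rule assms)
  show ?thesis
    by unfold_locales (use P M assms(2) U_int U_nonneg U_mass moments b_le in \<open>auto elim: eventually_mono\<close>)
qed

lemma
  assumes "0 < P"
  shows const_solution_measurable: "const_solution P c \<in> borel_measurable leb_itv"
    and const_solution_nonpos: "const_solution P c x \<le> 0"
proof -
  show "const_solution P c \<in> borel_measurable leb_itv"
    unfolding const_solution_def[abs_def] by (intro borel_imp_leb_itv) measurable
  show "const_solution P c x \<le> 0"
    using assms by (auto simp: const_solution_def intro!: divide_nonneg_nonneg mult_nonneg_nonneg add_nonneg_nonneg)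
qed

lemma exponent_range_nonempty:
  assumes "0 \<le> M"
  shows "\<exists>q. 1 < q \<and> q < inverse (1/2 + arctan M / pi)"
proof (rule dense)
  have "0 \<le> arctan M / pi" "arctan M / pi < 1/2"
    using assms arctan_ubound[of M] by (auto simp: divide_simps)
  then have "0 < 1/2 + arctan M / pi" "1/2 + arctan M / pi < 1" by linarith+
  then show "1 < inverse (1/2 + arctan M / pi)" by (rule one_less_inverse)
qed

lemma const_solution_is_solution:
  assumes P: "0 < P"
  shows "is_solution P (\<lambda>_. c) (const_solution P c)"
proof -
  obtain q where q: "1 < q" "q < inverse (1/2 + arctan \<bar>c\<bar> / pi)"
    using exponent_range_nonempty[of "\<bar>c\<bar>"] by auto
  note bd = constant_boundary_data[OF P, of c]
  have "const_solution P c \<in> Lq q"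
    using Lq_uniform_bound[OF P _ q] const_solution_measurable[OF P] bd by auto
  then show ?thesis
    using boundary_data_solution[OF bd _ q(1)] const_solution_nonpos[OF P] by auto
qed

text \<open>The constant sequence \<open>s\<close> converges weakly to the explicit solution, hence equals it; the sign of the
  difference is a test function that shows this.\<close>
lemma const_solution_unique:
  assumes P: "0 < P" and s: "is_solution P (\<lambda>_. c) s"
  shows "AE x in leb_itv. s x = const_solution P c x"
proof -
  let ?t = "const_solution P c" and ?M = "\<bar>c\<bar>"
  interpret finite_measure leb_itv by (rule finite_measure_lebesgue_on) simp
  have bds: "boundary_data P ?M (\<lambda>_. c) (\<lambda>x. - (sin x * s (cos x)))"
    using solution_boundary_data[OF s P, of ?M] by simp
  have sm: "s \<in> borel_measurable leb_itv" using s by (auto simp: is_solution_def Lq_def)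
  note tm = const_solution_measurable[OF P, of c]
  obtain q where q: "1 < q" "q < inverse (1/2 + arctan ?M / pi)"
    using exponent_range_nonempty[of ?M] by auto
  have "weakly_converges q (\<lambda>_. s) ?t"
    by (rule weak_convergence_of_data(1)[OF P _ q, where f = "\<lambda>_ _. c" and f' = "\<lambda>_. c"])
       (use sm tm bds constant_boundary_data[OF P, of c] in auto)
  then have sq: "s \<in> Lq q" "?t \<in> Lq q"
    and lim: "\<And>g. g \<in> Lq (q / (q - 1)) \<Longrightarrow> (\<lambda>n::nat. LINT x|leb_itv. s x * g x) \<longlonglongrightarrow> (LINT x|leb_itv. ?t x * g x)"
    unfolding weakly_converges_def by auto
  have eq: "(LINT x|leb_itv. s x * g x) = (LINT x|leb_itv. ?t x * g x)" if "g \<in> Lq (q / (q - 1))" for g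
    using LIMSEQ_unique[OF tendsto_const lim[OF that]] .
  have si: "integrable leb_itv s" "integrable leb_itv ?t" using sq Lq_integrable[OF q(1)] by auto
  \<comment> \<open>A bounded function belongs to every Lebesgue space over a bounded interval.\<close>
  define g where "g x = sgn (s x - ?t x)" for x
  have gm [measurable]: "g \<in> borel_measurable leb_itv" unfolding g_def using sm tm by measurable
  have gb: "\<bar>g x\<bar> \<le> 1" for x by (simp add: g_def abs_sgn_eq)
  have "g \<in> Lq (q / (q - 1))"
  proof -
    have "integrable leb_itv (\<lambda>x. \<bar>g x\<bar> powr (q / (q - 1)))"
      by (rule integrable_const_bound[where B = 1]) (use q(1) gb in \<open>auto intro!: powr_le1\<close>)
    then show ?thesis using gm by (simp add: Lq_def)
  qed
  from eq[OF this] have "(LINT x|leb_itv. s x * g x) = (LINT x|leb_itv. ?t x * g x)" .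
  moreover have gi: "integrable leb_itv (\<lambda>x. v x * g x)" if "integrable leb_itv v" for v
    by (rule Bochner_Integration.integrable_bound[OF that])
       (use that gb in \<open>auto simp: abs_mult mult_left_le\<close>)
  ultimately have "(LINT x|leb_itv. s x * g x - ?t x * g x) = 0"
    using Bochner_Integration.integral_diff[OF gi[OF si(1)] gi[OF si(2)]] by simp
  moreover have "s x * g x - ?t x * g x = \<bar>s x - ?t x\<bar>" for x
    by (simp add: g_def abs_sgn flip: left_diff_distrib)
  ultimately have "(LINT x|leb_itv. \<bar>s x - ?t x\<bar>) = 0" by simp
  then have "AE x in leb_itv. \<bar>s x - ?t x\<bar> = 0"
    using si by (subst (asm) integral_nonneg_eq_0_iff_AE) auto
  then show ?thesis by eventually_elim simp
qed

theorem theorem2: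
  fixes P :: real
    and p :: "real \<Rightarrow> real"
    and t :: "nat \<Rightarrow> real \<Rightarrow> real"
  assumes "P > 0"
    and "piecewise_lipschitz p"
    and "\<And>x. p (x + 2) = p x"
    and "\<And>n. n \<ge> 1 \<Longrightarrow> is_solution P (rescale p n) (t n)"
  shows "is_solution P (\<lambda>_. f_eff p) (t_eff P p)
      \<and> (\<forall>s. is_solution P (\<lambda>_. f_eff p) s \<longrightarrow> (AE x in leb_itv. s x = t_eff P p x))
      \<and> beta p < 1/2
      \<and> (\<forall>q. 1 < q \<and> q < inverse (1/2 + beta p) \<longrightarrow>
            weakly_converges q t (t_eff P p)
          \<and> weakly_converges q (\<lambda>n x. rescale p n x * t n x) (\<lambda>x. f_eff p * t_eff P p x))
      \<and> (\<lambda>n. - (LINT x|leb_itv. rescale p n x * t n x)) \<longlonglongrightarrow> f_eff p * P"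
proof -
  note P = assms(1) and per = assms(3) and sol = assms(4)
  interpret finite_measure leb_itv by (rule finite_measure_lebesgue_on) simp
  obtain B where B: "\<And>x. \<bar>p x\<bar> \<le> B" using piecewise_lipschitz_bounded_measurable(1)[OF assms(2,3)] by blast
  note pm [measurable] = piecewise_lipschitz_bounded_measurable(2)[OF assms(2,3)]
  define M where "M = Linf_norm (rescale p 1)"
  let ?e = "esssup leb_itv (\<lambda>x. ereal \<bar>rescale p 1 x\<bar>)"
  have r1: "rescale p 1 = p" by (simp add: rescale_def fun_eq_iff)
  have rm: "rescale p n \<in> borel_measurable leb_itv" for n
    unfolding rescale_def by (intro borel_imp_leb_itv) measurable
  have ae: "AE x in leb_itv. ereal \<bar>rescale p 1 x\<bar> \<le> ?e" by (rule esssup_AE)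
  have em: "emeasure leb_itv (space leb_itv) = 2"
    by (simp add: emeasure_restrict_space)
  have e0: "0 \<le> ?e"
  proof (rule ccontr)
    assume "\<not> 0 \<le> ?e"
    then have neg: "?e < 0" by simp
    from ae have "AE x in leb_itv. False"
    proof eventually_elim
      case (elim x)
      have "0 \<le> ereal \<bar>rescale p 1 x\<bar>" by simp
      with elim neg show ?case by (meson leD order_trans)
    qed
    then have "emeasure leb_itv (space leb_itv) = 0"
      unfolding eventually_False ae_filter_eq_bot_iff .
    with em show False by simp
  qed
  have "?e \<le> ereal B"
    unfolding r1
  proof (rule esssup_I)
    note [measurable] = borel_imp_leb_itv[OF pm]
    show "(\<lambda>x. ereal \<bar>p x\<bar>) \<in> borel_measurable leb_itv" by measurable
  qed (use B in simp)
  with e0 have eM: "?e = ereal M"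
    unfolding M_def Linf_norm_def by (cases ?e) auto
  have M0: "0 \<le> M" using e0 eM by simp
  have pM: "AE x in leb_itv. \<bar>p x\<bar> \<le> M" using ae[unfolded eM, unfolded r1] by simp
  have pMn: "AE x in leb_itv. \<bar>rescale p n x\<bar> \<le> M" if "1 \<le> n" for n
    by (rule AE_bound_rescaled[OF per pm pM that])
  have beta: "beta p = arctan M / pi" by (simp add: beta_def M_def)
  have beta_half: "beta p < 1/2" unfolding beta using arctan_ubound[of M] by (simp add: divide_simps)
  define A where "A x = arctan (p x)" for x
  have Am: "A \<in> borel_measurable borel" unfolding A_def by measurable
  have Ab: "\<bar>A x\<bar> \<le> pi / 2" for x using arctan_bounded[of "p x"] by (auto simp: A_def abs_le_iff)
  have Ai: "integrable leb_itv A"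
    by (rule integrable_const_bound[where B = "pi / 2"]) (use Ab borel_imp_leb_itv[OF Am] in auto)
  have AM: "\<bar>mean A\<bar> \<le> arctan M"
  proof -
    have "AE x in leb_itv. \<bar>A x\<bar> \<le> arctan M"
      using pM
    proof eventually_elim
      case (elim x)
      then have "p x \<le> M" "- M \<le> p x" by auto
      then have "arctan (p x) \<le> arctan M" "arctan (- M) \<le> arctan (p x)" by (simp_all only: arctan_le_iff)
      then show ?case by (simp add: A_def arctan_minus abs_le_iff)
    qed
    then have "(LINT x|leb_itv. \<bar>A x\<bar>) \<le> (LINT x|leb_itv. arctan M)"
      by (intro integral_mono_AE integrable_abs Ai) auto
    then have "(LINT x|leb_itv. \<bar>A x\<bar>) \<le> 2 * arctan M" by (simp add: measure_restrict_space)
    moreover have "\<bar>LINT x|leb_itv. A x\<bar> \<le> (LINT x|leb_itv. \<bar>A x\<bar>)" by (rule integral_abs_bound)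
    ultimately have "\<bar>LINT x|leb_itv. A x\<bar> \<le> 2 * arctan M" by (rule order_trans[rotated])
    then show ?thesis by (simp add: mean_def abs_mult)
  qed
  \<comment> \<open>The absolute value of the mean is at most \<open>arctan M < \<pi> / 2\<close>, where \<open>arctan\<close> inverts the tangent.\<close>
  define c where "c = f_eff p"
  have cA: "c = tan (mean A)" by (simp only: c_def f_eff_def r1 A_def[abs_def])
  have ac: "arctan c = mean A"
    unfolding cA using AM arctan_ubound[of M] by (intro arctan_tan) auto
  have cM: "\<bar>c\<bar> \<le> M"
  proof -
    have "arctan c \<le> arctan M" "arctan (- M) \<le> arctan c" using AM unfolding ac arctan_minus by auto
    then show ?thesis by (simp add: arctan_le_iff abs_le_iff)
  qed
  have te: "t_eff P p = const_solution P c" by (simp add: t_eff_def c_def)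
  have bd: "boundary_data P M (\<lambda>x. rescale p n (cos x)) (\<lambda>x. - (sin x * t n (cos x)))" if "1 \<le> n" for n
    by (rule solution_boundary_data[OF sol[OF that] P rm M0 pMn[OF that]])
  have bd': "boundary_data P M (\<lambda>x. c) (\<lambda>x. - (sin x * const_solution P c (cos x)))"
    by (rule boundary_data_mono[OF constant_boundary_data[OF P] cM])
  have lim: "(\<lambda>n. LINT x|angles. arctan (rescale p n (cos x)) * sin (real k * x)) \<longlonglongrightarrow>
      (LINT x|angles. arctan c * sin (real k * x))" for k
  proof -
    obtain Q where Q: "\<And>x. sin (real k * x) = sin x * poly Q (cos x)" using sin_multiple_poly by blast
    have "(LINT x|angles. F (cos x) * sin (real k * x)) = (LINT x|leb_itv. F x * poly Q x)" for F :: "real \<Rightarrow> real"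
      unfolding Q cos_substitution[of "\<lambda>x. F x * poly Q x"] by (simp add: mult.left_commute)
    note conv = this[of "\<lambda>x. arctan (rescale p _ x)"] this[of "\<lambda>_. arctan c"]
    have "A (x + 2) = A x" for x by (simp add: A_def per)
    from periodic_mean_tendsto[OF Am Ab this, of Q] show ?thesis
      unfolding conv unfolding ac by (simp only: A_def[abs_def] rescale_def)
  qed
  have tm: "t n \<in> borel_measurable leb_itv" if "1 \<le> n" for n
    using sol[OF that] by (auto simp: is_solution_def Lq_def)
  have weak: "weakly_converges q t (const_solution P c)"
    "weakly_converges q (\<lambda>n x. rescale p n x * t n x) (\<lambda>x. c * const_solution P c x)"
    if q: "1 < q" "q < inverse (1/2 + arctan M / pi)" for q
    by (rule weak_convergence_of_data[OF P M0 q, where f = "rescale p" and f' = "\<lambda>_. c"];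
        use tm rm const_solution_measurable[OF P] pMn cM bd bd' lim in simp)+
  have sol_eff: "is_solution P (\<lambda>_. c) (const_solution P c)" by (rule const_solution_is_solution[OF P])
  have final: "(\<lambda>n. - (LINT x|leb_itv. rescale p n x * t n x)) \<longlonglongrightarrow> c * P"
  proof -
    obtain q where q: "1 < q" "q < inverse (1/2 + arctan M / pi)" using exponent_range_nonempty[OF M0] by auto
    have one: "(\<lambda>_. 1) \<in> Lq (q / (q - 1))" by (simp add: Lq_def)
    have "\<forall>g\<in>Lq (q / (q - 1)). (\<lambda>n. LINT x|leb_itv. rescale p n x * t n x * g x) \<longlonglongrightarrow>
        (LINT x|leb_itv. c * const_solution P c x * g x)"
      using weak(2)[OF q] by (simp add: weakly_converges_def)
    from bspec[OF this one]
    have "(\<lambda>n. LINT x|leb_itv. rescale p n x * t n x) \<longlonglongrightarrow> (LINT x|leb_itv. c * const_solution P c x)"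
      by simp
    moreover have "(LINT x|leb_itv. c * const_solution P c x) = - (c * P)"
      using sol_eff by (simp add: is_solution_def)
    ultimately have "(\<lambda>n. LINT x|leb_itv. rescale p n x * t n x) \<longlonglongrightarrow> - (c * P)" by (simp only:)
    from tendsto_minus[OF this] show ?thesis by simp
  qed
  show ?thesis
    unfolding te c_def[symmetric] beta
    using sol_eff const_solution_unique[OF P, of c] beta_half[unfolded beta] weak final by blast
qed

end
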